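(* Let $\Bbbk$ be a field and let $A$ be an associative unital $\Bbbk$-algebra of finite dimension $n\geq 3$. The following statements are equivalent: 1. $\operatorname{Frobdim}(A)=(n-1)^2$. 2. $A$ admits a basis $\mathcal{B}=\{1,v_2,\dots,v_n\}$ as a $\Bbbk$-vector space such that $v_iv_j=0$ for all $i,j=2,\dots,n$. 3. $A$ is (isomorphic to) the radical square zero algebra $\Bbbk Q/\langle \alpha_i\alpha_j : i,j=2,\dots,n\rangle$, where $Q$ is the quiver with exactly one vertex and exactly $n-1$ arrows $\alpha_2,\dots,\alpha_n$, all of them loops at that vertex.
   Context: A nearly Frobenius coproduct on an associative unital $\Bbbk$-algebra $A$ is a homomorphism of $A$-bimodules $\Delta:A\to A\otimes_{\Bbbk} A$, where $A\otimes_{\Bbbk} A$ has the bimodule structure $a\cdot(b\otimes c)\cdot d=ab\otimes cd$. The Frobenius space $\mathscr{E}_A$ is the $\Bbbk$-vector space of all nearly Frobenius coproducts on $A$, and $\operatorname{Frobdim}(A)=\dim_{\Bbbk}\mathscr{E}_A$. For a quiver $Q$, $\Bbbk Q$ denotes its path algebra (basis: all paths, including the trivial path at each vertex; product: concatenation of paths when possible and $0$ otherwise). A radical square zero algebra is the quotient $\Bbbk Q/I$ where $I$ is the two-sided ideal generated by all paths of length $2$. *)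

theory Defs
  imports
    "HOL-Algebra.QuotRing"
    "Jordan_Normal_Form.Missing_VectorSpace"
    "Graph_Theory.Arc_Walk"
begin

text \<open>
  The locale \<^locale>\<open>algebra\<close> of HOL-Algebra requires commutativity; here the multiplication
  is only associative and unital.
\<close>

locale assoc_algebra = vectorspace K A + ring A for K and A (structure) +
  assumes smult_mult_left:
      "\<lbrakk>c \<in> carrier K; x \<in> carrier A; y \<in> carrier A\<rbrakk> \<Longrightarrow>
        (c \<odot>\<^bsub>A\<^esub> x) \<otimes>\<^bsub>A\<^esub> y = c \<odot>\<^bsub>A\<^esub> (x \<otimes>\<^bsub>A\<^esub> y)"
    and smult_mult_right:
      "\<lbrakk>c \<in> carrier K; x \<in> carrier A; y \<in> carrier A\<rbrakk> \<Longrightarrow>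
        x \<otimes>\<^bsub>A\<^esub> (c \<odot>\<^bsub>A\<^esub> y) = c \<odot>\<^bsub>A\<^esub> (x \<otimes>\<^bsub>A\<^esub> y)"

definition algebra_isomorphic ::
  "('k, 'm) ring_scheme \<Rightarrow> ('k, 'a, 'n) module_scheme \<Rightarrow> ('k, 'b, 'l) module_scheme \<Rightarrow> bool"
  where "algebra_isomorphic K A B \<longleftrightarrow> ring_iso A B \<inter> LinearCombinations.module_hom K A B \<noteq> {}"

text \<open>
  A vector space without multiplication is encoded, as in \<^const>\<open>direct_sum\<close>, by a
  \<^typ>\<open>('k, 'a) module\<close> record whose fields \<^const>\<open>mult\<close> and \<^const>\<open>one\<close> carry no meaning.

  The free vector space on a set \<open>S\<close> consists of the finitely supported functions on \<open>S\<close>,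
  extended by zero.
\<close>

definition free_module :: "('k, 'm) ring_scheme \<Rightarrow> 'x set \<Rightarrow> ('k, 'x \<Rightarrow> 'k) module"
  where "free_module K S =
    \<lparr>carrier = {f. (\<forall>x\<in>S. f x \<in> carrier K) \<and> (\<forall>x. x \<notin> S \<longrightarrow> f x = \<zero>\<^bsub>K\<^esub>)
                   \<and> finite {x. f x \<noteq> \<zero>\<^bsub>K\<^esub>}},
     mult = (\<lambda>f g x. \<zero>\<^bsub>K\<^esub>),
     one = (\<lambda>x. \<zero>\<^bsub>K\<^esub>),
     zero = (\<lambda>x. \<zero>\<^bsub>K\<^esub>),
     add = (\<lambda>f g x. f x \<oplus>\<^bsub>K\<^esub> g x),
     smult = (\<lambda>c f x. c \<otimes>\<^bsub>K\<^esub> f x)\<rparr>"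

definition free_gen :: "('k, 'm) ring_scheme \<Rightarrow> 'x \<Rightarrow> 'x \<Rightarrow> 'k"
  where "free_gen K x = (\<lambda>y. if y = x then \<one>\<^bsub>K\<^esub> else \<zero>\<^bsub>K\<^esub>)"

text \<open>
  The linear map of free vector spaces that sends the generator \<open>x\<close> to the generator \<open>h x\<close>.
\<close>

definition free_map :: "('k, 'm) ring_scheme \<Rightarrow> ('x \<Rightarrow> 'y) \<Rightarrow> ('x \<Rightarrow> 'k) \<Rightarrow> 'y \<Rightarrow> 'k"
  where "free_map K h f = (\<lambda>y. \<Oplus>\<^bsub>K\<^esub>x\<in>{x. f x \<noteq> \<zero>\<^bsub>K\<^esub> \<and> h x = y}. f x)"

text \<open>
  The quotient by a subspace or, if the multiplication of \<open>M\<close> is meaningful, of an algebra by a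
  two-sided ideal: \<^const>\<open>FactRing\<close> together with the induced scalar multiplication.
\<close>

definition quotient_module :: "('k, 'a, 'n) module_scheme \<Rightarrow> 'a set \<Rightarrow> ('k, 'a set) module"
  where "quotient_module M N =
    ring.extend (M Quot N) (module.fields (\<lambda>c X. \<Union>x\<in>X. N +>\<^bsub>M\<^esub> (c \<odot>\<^bsub>M\<^esub> x)))"


subsection \<open>Tensor products and nearly Frobenius coproducts\<close>

definition tensor_relations ::
  "('k, 'm) ring_scheme \<Rightarrow> ('k, 'a, 'n) module_scheme \<Rightarrow> ('k, 'b, 'l) module_scheme
    \<Rightarrow> ('a \<times> 'b \<Rightarrow> 'k) set"
  where "tensor_relations K V W =
    (let F = free_module K (carrier V \<times> carrier W); g = free_gen K in
      {g (v \<oplus>\<^bsub>V\<^esub> v', w) \<ominus>\<^bsub>F\<^esub> (g (v, w) \<oplus>\<^bsub>F\<^esub> g (v', w)) | v v' w.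
         v \<in> carrier V \<and> v' \<in> carrier V \<and> w \<in> carrier W} \<union>
      {g (v, w \<oplus>\<^bsub>W\<^esub> w') \<ominus>\<^bsub>F\<^esub> (g (v, w) \<oplus>\<^bsub>F\<^esub> g (v, w')) | v w w'.
         v \<in> carrier V \<and> w \<in> carrier W \<and> w' \<in> carrier W} \<union>
      {g (c \<odot>\<^bsub>V\<^esub> v, w) \<ominus>\<^bsub>F\<^esub> c \<odot>\<^bsub>F\<^esub> g (v, w) | c v w.
         c \<in> carrier K \<and> v \<in> carrier V \<and> w \<in> carrier W} \<union>
      {g (v, c \<odot>\<^bsub>W\<^esub> w) \<ominus>\<^bsub>F\<^esub> c \<odot>\<^bsub>F\<^esub> g (v, w) | c v w.
         c \<in> carrier K \<and> v \<in> carrier V \<and> w \<in> carrier W})"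

definition tensor_null ::
  "('k, 'm) ring_scheme \<Rightarrow> ('k, 'a, 'n) module_scheme \<Rightarrow> ('k, 'b, 'l) module_scheme
    \<Rightarrow> ('a \<times> 'b \<Rightarrow> 'k) set"
  where "tensor_null K V W =
    LinearCombinations.module.span K (free_module K (carrier V \<times> carrier W))
      (tensor_relations K V W)"

definition tensor_product ::
  "('k, 'm) ring_scheme \<Rightarrow> ('k, 'a, 'n) module_scheme \<Rightarrow> ('k, 'b, 'l) module_scheme
    \<Rightarrow> ('k, ('a \<times> 'b \<Rightarrow> 'k) set) module"
  where "tensor_product K V W =
    quotient_module (free_module K (carrier V \<times> carrier W)) (tensor_null K V W)"

text \<open>
  \<open>bimodule_act K A a t d\<close> is \<open>a \<cdot> t \<cdot> d\<close> for \<open>t\<close> in the tensor square of \<open>A\<close>: the map induced on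
  cosets by \<open>(b, c) \<mapsto> (a b, c d)\<close>, that is, \<open>a \<cdot> (b \<otimes> c) \<cdot> d = a b \<otimes> c d\<close>.
\<close>

definition bimodule_act ::
  "('k, 'm) ring_scheme \<Rightarrow> ('k, 'a, 'n) module_scheme \<Rightarrow> 'a \<Rightarrow> ('a \<times> 'a \<Rightarrow> 'k) set \<Rightarrow> 'a
    \<Rightarrow> ('a \<times> 'a \<Rightarrow> 'k) set"
  where "bimodule_act K A a t d =
    (\<Union>f\<in>t. tensor_null K A A +>\<^bsub>free_module K (carrier A \<times> carrier A)\<^esub>
             free_map K (\<lambda>(b, c). (a \<otimes>\<^bsub>A\<^esub> b, c \<otimes>\<^bsub>A\<^esub> d)) f)"

definition nearly_frobenius ::
  "('k, 'm) ring_scheme \<Rightarrow> ('k, 'a, 'n) module_scheme \<Rightarrow> ('a \<Rightarrow> ('a \<times> 'a \<Rightarrow> 'k) set) \<Rightarrow> bool"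
  where "nearly_frobenius K A \<Delta> \<longleftrightarrow>
    \<Delta> \<in> LinearCombinations.module_hom K A (tensor_product K A A) \<and>
    (\<forall>a\<in>carrier A. \<forall>x\<in>carrier A. \<forall>d\<in>carrier A.
       \<Delta> (a \<otimes>\<^bsub>A\<^esub> x \<otimes>\<^bsub>A\<^esub> d) = bimodule_act K A a (\<Delta> x) d)"

text \<open>
  Coproducts are taken in \<^const>\<open>extensional\<close> form, so that those agreeing on \<^term>\<open>carrier A\<close>
  are equal.
\<close>

definition frobenius_space ::
  "('k, 'm) ring_scheme \<Rightarrow> ('k, 'a, 'n) module_scheme
    \<Rightarrow> ('k, 'a \<Rightarrow> ('a \<times> 'a \<Rightarrow> 'k) set) module"
  where "frobenius_space K A = (let T = tensor_product K A A in
    \<lparr>carrier = {\<Delta> \<in> extensional (carrier A). nearly_frobenius K A \<Delta>},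
     mult = (\<lambda>\<Delta> \<Gamma>. \<lambda>x\<in>carrier A. \<zero>\<^bsub>T\<^esub>),
     one = (\<lambda>x\<in>carrier A. \<zero>\<^bsub>T\<^esub>),
     zero = (\<lambda>x\<in>carrier A. \<zero>\<^bsub>T\<^esub>),
     add = (\<lambda>\<Delta> \<Gamma>. \<lambda>x\<in>carrier A. \<Delta> x \<oplus>\<^bsub>T\<^esub> \<Gamma> x),
     smult = (\<lambda>c \<Delta>. \<lambda>x\<in>carrier A. c \<odot>\<^bsub>T\<^esub> \<Delta> x)\<rparr>)"

text \<open>
  The dimension is a natural number, meaningful when the Frobenius space is finite-dimensional, in
  particular for every finite-dimensional \<open>A\<close>.
\<close>

definition Frobdim :: "('k, 'm) ring_scheme \<Rightarrow> ('k, 'a, 'n) module_scheme \<Rightarrow> nat"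
  where "Frobdim K A = vectorspace.dim K (frobenius_space K A)"


subsection \<open>Path algebras\<close>

text \<open>
  A quiver is a \<^typ>\<open>('v, 'e) pre_digraph\<close>. A path is a triple of source, list of arrows and
  target, so that the trivial path at \<open>u\<close> is \<open>(u, [], u)\<close>.
\<close>

definition quiver_paths :: "('v, 'e) pre_digraph \<Rightarrow> ('v \<times> 'e list \<times> 'v) set"
  where "quiver_paths Q = {(u, p, w). pre_digraph.awalk Q u p w}"

text \<open>
  The coefficient of a product at a path \<open>(u, r, w)\<close> sums over all ways to write that path as the
  concatenation of \<open>(u, p, v)\<close> and \<open>(v, q, w)\<close>. The identity is the sum of the trivial paths; it
  lies in the carrier when \<open>Q\<close> has finitely many vertices.
\<close>

definition path_algebra ::
  "('k, 'm) ring_scheme \<Rightarrow> ('v, 'e) pre_digraph \<Rightarrow> ('k, 'v \<times> 'e list \<times> 'v \<Rightarrow> 'k) module"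
  where "path_algebra K Q = (free_module K (quiver_paths Q))
    \<lparr>mult := (\<lambda>f g (u, r, w).
       finsum K (\<lambda>(p, v, q). f (u, p, v) \<otimes>\<^bsub>K\<^esub> g (v, q, w))
         {(p, v, q). p @ q = r \<and> (u, p, v) \<in> quiver_paths Q \<and> (v, q, w) \<in> quiver_paths Q}),
     one := (\<lambda>(u, r, w). if u \<in> verts Q \<and> r = [] \<and> w = u then \<one>\<^bsub>K\<^esub> else \<zero>\<^bsub>K\<^esub>)\<rparr>"

definition radical_square_zero_algebra ::
  "('k, 'm) ring_scheme \<Rightarrow> ('v, 'e) pre_digraph \<Rightarrow> ('k, ('v \<times> 'e list \<times> 'v \<Rightarrow> 'k) set) module"
  where "radical_square_zero_algebra K Q =
    quotient_module (path_algebra K Q)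
      (Idl\<^bsub>path_algebra K Q\<^esub>
        {free_gen K (u, p, w) | u p w. (u, p, w) \<in> quiver_paths Q \<and> length p = 2})"

definition loop_quiver :: "nat \<Rightarrow> (unit, nat) pre_digraph"
  where "loop_quiver n = \<lparr>verts = {()}, arcs = {2..n}, tail = (\<lambda>i. ()), head = (\<lambda>i. ())\<rparr>"

end

theory Submission
  imports Defs
begin

text \<open>
  Write \<open>t = \<Delta> 1\<close> for a nearly Frobenius coproduct \<open>\<Delta>\<close>. The bimodule condition says that \<open>\<Delta>\<close> is
  determined by \<open>t\<close> and that \<open>a \<cdot> t = t \<cdot> a\<close> for all \<open>a\<close>. A linear form \<open>\<phi>\<close> on \<open>A\<close> contracts \<open>t\<close>
  to the element \<open>(id \<otimes> \<phi>) t\<close> of \<open>A\<close>, and the condition on \<open>t\<close> becomes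
  \<open>a ((id \<otimes> \<phi>) t) = (id \<otimes> \<phi>(\<cdot> a)) t\<close> (\<open>mult_slice\<close>). Hence knowing the contraction
  against \<open>\<phi>\<close> means knowing those against all translates \<open>\<phi>(\<cdot> a)\<close>. The dimension of the
  Frobenius space is bounded by counting how many linear forms are needed to determine \<open>\<Delta>\<close>
  (\<open>dim_le_card_separating\<close>).

  Let \<open>W\<^sub>\<phi>\<close> be the largest right ideal in the kernel of \<open>\<phi>\<close>. Contractions against \<open>m\<close> forms whose
  right ideals intersect in \<open>W\<close>, together with \<open>dim W\<close> forms that separate the points of \<open>W\<close>,
  determine \<open>\<Delta>\<close>, so the dimension is at most \<open>(m + dim W) n\<close> (\<open>frobdim_bound\<close>). This is less
  than \<open>(n - 1)\<^sup>2\<close> as soon as \<open>m + dim W \<le> n - 2\<close>. Suppose that the dimension is \<open>(n - 1)\<^sup>2\<close>, and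
  choose \<open>\<phi> \<noteq> 0\<close> with \<open>\<phi> 1 = 0\<close>. As \<open>1\<close> lies in the kernel of \<open>\<phi>\<close> but not in \<open>W = W\<^sub>\<phi>\<close>, the bound
  for \<open>m = 1\<close> forces \<open>dim W = n - 2\<close>, and the bound for \<open>m = 2\<close> forces the intersection of \<open>W\<close> with
  the kernel of any form to be a right ideal. Then \<open>A\<close> acts on \<open>W\<close> from the right by scalars,
  \<open>x a = \<chi>(a) x\<close> (\<open>right_mult_scalar_on_subspace\<close>).

  Let \<open>Z\<close> be the set of all \<open>z\<close> with \<open>a z = \<chi>(a) z\<close> for all \<open>a\<close>. Coproducts whose contraction
  against \<open>\<phi>\<close> vanishes correspond to tensors in \<open>Z \<otimes> W\<close>, and the contractions against \<open>\<phi>\<close> stay in a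
  proper subspace of \<open>A\<close>, so the dimension is at most \<open>(n - 1) + (n - 2) dim Z\<close>
  (\<open>frobdim_bound_eigenspace\<close>), which forces \<open>dim Z \<ge> n - 1\<close>. Since \<open>1\<close> is not in \<open>Z\<close>, the algebra is
  the direct sum of the scalars and \<open>Z\<close>. For \<open>w \<noteq> 0\<close> in \<open>W\<close> and \<open>z\<close> in \<open>Z\<close> the product \<open>w z\<close> equals
  both \<open>\<chi>(z) w\<close> and \<open>\<chi>(w) z\<close>; because \<open>dim Z \<ge> 2\<close>, this is possible only if \<open>\<chi>\<close> vanishes on \<open>Z\<close>,
  that is, if \<open>Z\<close> has square zero (\<open>eigenspace_square_zero\<close>).

  Conversely, if \<open>1, v\<^sub>2, \<dots>, v\<^sub>n\<close> is a basis with all \<open>v\<^sub>i v\<^sub>j = 0\<close>, then the tensors \<open>v\<^sub>i \<otimes> v\<^sub>j\<close> define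
  coproducts, and \<open>n \<ge> 3\<close> leaves room for no others (\<open>Frobdim_square_zero\<close>). Finally, the ideal
  generated by the paths of length two in the path algebra of the quiver of loops consists of the
  elements without constant and linear coefficients (\<open>J_eq\<close>), so the quotient is the algebra with
  such a basis given by the classes of the arrows.
\<close>

section \<open>Linear forms and dimensions of subspaces\<close>

definition linear_forms :: "('k, 'm) ring_scheme \<Rightarrow> ('k, 'a, 'n) module_scheme \<Rightarrow> ('a \<Rightarrow> 'k) set"
  where "linear_forms K V = {\<phi>. \<phi> \<in> carrier V \<rightarrow> carrier K
    \<and> (\<forall>x\<in>carrier V. \<forall>y\<in>carrier V. \<phi> (x \<oplus>\<^bsub>V\<^esub> y) = \<phi> x \<oplus>\<^bsub>K\<^esub> \<phi> y)
    \<and> (\<forall>c\<in>carrier K. \<forall>x\<in>carrier V. \<phi> (c \<odot>\<^bsub>V\<^esub> x) = c \<otimes>\<^bsub>K\<^esub> \<phi> x)}"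

lemma linear_formI:
  assumes "\<And>x. x \<in> carrier V \<Longrightarrow> \<phi> x \<in> carrier K"
    and "\<And>x y. x \<in> carrier V \<Longrightarrow> y \<in> carrier V \<Longrightarrow> \<phi> (x \<oplus>\<^bsub>V\<^esub> y) = \<phi> x \<oplus>\<^bsub>K\<^esub> \<phi> y"
    and "\<And>c x. c \<in> carrier K \<Longrightarrow> x \<in> carrier V \<Longrightarrow> \<phi> (c \<odot>\<^bsub>V\<^esub> x) = c \<otimes>\<^bsub>K\<^esub> \<phi> x"
  shows "\<phi> \<in> linear_forms K V"
  using assms unfolding linear_forms_def by blast

lemma linear_form_closed: "\<phi> \<in> linear_forms K V \<Longrightarrow> x \<in> carrier V \<Longrightarrow> \<phi> x \<in> carrier K"
  and linear_form_add: "\<phi> \<in> linear_forms K V \<Longrightarrow> x \<in> carrier V \<Longrightarrow> y \<in> carrier V \<Longrightarrow>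
    \<phi> (x \<oplus>\<^bsub>V\<^esub> y) = \<phi> x \<oplus>\<^bsub>K\<^esub> \<phi> y"
  and linear_form_smult: "\<phi> \<in> linear_forms K V \<Longrightarrow> c \<in> carrier K \<Longrightarrow> x \<in> carrier V \<Longrightarrow>
    \<phi> (c \<odot>\<^bsub>V\<^esub> x) = c \<otimes>\<^bsub>K\<^esub> \<phi> x"
  unfolding linear_forms_def by blast+

lemma (in Module.module) submodule_alt:
  "LinearCombinations.submodule R N M \<longleftrightarrow> N \<subseteq> carrier M \<and> \<zero>\<^bsub>M\<^esub> \<in> N
    \<and> (\<forall>x\<in>N. \<forall>y\<in>N. x \<oplus>\<^bsub>M\<^esub> y \<in> N) \<and> (\<forall>c\<in>carrier R. \<forall>x\<in>N. c \<odot>\<^bsub>M\<^esub> x \<in> N)"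
proof -
  have "Module.module R M" ..
  then show ?thesis unfolding LinearCombinations.submodule_def by (simp add: Ball_def) meson
qed

context vectorspace
begin

lemma subspace_alt:
  "VectorSpace.subspace K N V \<longleftrightarrow> N \<subseteq> carrier V \<and> \<zero>\<^bsub>V\<^esub> \<in> N
    \<and> (\<forall>x\<in>N. \<forall>y\<in>N. x \<oplus>\<^bsub>V\<^esub> y \<in> N) \<and> (\<forall>c\<in>carrier K. \<forall>x\<in>N. c \<odot>\<^bsub>V\<^esub> x \<in> N)"
  using vectorspace_axioms by (simp add: VectorSpace.subspace_def submodule_alt)

lemma linear_form_zero:
  assumes "\<phi> \<in> linear_forms K V"
  shows "\<phi> \<zero>\<^bsub>V\<^esub> = \<zero>\<^bsub>K\<^esub>"
  using linear_form_smult[OF assms, of "\<zero>\<^bsub>K\<^esub>" "\<zero>\<^bsub>V\<^esub>"] linear_form_closed[OF assms, of "\<zero>\<^bsub>V\<^esub>"]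
  by simp

lemma linear_form_ker_subspace:
  assumes "\<phi> \<in> linear_forms K V"
  shows "VectorSpace.subspace K {x \<in> carrier V. \<phi> x = \<zero>\<^bsub>K\<^esub>} V"
  unfolding subspace_alt
  using linear_form_zero[OF assms] linear_form_add[OF assms] linear_form_smult[OF assms] by auto

lemma subspace_inter:
  assumes "VectorSpace.subspace K U V" "VectorSpace.subspace K W V"
  shows "VectorSpace.subspace K (U \<inter> W) V"
  using assms unfolding subspace_alt by blast

lemma span_subset_subspace:
  assumes "VectorSpace.subspace K W V" "S \<subseteq> W"
  shows "span S \<subseteq> W"
  using assms span_is_subset[of S W] unfolding VectorSpace.subspace_def by blast

lemma linear_form_diff:
  assumes "\<phi> \<in> linear_forms K V" "x \<in> carrier V" "y \<in> carrier V"
  shows "\<phi> (x \<ominus>\<^bsub>V\<^esub> y) = \<phi> x \<ominus>\<^bsub>K\<^esub> \<phi> y"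
proof -
  have "\<phi> x = \<phi> (x \<ominus>\<^bsub>V\<^esub> y \<oplus>\<^bsub>V\<^esub> y)"
    using assms(2,3) by (simp add: a_minus_def M.a_assoc M.l_neg)
  also have "\<dots> = \<phi> (x \<ominus>\<^bsub>V\<^esub> y) \<oplus>\<^bsub>K\<^esub> \<phi> y"
    using assms by (intro linear_form_add) auto
  finally show ?thesis
    using linear_form_closed[OF assms(1)] assms(2,3)
    by (simp add: a_minus_def R.a_assoc R.r_neg)
qed

lemma subspace_diff:
  assumes "VectorSpace.subspace K W V" "x \<in> W" "y \<in> W"
  shows "x \<ominus>\<^bsub>V\<^esub> y \<in> W"
proof -
  have "\<ominus>\<^bsub>V\<^esub> y = (\<ominus>\<^bsub>K\<^esub> \<one>\<^bsub>K\<^esub>) \<odot>\<^bsub>V\<^esub> y"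
    using assms smult_minus_1[of y] unfolding subspace_alt by auto
  then have "\<ominus>\<^bsub>V\<^esub> y \<in> W" using assms unfolding subspace_alt by auto
  then show ?thesis using assms unfolding subspace_alt a_minus_def by auto
qed

text \<open>
  By induction on the number of forms: if one of them is nonzero at a vector \<open>w\<close> of \<open>W\<close>, then
  subtracting a multiple of \<open>w\<close> moves any vector of \<open>W\<close> into the kernel of this form, where the
  remaining forms separate points.
\<close>

lemma subspace_spanned_of_separating_forms:
  assumes "finite S" "\<And>s. s \<in> S \<Longrightarrow> \<phi> s \<in> linear_forms K V"
    and "VectorSpace.subspace K W V"
    and "\<And>x. x \<in> W \<Longrightarrow> (\<And>s. s \<in> S \<Longrightarrow> \<phi> s x = \<zero>\<^bsub>K\<^esub>) \<Longrightarrow> x = \<zero>\<^bsub>V\<^esub>"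
  shows "\<exists>B\<subseteq>W. finite B \<and> card B \<le> card S \<and> W \<subseteq> span B"
  using assms
proof (induction S arbitrary: W rule: finite_induct)
  case empty
  then have "W \<subseteq> {\<zero>\<^bsub>V\<^esub>}" by auto
  then show ?case by (intro exI[of _ "{}"]) (auto simp: span_empty)
next
  case (insert s S)
  define W' where "W' = W \<inter> {x \<in> carrier V. \<phi> s x = \<zero>\<^bsub>K\<^esub>}"
  have sub': "VectorSpace.subspace K W' V"
    unfolding W'_def using insert.prems by (intro subspace_inter linear_form_ker_subspace) auto
  have "\<exists>B\<subseteq>W'. finite B \<and> card B \<le> card S \<and> W' \<subseteq> span B"
    using insert.prems by (intro insert.IH sub') (auto simp: W'_def)
  then obtain B where B: "B \<subseteq> W'" "finite B" "card B \<le> card S" "W' \<subseteq> span B" by blast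
  show ?case
  proof (cases "W \<subseteq> W'")
    case True
    with B show ?thesis using insert.hyps by (intro exI[of _ B]) (auto simp: W'_def)
  next
    case False
    have WV: "W \<subseteq> carrier V" using insert.prems(2) unfolding subspace_alt by auto
    from False WV obtain w where w: "w \<in> W" "\<phi> s w \<noteq> \<zero>\<^bsub>K\<^esub>" unfolding W'_def by auto
    have wV: "w \<in> carrier V" using w WV by auto
    have \<phi>s: "\<phi> s \<in> linear_forms K V" using insert.prems by auto
    have \<phi>w: "\<phi> s w \<in> carrier K" using linear_form_closed[OF \<phi>s wV] .
    have BV: "insert w B \<subseteq> carrier V" using B wV WV unfolding W'_def by auto
    have sp: "VectorSpace.subspace K (span (insert w B)) V" using span_is_subspace[OF BV] .
    have "W \<subseteq> span (insert w B)"
    proof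
      fix x assume x: "x \<in> W"
      have xV: "x \<in> carrier V" using x WV by auto
      define c where "c = \<phi> s x \<otimes>\<^bsub>K\<^esub> inv\<^bsub>K\<^esub> (\<phi> s w)"
      have \<phi>x: "\<phi> s x \<in> carrier K" using linear_form_closed[OF \<phi>s xV] .
      have c: "c \<in> carrier K" unfolding c_def using \<phi>x \<phi>w w by auto
      have "c \<otimes>\<^bsub>K\<^esub> \<phi> s w = \<phi> s x"
        unfolding c_def using \<phi>x \<phi>w w field_Units by (simp add: R.m_assoc)
      then have "\<phi> s (x \<ominus>\<^bsub>V\<^esub> c \<odot>\<^bsub>V\<^esub> w) = \<zero>\<^bsub>K\<^esub>"
        using xV wV c \<phi>x by (simp add: linear_form_diff[OF \<phi>s] linear_form_smult[OF \<phi>s])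
      then have "x \<ominus>\<^bsub>V\<^esub> c \<odot>\<^bsub>V\<^esub> w \<in> W'"
        unfolding W'_def using xV wV c x w insert.prems(2) subspace_diff[of W]
        by (auto simp: subspace_alt)
      then have "x \<ominus>\<^bsub>V\<^esub> c \<odot>\<^bsub>V\<^esub> w \<in> span (insert w B)"
        using B(4) span_is_monotone[of B "insert w B"] by blast
      moreover have "c \<odot>\<^bsub>V\<^esub> w \<in> span (insert w B)"
        using sp span_mem[OF BV, of w] c unfolding subspace_alt by auto
      ultimately have "x \<ominus>\<^bsub>V\<^esub> c \<odot>\<^bsub>V\<^esub> w \<oplus>\<^bsub>V\<^esub> c \<odot>\<^bsub>V\<^esub> w \<in> span (insert w B)"
        using sp unfolding subspace_alt by auto
      then show "x \<in> span (insert w B)"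
        using xV wV c by (simp add: a_minus_def M.a_assoc M.l_neg)
    qed
    moreover have "card (insert w B) \<le> card (insert s S)"
      using B insert.hyps by (simp add: card_insert_if)
    moreover have "insert w B \<subseteq> W" using B w unfolding W'_def by auto
    ultimately show ?thesis using B by blast
  qed
qed

text \<open>
  All upper bounds on the dimension of the Frobenius space are instances of this lemma, so that no
  dimension of a tensor product or of a space of linear maps has to be computed.
\<close>

lemma dim_le_card_separating:
  assumes "finite S" "\<And>s. s \<in> S \<Longrightarrow> \<phi> s \<in> linear_forms K V"
    and "\<And>x. x \<in> carrier V \<Longrightarrow> (\<And>s. s \<in> S \<Longrightarrow> \<phi> s x = \<zero>\<^bsub>K\<^esub>) \<Longrightarrow> x = \<zero>\<^bsub>V\<^esub>"
  shows "fin_dim" "dim \<le> card S"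
proof -
  have "VectorSpace.subspace K (carrier V) V" unfolding subspace_alt by auto
  have "\<exists>B\<subseteq>carrier V. finite B \<and> card B \<le> card S \<and> carrier V \<subseteq> span B"
    by (rule subspace_spanned_of_separating_forms[where \<phi> = \<phi>])
      (use assms \<open>VectorSpace.subspace K (carrier V) V\<close> in auto)
  then obtain B where B: "B \<subseteq> carrier V" "finite B" "card B \<le> card S" "carrier V \<subseteq> span B" by auto
  moreover have "span B = carrier V" using B span_closed by blast
  ultimately show "fin_dim" "dim \<le> card S"
    unfolding fin_dim_def using gen_ge_dim[of B] by auto
qed

lemma subspace_basis:
  assumes "fin_dim" "VectorSpace.subspace K W V"
  obtains B where "finite B" "B \<subseteq> W" "lin_indpt B" "span B = W" "vectorspace.fin_dim K (vs W)"
    "vectorspace.dim K (vs W) = card B"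
proof -
  interpret W: vectorspace K "vs W" using subspace_is_vs[OF assms(2)] .
  have WV: "W \<subseteq> carrier V" using assms(2) unfolding subspace_alt by auto
  have sub: "LinearCombinations.submodule K W V" using assms(2) by auto
  note dep = span_li_not_depend[OF _ sub]
  have "\<exists>B. finite B \<and> maximal B (\<lambda>S. S \<subseteq> carrier (vs W) \<and> W.lin_indpt S)"
  proof (rule maximal_exists[where N = dim and B = "{}"])
    fix S assume "S \<subseteq> carrier (vs W) \<and> W.lin_indpt S"
    then show "finite S \<and> card S \<le> dim"
      using li_le_dim[OF assms(1), of S] WV dep(2)[of S] by auto
  next
    show "{} \<subseteq> carrier (vs W) \<and> W.lin_indpt {}" unfolding W.lin_dep_def by auto
  qed
  then obtain B where B: "finite B" "maximal B (\<lambda>S. S \<subseteq> carrier (vs W) \<and> W.lin_indpt S)" by blast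
  have basis: "W.basis B" using W.max_li_is_basis[OF B(2)] .
  have BW: "B \<subseteq> W" using basis unfolding W.basis_def by auto
  show ?thesis
  proof (rule that[of B])
    show "W.fin_dim" using basis B(1) unfolding W.fin_dim_def W.basis_def by auto
    show "W.dim = card B" using W.dim_basis[OF B(1) basis] .
    show "lin_indpt B" "span B = W" using basis dep[OF BW] unfolding W.basis_def by auto
  qed (use B BW in auto)
qed

text \<open>
  A vector of \<open>W\<close> outside \<open>U\<close> enlarges a basis of \<open>U\<close> to an independent set in \<open>W\<close>.
\<close>

lemma subspace_dim_less:
  assumes "fin_dim" "VectorSpace.subspace K U V" "VectorSpace.subspace K W V" "U \<subset> W"
  shows "vectorspace.dim K (vs U) < vectorspace.dim K (vs W)"
proof -
  obtain B where B: "finite B" "B \<subseteq> U" "lin_indpt B" "span B = U"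
    "vectorspace.dim K (vs U) = card B"
    using subspace_basis[OF assms(1,2)] by metis
  interpret W: vectorspace K "vs W" using subspace_is_vs[OF assms(3)] .
  have fdW: "W.fin_dim" using subspace_basis[OF assms(1,3)] by metis
  obtain y where y: "y \<in> W" "y \<notin> U" using assms(4) by auto
  have WV: "W \<subseteq> carrier V" using assms(3) unfolding subspace_alt by auto
  have "\<not> lin_dep (B \<union> {y})"
    using lin_dep_iff_in_span[of B y] B y WV assms(4) by blast
  then have "\<not> W.lin_dep (B \<union> {y})"
    using span_li_not_depend(2)[of "B \<union> {y}" W] assms(3,4) B y by auto
  then have "card (B \<union> {y}) \<le> W.dim"
    using W.li_le_dim(2)[OF fdW, of "B \<union> {y}"] B y assms(4) by auto
  moreover have "y \<notin> B" using B(2) y(2) by blast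
  then have "card (B \<union> {y}) = Suc (card B)" using B(1) by simp
  ultimately show ?thesis using B by auto
qed

text \<open>
  The dual basis. Its linearity comes from the uniqueness of the coefficients.
\<close>

lemma basis_coordinates:
  assumes "finite B" "basis B"
  obtains \<kappa> where "\<And>b. b \<in> B \<Longrightarrow> \<kappa> b \<in> linear_forms K V"
    and "\<And>b b'. b \<in> B \<Longrightarrow> b' \<in> B \<Longrightarrow> \<kappa> b b' = (if b = b' then \<one>\<^bsub>K\<^esub> else \<zero>\<^bsub>K\<^esub>)"
    and "\<And>x. x \<in> carrier V \<Longrightarrow> lincomb (\<lambda>b. \<kappa> b x) B = x"
proof -
  have BV: "B \<subseteq> carrier V" using assms(2) unfolding basis_def by auto
  have ex1: "\<exists>!a. a \<in> B \<rightarrow>\<^sub>E carrier K \<and> lincomb a B = x" if "x \<in> carrier V" for x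
    using assms basis_criterion[OF assms(1) BV] that by blast
  define co where "co x = (THE a. a \<in> B \<rightarrow>\<^sub>E carrier K \<and> lincomb a B = x)" for x
  have co: "co x \<in> B \<rightarrow>\<^sub>E carrier K" "lincomb (co x) B = x" if "x \<in> carrier V" for x
    using theI'[OF ex1[OF that]] unfolding co_def by auto
  have uniq: "co x b = a b"
    if "x \<in> carrier V" "a \<in> B \<rightarrow> carrier K" "lincomb a B = x" "b \<in> B" for x a b
  proof -
    have "restrict a B \<in> B \<rightarrow>\<^sub>E carrier K" using that by auto
    moreover have "lincomb (restrict a B) B = x"
      using that lincomb_restrict[OF BV, of "restrict a B" a] by auto
    ultimately have "co x = restrict a B" using ex1[OF that(1)] co[OF that(1)] by blast
    then show ?thesis using that by auto
  qed
  show ?thesis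
  proof (rule that[of "\<lambda>b x. co x b"])
    fix b assume b: "b \<in> B"
    show "(\<lambda>x. co x b) \<in> linear_forms K V"
    proof (rule linear_formI)
      fix x assume "x \<in> carrier V" then show "co x b \<in> carrier K" using co(1) b by fastforce
    next
      fix x y assume xy: "x \<in> carrier V" "y \<in> carrier V"
      have c: "co x \<in> B \<rightarrow> carrier K" "co y \<in> B \<rightarrow> carrier K" using co xy by auto
      then have "lincomb (\<lambda>v. co x v \<oplus>\<^bsub>K\<^esub> co y v) B = x \<oplus>\<^bsub>V\<^esub> y"
        using lincomb_sum[OF assms(1) BV c] co xy by auto
      then show "co (x \<oplus>\<^bsub>V\<^esub> y) b = co x b \<oplus>\<^bsub>K\<^esub> co y b"
        using xy b c by (intro uniq) auto
    next
      fix r x assume rx: "r \<in> carrier K" "x \<in> carrier V"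
      have c: "co x \<in> B \<rightarrow> carrier K" using co rx by auto
      have "lincomb (\<lambda>v. r \<otimes>\<^bsub>K\<^esub> co x v) B = r \<odot>\<^bsub>V\<^esub> x"
        using lincomb_smult[OF BV c rx(1)] co rx by auto
      then show "co (r \<odot>\<^bsub>V\<^esub> x) b = r \<otimes>\<^bsub>K\<^esub> co x b"
        using rx b c by (intro uniq) auto
    qed
  next
    fix b b' assume b: "b \<in> B" "b' \<in> B"
    let ?a = "\<lambda>v. if v = b' then \<one>\<^bsub>K\<^esub> else \<zero>\<^bsub>K\<^esub>"
    have "lincomb ?a B = ?a b' \<odot>\<^bsub>V\<^esub> b' \<oplus>\<^bsub>V\<^esub> lincomb ?a (B - {b'})"
      using lincomb_del2[OF assms(1) BV _ b(2), of ?a] by auto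
    also have "lincomb ?a (B - {b'}) = \<zero>\<^bsub>V\<^esub>"
      using BV by (intro lincomb_zero) auto
    finally have "lincomb ?a B = b'" using b BV by auto
    then show "co b' b = (if b = b' then \<one>\<^bsub>K\<^esub> else \<zero>\<^bsub>K\<^esub>)"
      using b BV by (intro uniq) auto
  next
    fix x assume "x \<in> carrier V" then show "lincomb (\<lambda>b. co x b) B = x" using co by auto
  qed
qed

lemma lin_indpt_extends_to_basis:
  assumes "fin_dim" "B \<subseteq> carrier V" "lin_indpt B"
  obtains C where "finite C" "B \<subseteq> C" "basis C"
proof -
  have "\<exists>C. finite C \<and> maximal C (\<lambda>S. B \<subseteq> S \<and> S \<subseteq> carrier V \<and> lin_indpt S)"
    using assms by (intro maximal_exists[where N = dim and B = B]) (auto dest: li_le_dim[OF assms(1)])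
  then obtain C where C: "finite C" "maximal C (\<lambda>S. B \<subseteq> S \<and> S \<subseteq> carrier V \<and> lin_indpt S)" by blast
  then have "maximal C (\<lambda>S. S \<subseteq> carrier V \<and> lin_indpt S)" unfolding maximal_def by blast
  then have "basis C" by (rule max_li_is_basis)
  then show ?thesis using that C unfolding maximal_def by blast
qed

text \<open>
  Extend a basis of \<open>W\<close> to one of \<open>V\<close>. The coordinates at the basis vectors in \<open>W\<close> separate the
  points of \<open>W\<close>, and the other coordinates cut out \<open>W\<close>.
\<close>

lemma adapted_coordinates:
  assumes "fin_dim" "VectorSpace.subspace K W V"
  obtains B C \<kappa> where "finite C" "basis C" "B \<subseteq> C" "span B = W" "card B = vectorspace.dim K (vs W)"
    and "\<And>b. b \<in> C \<Longrightarrow> \<kappa> b \<in> linear_forms K V"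
    and "\<And>x. x \<in> W \<Longrightarrow> (\<And>b. b \<in> B \<Longrightarrow> \<kappa> b x = \<zero>\<^bsub>K\<^esub>) \<Longrightarrow> x = \<zero>\<^bsub>V\<^esub>"
    and "\<And>x. x \<in> carrier V \<Longrightarrow> x \<in> W \<longleftrightarrow> (\<forall>b\<in>C - B. \<kappa> b x = \<zero>\<^bsub>K\<^esub>)"
proof -
  obtain B where B: "finite B" "B \<subseteq> W" "lin_indpt B" "span B = W"
    "vectorspace.dim K (vs W) = card B"
    using subspace_basis[OF assms] by metis
  have WV: "W \<subseteq> carrier V" using assms(2) unfolding subspace_alt by auto
  obtain C where C: "finite C" "B \<subseteq> C" "basis C"
    using lin_indpt_extends_to_basis[OF assms(1) _ B(3)] B WV by (metis subset_trans)
  obtain \<kappa> where \<kappa>: "\<And>b. b \<in> C \<Longrightarrow> \<kappa> b \<in> linear_forms K V"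
    "\<And>b b'. b \<in> C \<Longrightarrow> b' \<in> C \<Longrightarrow> \<kappa> b b' = (if b = b' then \<one>\<^bsub>K\<^esub> else \<zero>\<^bsub>K\<^esub>)"
    "\<And>x. x \<in> carrier V \<Longrightarrow> lincomb (\<lambda>b. \<kappa> b x) C = x"
    using basis_coordinates[OF C(1,3)] by metis
  have CV: "C \<subseteq> carrier V" using C unfolding basis_def by auto
  have vanish: "\<kappa> b x = \<zero>\<^bsub>K\<^esub>" if "x \<in> W" "b \<in> C - B" for x b
  proof -
    have sub: "VectorSpace.subspace K {x \<in> carrier V. \<kappa> b x = \<zero>\<^bsub>K\<^esub>} V"
      using \<kappa>(1) that by (intro linear_form_ker_subspace) auto
    have "B \<subseteq> {x \<in> carrier V. \<kappa> b x = \<zero>\<^bsub>K\<^esub>}" using B WV C \<kappa>(2) that by auto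
    from span_subset_subspace[OF sub this] show ?thesis using that B by auto
  qed
  have zero: "x = \<zero>\<^bsub>V\<^esub>" if "x \<in> W" "\<And>b. b \<in> B \<Longrightarrow> \<kappa> b x = \<zero>\<^bsub>K\<^esub>" for x
  proof -
    have "\<And>b. b \<in> C \<Longrightarrow> \<kappa> b x = \<zero>\<^bsub>K\<^esub>" using that vanish by blast
    then have "lincomb (\<lambda>b. \<kappa> b x) C = \<zero>\<^bsub>V\<^esub>" using CV by (intro lincomb_zero) auto
    then show ?thesis using \<kappa>(3) that WV by auto
  qed
  have mem: "x \<in> W" if x: "x \<in> carrier V" and z: "\<And>b. b \<in> C - B \<Longrightarrow> \<kappa> b x = \<zero>\<^bsub>K\<^esub>" for x
  proof -
    have 1: "(\<lambda>b. \<kappa> b x) \<in> B \<rightarrow> carrier K" using C linear_form_closed[OF \<kappa>(1) x] by auto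
    have "lincomb (\<lambda>b. \<kappa> b x) (B \<union> (C - B)) = lincomb (\<lambda>b. \<kappa> b x) B"
      using B C CV z 1 by (intro lincomb_clean) auto
    moreover have "B \<union> (C - B) = C" using C by auto
    ultimately have "x = lincomb (\<lambda>b. \<kappa> b x) B" using \<kappa>(3)[OF x] by auto
    then show "x \<in> W" using B 1 unfolding span_def by blast
  qed
  show ?thesis
    by (rule that[of C B \<kappa>]) (use B C \<kappa> vanish zero mem in auto)
qed

lemma subspace_separating_forms:
  assumes "fin_dim" "VectorSpace.subspace K W V"
  obtains S :: "'c set" and \<phi> where "finite S" "card S = vectorspace.dim K (vs W)"
    and "\<And>s. s \<in> S \<Longrightarrow> \<phi> s \<in> linear_forms K V"
    and "\<And>x. x \<in> W \<Longrightarrow> (\<And>s. s \<in> S \<Longrightarrow> \<phi> s x = \<zero>\<^bsub>K\<^esub>) \<Longrightarrow> x = \<zero>\<^bsub>V\<^esub>"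
proof (rule adapted_coordinates[OF assms])
  fix B C :: "'c set" and \<kappa>
  assume "finite C" "B \<subseteq> C" "card B = vectorspace.dim K (vs W)"
    and "\<And>b. b \<in> C \<Longrightarrow> \<kappa> b \<in> linear_forms K V"
    and zero: "\<And>x. x \<in> W \<Longrightarrow> (\<And>b. b \<in> B \<Longrightarrow> \<kappa> b x = \<zero>\<^bsub>K\<^esub>) \<Longrightarrow> x = \<zero>\<^bsub>V\<^esub>"
  then show thesis by (intro that[of B \<kappa>] zero) (auto intro: finite_subset)
qed

lemma linear_form_avoiding_subspace:
  assumes "fin_dim" "VectorSpace.subspace K W V" "y \<in> carrier V" "y \<notin> W"
  obtains \<phi> where "\<phi> \<in> linear_forms K V" "\<And>x. x \<in> W \<Longrightarrow> \<phi> x = \<zero>\<^bsub>K\<^esub>" "\<phi> y \<noteq> \<zero>\<^bsub>K\<^esub>"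
proof (rule adapted_coordinates[OF assms(1,2)])
  fix B C :: "'c set" and \<kappa>
  assume form: "\<And>b. b \<in> C \<Longrightarrow> \<kappa> b \<in> linear_forms K V"
    and mem: "\<And>x. x \<in> carrier V \<Longrightarrow> x \<in> W \<longleftrightarrow> (\<forall>b\<in>C - B. \<kappa> b x = \<zero>\<^bsub>K\<^esub>)"
  obtain b where b: "b \<in> C - B" "\<kappa> b y \<noteq> \<zero>\<^bsub>K\<^esub>" using mem[OF assms(3)] assms(4) by blast
  have WV: "W \<subseteq> carrier V" using assms(2) unfolding subspace_alt by auto
  show thesis
  proof (rule that[of "\<kappa> b"])
    show "\<kappa> b x = \<zero>\<^bsub>K\<^esub>" if "x \<in> W" for x using mem[of x] that WV b by blast
  qed (use form b in auto)
qed

text \<open>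
  Evaluating \<open>\<phi> s\<close> at a vanishing linear combination isolates the coefficient of \<open>x s\<close>.
\<close>

lemma dual_family_lin_indpt:
  assumes "finite S" "\<And>s. s \<in> S \<Longrightarrow> \<phi> s \<in> linear_forms K V"
    and "\<And>s. s \<in> S \<Longrightarrow> x s \<in> carrier V"
    and "\<And>s t. s \<in> S \<Longrightarrow> t \<in> S \<Longrightarrow> \<phi> s (x t) = (if s = t then \<one>\<^bsub>K\<^esub> else \<zero>\<^bsub>K\<^esub>)"
  shows "inj_on x S" "lin_indpt (x ` S)"
proof -
  show "inj_on x S"
  proof (rule inj_onI)
    fix s t assume st: "s \<in> S" "t \<in> S" "x s = x t"
    show "s = t"
    proof (rule ccontr)
      assume "s \<noteq> t"
      then show False using assms(4)[OF st(1,2)] assms(4)[OF st(1,1)] st by auto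
    qed
  qed
  have xV: "x ` S \<subseteq> carrier V" using assms by auto
  show "lin_indpt (x ` S)"
  proof (rule finite_lin_indpt2)
    show "finite (x ` S)" "x ` S \<subseteq> carrier V" using assms xV by auto
    fix a assume a: "a \<in> x ` S \<rightarrow> carrier K" "lincomb a (x ` S) = \<zero>\<^bsub>V\<^esub>"
    show "\<forall>v\<in>x ` S. a v = \<zero>\<^bsub>K\<^esub>"
    proof
      fix v assume "v \<in> x ` S"
      then obtain s where s: "s \<in> S" "v = x s" by auto
      have ker: "VectorSpace.subspace K {y \<in> carrier V. \<phi> s y = \<zero>\<^bsub>K\<^esub>} V"
        using assms(2)[OF s(1)] by (rule linear_form_ker_subspace)
      have aV: "a v \<in> carrier K" using a s by auto
      have "\<zero>\<^bsub>V\<^esub> = a v \<odot>\<^bsub>V\<^esub> v \<oplus>\<^bsub>V\<^esub> lincomb a (x ` S - {v})"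
        using lincomb_del2[of "x ` S" a v] a s xV assms by auto
      moreover have "x ` S - {v} \<subseteq> {y \<in> carrier V. \<phi> s y = \<zero>\<^bsub>K\<^esub>}"
        using assms(3,4) s by auto
      then have "span (x ` S - {v}) \<subseteq> {y \<in> carrier V. \<phi> s y = \<zero>\<^bsub>K\<^esub>}"
        using span_subset_subspace[OF ker] by blast
      moreover have "lincomb a (x ` S - {v}) \<in> span (x ` S - {v})"
        unfolding span_def using assms a by (intro CollectI exI) auto
      ultimately have "\<phi> s \<zero>\<^bsub>V\<^esub> = \<phi> s (a v \<odot>\<^bsub>V\<^esub> v \<oplus>\<^bsub>V\<^esub> lincomb a (x ` S - {v}))"
        "\<phi> s (lincomb a (x ` S - {v})) = \<zero>\<^bsub>K\<^esub>" "lincomb a (x ` S - {v}) \<in> carrier V" by auto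
      note l = this
      have vV: "v \<in> carrier V" and 1: "\<phi> s v = \<one>\<^bsub>K\<^esub>" using s assms(3,4) by auto
      note \<phi>s = assms(2)[OF s(1)]
      have "\<zero>\<^bsub>K\<^esub> = \<phi> s \<zero>\<^bsub>V\<^esub>" using linear_form_zero[OF \<phi>s] by simp
      also have "\<dots> = \<phi> s (a v \<odot>\<^bsub>V\<^esub> v) \<oplus>\<^bsub>K\<^esub> \<phi> s (lincomb a (x ` S - {v}))"
        unfolding l(1) using aV vV l(3) by (intro linear_form_add[OF \<phi>s]) auto
      also have "\<dots> = a v" unfolding l(2) linear_form_smult[OF \<phi>s aV vV] 1 using aV by simp
      finally show "a v = \<zero>\<^bsub>K\<^esub>" ..
    qed
  qed
qed

lemma card_dual_family_le_dim:
  assumes "fin_dim" "finite S" "\<And>s. s \<in> S \<Longrightarrow> \<phi> s \<in> linear_forms K V"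
    and "\<And>s. s \<in> S \<Longrightarrow> x s \<in> carrier V"
    and "\<And>s t. s \<in> S \<Longrightarrow> t \<in> S \<Longrightarrow> \<phi> s (x t) = (if s = t then \<one>\<^bsub>K\<^esub> else \<zero>\<^bsub>K\<^esub>)"
  shows "card S \<le> dim"
proof -
  note dual = dual_family_lin_indpt[OF assms(2-5)]
  have "card (x ` S) \<le> dim" using assms(4) by (intro li_le_dim(2)[OF assms(1) _ dual(2)]) auto
  then show ?thesis using card_image[OF dual(1)] by simp
qed

lemma linear_forms_subspace:
  assumes "VectorSpace.subspace K W V" "\<phi> \<in> linear_forms K V"
  shows "\<phi> \<in> linear_forms K (vs W)"
proof -
  have "x \<in> carrier V" if "x \<in> W" for x using assms(1) that unfolding subspace_alt by blast
  then show ?thesis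
    by (intro linear_formI)
      (simp_all add: linear_form_closed[OF assms(2)] linear_form_add[OF assms(2)]
        linear_form_smult[OF assms(2)])
qed

lemma linear_forms_separate_points:
  assumes "fin_dim" "x \<in> carrier V" "y \<in> carrier V"
    and "\<And>\<zeta>. \<zeta> \<in> linear_forms K V \<Longrightarrow> \<zeta> x = \<zeta> y"
  shows "x = y"
proof (rule ccontr)
  assume ne: "x \<noteq> y"
  have sub: "VectorSpace.subspace K {\<zero>\<^bsub>V\<^esub>} V" unfolding subspace_alt by auto
  have "x \<ominus>\<^bsub>V\<^esub> y \<in> carrier V" "x \<ominus>\<^bsub>V\<^esub> y \<notin> {\<zero>\<^bsub>V\<^esub>}" using assms ne by auto
  then obtain \<zeta> where \<zeta>: "\<zeta> \<in> linear_forms K V" "\<zeta> (x \<ominus>\<^bsub>V\<^esub> y) \<noteq> \<zero>\<^bsub>K\<^esub>"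
    using linear_form_avoiding_subspace[OF assms(1) sub] by metis
  then show False
    using linear_form_diff[OF \<zeta>(1) assms(2,3)] assms(4)[OF \<zeta>(1)]
      linear_form_closed[OF \<zeta>(1) assms(3)] by simp
qed

lemma span_singleton:
  assumes "x \<in> carrier V"
  shows "span {x} = {c \<odot>\<^bsub>V\<^esub> x | c. c \<in> carrier K}"
proof -
  have "span {x} = {lincomb a {x} | a. a \<in> {x} \<rightarrow> carrier K}"
    using assms by (intro finite_span) auto
  also have "\<dots> = {c \<odot>\<^bsub>V\<^esub> x | c. c \<in> carrier K}"
  proof -
    have lin: "lincomb a {x} = a x \<odot>\<^bsub>V\<^esub> x" if "a \<in> {x} \<rightarrow> carrier K" for a
      using that assms unfolding lincomb_def by auto
    have "lincomb (\<lambda>_. c) {x} = c \<odot>\<^bsub>V\<^esub> x" if "c \<in> carrier K" for c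
      using lin[of "\<lambda>_. c"] that by auto
    then have "\<exists>a. c \<odot>\<^bsub>V\<^esub> x = lincomb a {x} \<and> a \<in> {x} \<rightarrow> carrier K" if "c \<in> carrier K" for c
      using that by (intro exI[of _ "\<lambda>_. c"]) auto
    then show ?thesis using lin by blast
  qed
  finally show ?thesis .
qed

lemma smult_eq_zeroD:
  assumes "c \<in> carrier K" "x \<in> carrier V" "c \<odot>\<^bsub>V\<^esub> x = \<zero>\<^bsub>V\<^esub>" "x \<noteq> \<zero>\<^bsub>V\<^esub>"
  shows "c = \<zero>\<^bsub>K\<^esub>"
  using mult_inverse[OF assms(1-3)] assms by (cases "c = \<zero>\<^bsub>K\<^esub>") auto

end

section \<open>Free modules and quotient modules\<close>

lemma free_module_carrier:
  "carrier (free_module K S) = {f. (\<forall>x\<in>S. f x \<in> carrier K) \<and> (\<forall>x. x \<notin> S \<longrightarrow> f x = \<zero>\<^bsub>K\<^esub>)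
                   \<and> finite {x. f x \<noteq> \<zero>\<^bsub>K\<^esub>}}"
  by (simp add: free_module_def)

lemma free_module_simps [simp]:
  "\<zero>\<^bsub>free_module K S\<^esub> = (\<lambda>x. \<zero>\<^bsub>K\<^esub>)"
  "f \<oplus>\<^bsub>free_module K S\<^esub> g = (\<lambda>x. f x \<oplus>\<^bsub>K\<^esub> g x)"
  "c \<odot>\<^bsub>free_module K S\<^esub> f = (\<lambda>x. c \<otimes>\<^bsub>K\<^esub> f x)"
  by (simp_all add: free_module_def)

context cring
begin

lemma free_module_closed: "f \<in> carrier (free_module R S) \<Longrightarrow> f x \<in> carrier R"
  by (cases "x \<in> S") (auto simp: free_module_carrier)

lemma free_gen_closed: "x \<in> S \<Longrightarrow> free_gen R x \<in> carrier (free_module R S)"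
  unfolding free_gen_def by (auto simp: free_module_carrier intro: finite_subset[of _ "{x}"])

lemma module_free_module: "Module.module R (free_module R S)"
proof (rule module_criteria)
  show "cring R" ..
  have fin_add: "finite {x. f x \<oplus> g x \<noteq> \<zero>}"
    if "finite {x. f x \<noteq> \<zero>}" "finite {x. g x \<noteq> \<zero>}" for f g :: "'d \<Rightarrow> 'a"
    by (rule finite_subset[OF _ finite_UnI[OF that]]) auto
  show "\<forall>v w. v \<in> carrier (free_module R S) \<and> w \<in> carrier (free_module R S) \<longrightarrow>
      v \<oplus>\<^bsub>free_module R S\<^esub> w \<in> carrier (free_module R S)"
    using fin_add by (auto simp: free_module_carrier)
  show "\<forall>c v. c \<in> carrier R \<and> v \<in> carrier (free_module R S) \<longrightarrow>
      c \<odot>\<^bsub>free_module R S\<^esub> v \<in> carrier (free_module R S)"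
  proof (intro allI impI)
    fix c v assume cv: "c \<in> carrier R \<and> v \<in> carrier (free_module R S)"
    then have "finite {x. c \<otimes> v x \<noteq> \<zero>}"
      by (auto simp: free_module_carrier intro: finite_subset[of _ "{x. v x \<noteq> \<zero>}"])
    then show "c \<odot>\<^bsub>free_module R S\<^esub> v \<in> carrier (free_module R S)"
      using cv by (auto simp: free_module_carrier)
  qed
  show "\<forall>v\<in>carrier (free_module R S). \<exists>neg_v\<in>carrier (free_module R S).
      v \<oplus>\<^bsub>free_module R S\<^esub> neg_v = \<zero>\<^bsub>free_module R S\<^esub>"
  proof
    fix v assume v: "v \<in> carrier (free_module R S)"
    note vc = free_module_closed[OF v]
    have "{x. \<ominus> v x \<noteq> \<zero>} \<subseteq> {x. v x \<noteq> \<zero>}" by auto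
    then have "finite {x. \<ominus> v x \<noteq> \<zero>}" using v finite_subset
      by (auto simp: free_module_carrier)
    then show "\<exists>neg_v\<in>carrier (free_module R S).
        v \<oplus>\<^bsub>free_module R S\<^esub> neg_v = \<zero>\<^bsub>free_module R S\<^esub>"
      using v vc by (intro bexI[of _ "\<lambda>x. \<ominus> v x"]) (auto simp: r_neg free_module_carrier)
  qed
  show "\<zero>\<^bsub>free_module R S\<^esub> \<in> carrier (free_module R S)" by (auto simp: free_module_carrier)
qed (auto simp: free_module_closed a_ac m_assoc l_distr r_distr)

text \<open>
  The support loses a point when the term at this point is split off.
\<close>

lemma free_module_induct:
  assumes f: "f \<in> carrier (free_module R S)"
    and zero: "P \<zero>\<^bsub>free_module R S\<^esub>"
    and gen: "\<And>c x. c \<in> carrier R \<Longrightarrow> x \<in> S \<Longrightarrow> P (c \<odot>\<^bsub>free_module R S\<^esub> free_gen R x)"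
    and add: "\<And>f g. f \<in> carrier (free_module R S) \<Longrightarrow> g \<in> carrier (free_module R S) \<Longrightarrow>
      P f \<Longrightarrow> P g \<Longrightarrow> P (f \<oplus>\<^bsub>free_module R S\<^esub> g)"
  shows "P f"
proof -
  interpret F: Module.module R "free_module R S" by (rule module_free_module)
  have "finite {x. f x \<noteq> \<zero>}" using f by (auto simp: free_module_carrier)
  then show ?thesis using f
  proof (induction "{x. f x \<noteq> \<zero>}" arbitrary: f rule: finite_induct)
    case empty
    then have "f = \<zero>\<^bsub>free_module R S\<^esub>" by auto
    then show ?case using zero by simp
  next
    case (insert y Y)
    have y: "f y \<noteq> \<zero>" using insert.hyps(4) by auto
    then have yS: "y \<in> S" using insert.prems by (auto simp: free_module_carrier)
    define h where "h = f(y := \<zero>)"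
    have supp: "Y = {x. h x \<noteq> \<zero>}" using insert.hyps(2,4) unfolding h_def by auto
    have h: "h \<in> carrier (free_module R S)"
      using insert.prems insert.hyps(1) yS supp by (auto simp: h_def free_module_carrier)
    have fy: "f y \<in> carrier R" using free_module_closed[OF insert.prems] .
    have "f = f y \<odot>\<^bsub>free_module R S\<^esub> free_gen R y \<oplus>\<^bsub>free_module R S\<^esub> h"
      using free_module_closed[OF insert.prems] by (auto simp: free_gen_def h_def)
    moreover have "P h" using insert.hyps(3)[OF supp h] .
    moreover have "f y \<odot>\<^bsub>free_module R S\<^esub> free_gen R y \<in> carrier (free_module R S)"
      using free_gen_closed[OF yS] fy by (rule F.smult_closed[rotated])
    ultimately show ?case using add gen h fy yS by metis
  qed
qed

end

text \<open>
  The value at \<open>f\<close> of the linear map from a free module to \<open>M\<close> that sends the generator at \<open>x\<close> to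
  \<open>\<beta> x\<close>. Summing over the support of \<open>f\<close> makes the definition independent of the index set.
\<close>

definition linear_extension ::
  "('k, 'm) ring_scheme \<Rightarrow> ('k, 'a, 'n) module_scheme \<Rightarrow> ('x \<Rightarrow> 'a) \<Rightarrow> ('x \<Rightarrow> 'k) \<Rightarrow> 'a"
  where "linear_extension K M \<beta> f = (\<Oplus>\<^bsub>M\<^esub>x\<in>{x. f x \<noteq> \<zero>\<^bsub>K\<^esub>}. f x \<odot>\<^bsub>M\<^esub> \<beta> x)"

context Module.module
begin

lemma linear_extension_superset:
  assumes "f \<in> carrier (free_module R S)" "\<beta> \<in> S \<rightarrow> carrier M"
    and "finite X" "{x. f x \<noteq> \<zero>} \<subseteq> X" "X \<subseteq> S"
  shows "linear_extension R M \<beta> f = (\<Oplus>\<^bsub>M\<^esub>x\<in>X. f x \<odot>\<^bsub>M\<^esub> \<beta> x)"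
proof -
  have "\<beta> x \<in> carrier M" if "x \<in> X" for x using assms that by blast
  then show ?thesis
    unfolding linear_extension_def using assms R.free_module_closed[OF assms(1)]
    by (intro M.add.finprod_mono_neutral_cong_left) auto
qed

lemma linear_extension_hom:
  assumes "\<beta> \<in> S \<rightarrow> carrier M"
  shows "linear_extension R M \<beta> \<in> LinearCombinations.module_hom R (free_module R S) M"
proof -
  interpret F: Module.module R "free_module R S" by (rule R.module_free_module)
  let ?E = "linear_extension R M \<beta>"
  let ?s = "\<lambda>f. {x. f x \<noteq> \<zero>}"
  have sup: "finite (?s f)" "?s f \<subseteq> S" if "f \<in> carrier (free_module R S)" for f
    using that by (auto simp: free_module_carrier)
  have cl: "f x \<in> carrier R" if "f \<in> carrier (free_module R S)" for f x
    using R.free_module_closed[OF that] .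
  have \<beta>: "\<beta> x \<in> carrier M" if "x \<in> S" for x using assms that by auto
  show ?thesis unfolding LinearCombinations.module_hom_def
  proof (intro CollectI conjI allI impI Pi_I)
    fix f assume "f \<in> carrier (free_module R S)"
    then show "?E f \<in> carrier M"
      unfolding linear_extension_def using sup(2)[of f] cl[of f] \<beta> by (intro M.finsum_closed) auto
  next
    fix f g assume "f \<in> carrier (free_module R S) \<and> g \<in> carrier (free_module R S)"
    then have fg: "f \<in> carrier (free_module R S)" "g \<in> carrier (free_module R S)" by auto
    then have fg': "f \<oplus>\<^bsub>free_module R S\<^esub> g \<in> carrier (free_module R S)" by (rule F.a_closed)
    let ?X = "?s f \<union> ?s g"
    have X: "finite ?X" "?X \<subseteq> S" using sup[OF fg(1)] sup[OF fg(2)] by auto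
    have "?E (f \<oplus>\<^bsub>free_module R S\<^esub> g)
        = (\<Oplus>\<^bsub>M\<^esub>x\<in>?X. (f \<oplus>\<^bsub>free_module R S\<^esub> g) x \<odot>\<^bsub>M\<^esub> \<beta> x)"
      by (intro linear_extension_superset[OF fg' assms]) (use X in auto)
    also have "\<dots> = (\<Oplus>\<^bsub>M\<^esub>x\<in>?X. f x \<odot>\<^bsub>M\<^esub> \<beta> x \<oplus>\<^bsub>M\<^esub> g x \<odot>\<^bsub>M\<^esub> \<beta> x)"
      using X(2) cl[OF fg(1)] cl[OF fg(2)] \<beta>
      by (intro M.finsum_cong') (auto simp: smult_l_distr)
    also have "\<dots> = (\<Oplus>\<^bsub>M\<^esub>x\<in>?X. f x \<odot>\<^bsub>M\<^esub> \<beta> x) \<oplus>\<^bsub>M\<^esub> (\<Oplus>\<^bsub>M\<^esub>x\<in>?X. g x \<odot>\<^bsub>M\<^esub> \<beta> x)"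
      using X(2) cl[OF fg(1)] cl[OF fg(2)] \<beta> by (intro M.finsum_addf) auto
    also have "(\<Oplus>\<^bsub>M\<^esub>x\<in>?X. f x \<odot>\<^bsub>M\<^esub> \<beta> x) = ?E f"
      by (rule linear_extension_superset[OF fg(1) assms, symmetric]) (use X in auto)
    also have "(\<Oplus>\<^bsub>M\<^esub>x\<in>?X. g x \<odot>\<^bsub>M\<^esub> \<beta> x) = ?E g"
      by (rule linear_extension_superset[OF fg(2) assms, symmetric]) (use X in auto)
    finally show "?E (f \<oplus>\<^bsub>free_module R S\<^esub> g) = ?E f \<oplus>\<^bsub>M\<^esub> ?E g" .
  next
    fix c f assume "c \<in> carrier R \<and> f \<in> carrier (free_module R S)"
    then have c: "c \<in> carrier R" and f: "f \<in> carrier (free_module R S)" by auto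
    then have cf: "c \<odot>\<^bsub>free_module R S\<^esub> f \<in> carrier (free_module R S)" by (rule F.smult_closed)
    have "?E (c \<odot>\<^bsub>free_module R S\<^esub> f)
        = (\<Oplus>\<^bsub>M\<^esub>x\<in>?s f. (c \<odot>\<^bsub>free_module R S\<^esub> f) x \<odot>\<^bsub>M\<^esub> \<beta> x)"
      by (intro linear_extension_superset[OF cf assms]) (use sup[OF f] c in auto)
    also have "\<dots> = (\<Oplus>\<^bsub>M\<^esub>x\<in>?s f. c \<odot>\<^bsub>M\<^esub> (f x \<odot>\<^bsub>M\<^esub> \<beta> x))"
      using sup(2)[OF f] cl[OF f] \<beta> c by (intro M.finsum_cong') (auto simp: smult_assoc1)
    also have "\<dots> = c \<odot>\<^bsub>M\<^esub> ?E f"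
      unfolding linear_extension_def using sup(2)[OF f] cl[OF f] \<beta> c
      by (intro finsum_smult[symmetric]) auto
    finally show "?E (c \<odot>\<^bsub>free_module R S\<^esub> f) = c \<odot>\<^bsub>M\<^esub> ?E f" .
  qed
qed

lemma linear_extension_gen:
  assumes "\<beta> \<in> S \<rightarrow> carrier M" "x \<in> S"
  shows "linear_extension R M \<beta> (free_gen R x) = \<beta> x"
proof -
  have "linear_extension R M \<beta> (free_gen R x) = (\<Oplus>\<^bsub>M\<^esub>y\<in>{x}. free_gen R x y \<odot>\<^bsub>M\<^esub> \<beta> y)"
    using assms by (intro linear_extension_superset[OF R.free_gen_closed[OF assms(2)] assms(1)])
      (auto simp: free_gen_def)
  also have "\<dots> = \<beta> x"
    using Pi_mem[OF assms] by (simp add: free_gen_def)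
  finally show ?thesis .
qed

end

subsection \<open>Quotients\<close>

lemma quotient_module_simps:
  "carrier (quotient_module M N) = a_rcosets\<^bsub>M\<^esub> N"
  "\<zero>\<^bsub>quotient_module M N\<^esub> = N"
  "\<one>\<^bsub>quotient_module M N\<^esub> = N +>\<^bsub>M\<^esub> \<one>\<^bsub>M\<^esub>"
  "X \<oplus>\<^bsub>quotient_module M N\<^esub> Y = X <+>\<^bsub>M\<^esub> Y"
  "X \<otimes>\<^bsub>quotient_module M N\<^esub> Y = rcoset_mult M N X Y"
  "c \<odot>\<^bsub>quotient_module M N\<^esub> X = (\<Union>x\<in>X. N +>\<^bsub>M\<^esub> (c \<odot>\<^bsub>M\<^esub> x))"
  by (simp_all add: quotient_module_def ring.defs module.defs FactRing_def)

context Module.module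
begin

text \<open>
  This makes the calculus of cosets of abelian groups available for submodules.
\<close>

lemma submodule_abelian_subgroup:
  assumes "LinearCombinations.submodule R N M"
  shows "abelian_subgroup N M"
proof (rule abelian_subgroupI3)
  note N = assms[unfolded submodule_alt]
  have "\<ominus>\<^bsub>M\<^esub> x \<in> N" if "x \<in> N" for x
  proof -
    have "\<ominus>\<^bsub>M\<^esub> x = (\<ominus> \<one>) \<odot>\<^bsub>M\<^esub> x" using N that smult_minus_1[of x] by auto
    then show ?thesis using N that by auto
  qed
  then show "additive_subgroup N M"
    using N by (intro additive_subgroup.intro M.add.subgroupI)
      (auto simp flip: a_inv_def)
qed (rule M.abelian_group_axioms)

context
  fixes N assumes N: "LinearCombinations.submodule R N M"
begin

interpretation N: abelian_subgroup N M by (rule submodule_abelian_subgroup[OF N])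

lemma quotient_carrier: "carrier (quotient_module M N) = (\<lambda>x. N +>\<^bsub>M\<^esub> x) ` carrier M"
  unfolding quotient_module_simps A_RCOSETS_defs a_r_coset_def by auto

lemma quotient_add:
  "x \<in> carrier M \<Longrightarrow> y \<in> carrier M \<Longrightarrow>
    (N +>\<^bsub>M\<^esub> x) \<oplus>\<^bsub>quotient_module M N\<^esub> (N +>\<^bsub>M\<^esub> y) = N +>\<^bsub>M\<^esub> (x \<oplus>\<^bsub>M\<^esub> y)"
  unfolding quotient_module_simps by (rule N.a_rcos_sum)

lemma coset_mem_iff:
  "x \<in> carrier M \<Longrightarrow> y \<in> carrier M \<Longrightarrow> y \<in> N +>\<^bsub>M\<^esub> x \<longleftrightarrow> y \<ominus>\<^bsub>M\<^esub> x \<in> N"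
  using N.a_rcos_module[of x y] by (simp add: a_minus_def)

lemma coset_eq_iff:
  assumes "x \<in> carrier M" "y \<in> carrier M"
  shows "N +>\<^bsub>M\<^esub> x = N +>\<^bsub>M\<^esub> y \<longleftrightarrow> x \<ominus>\<^bsub>M\<^esub> y \<in> N"
proof -
  have "N +>\<^bsub>M\<^esub> x = N +>\<^bsub>M\<^esub> y \<longleftrightarrow> x \<in> N +>\<^bsub>M\<^esub> y"
    using N.a_repr_independence'[of x y] N.a_rcos_self[of x] assms by auto
  also have "\<dots> \<longleftrightarrow> x \<ominus>\<^bsub>M\<^esub> y \<in> N"
    using coset_mem_iff assms by auto
  finally show ?thesis .
qed

text \<open>
  Operations on cosets are written as unions over all representatives; this evaluates such a union
  once the result is known not to depend on the representative.
\<close>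

lemma coset_union_const:
  assumes x: "x \<in> carrier M" and c: "\<And>y. y \<in> N +>\<^bsub>M\<^esub> x \<Longrightarrow> F y = F x"
  shows "(\<Union>y\<in>N +>\<^bsub>M\<^esub> x. F y) = F x"
proof (intro equalityI subsetI)
  fix z assume "z \<in> (\<Union>y\<in>N +>\<^bsub>M\<^esub> x. F y)"
  then obtain y where "y \<in> N +>\<^bsub>M\<^esub> x" "z \<in> F y" by blast
  with c show "z \<in> F x" by metis
qed (use N.a_rcos_self[OF x] in blast)

lemma quotient_smult:
  assumes c: "c \<in> carrier R" and x: "x \<in> carrier M"
  shows "c \<odot>\<^bsub>quotient_module M N\<^esub> (N +>\<^bsub>M\<^esub> x) = N +>\<^bsub>M\<^esub> (c \<odot>\<^bsub>M\<^esub> x)"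
  unfolding quotient_module_simps
proof (rule coset_union_const[OF x])
  fix y assume y: "y \<in> N +>\<^bsub>M\<^esub> x"
  then have yM: "y \<in> carrier M" using x N.a_elemrcos_carrier by blast
  have "y \<ominus>\<^bsub>M\<^esub> x \<in> N"
    using coset_mem_iff x y yM by auto
  then have "c \<odot>\<^bsub>M\<^esub> (y \<ominus>\<^bsub>M\<^esub> x) \<in> N" using N c unfolding submodule_alt by auto
  then have "c \<odot>\<^bsub>M\<^esub> y \<ominus>\<^bsub>M\<^esub> c \<odot>\<^bsub>M\<^esub> x \<in> N"
    using c x yM by (simp add: a_minus_def smult_r_distr smult_r_minus)
  then show "N +>\<^bsub>M\<^esub> (c \<odot>\<^bsub>M\<^esub> y) = N +>\<^bsub>M\<^esub> (c \<odot>\<^bsub>M\<^esub> x)"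
    using coset_eq_iff c x yM by auto
qed

lemma quotient_zero: "\<zero>\<^bsub>quotient_module M N\<^esub> = N +>\<^bsub>M\<^esub> \<zero>\<^bsub>M\<^esub>"
  unfolding quotient_module_simps using N.a_subset by simp

lemma module_quotient_module: "Module.module R (quotient_module M N)"
proof (rule module_criteria)
  show "cring R" ..
  show "\<forall>v\<in>carrier (quotient_module M N). \<exists>neg_v\<in>carrier (quotient_module M N).
      v \<oplus>\<^bsub>quotient_module M N\<^esub> neg_v = \<zero>\<^bsub>quotient_module M N\<^esub>"
  proof
    fix v assume "v \<in> carrier (quotient_module M N)"
    then obtain x where x: "x \<in> carrier M" "v = N +>\<^bsub>M\<^esub> x" unfolding quotient_carrier by auto
    then have "v \<oplus>\<^bsub>quotient_module M N\<^esub> (N +>\<^bsub>M\<^esub> (\<ominus>\<^bsub>M\<^esub> x)) = \<zero>\<^bsub>quotient_module M N\<^esub>"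
      by (simp add: quotient_add quotient_zero M.r_neg)
    then show "\<exists>neg_v\<in>carrier (quotient_module M N).
        v \<oplus>\<^bsub>quotient_module M N\<^esub> neg_v = \<zero>\<^bsub>quotient_module M N\<^esub>"
      using x unfolding quotient_carrier by blast
  qed
qed (auto simp: quotient_carrier quotient_zero quotient_add quotient_smult M.a_ac
    smult_assoc1 smult_l_distr smult_r_distr)

lemma coset_hom: "(\<lambda>x. N +>\<^bsub>M\<^esub> x) \<in> LinearCombinations.module_hom R M (quotient_module M N)"
  unfolding LinearCombinations.module_hom_def by (auto simp: quotient_carrier quotient_add quotient_smult)

text \<open>
  This is why a map on the quotient may be defined through an arbitrary representative.
\<close>

lemma hom_const_on_coset:
  assumes P: "Module.module R P" and h: "h \<in> LinearCombinations.module_hom R M P"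
    and ker: "\<And>x. x \<in> N \<Longrightarrow> h x = \<zero>\<^bsub>P\<^esub>" and x: "x \<in> carrier M" and y: "y \<in> N +>\<^bsub>M\<^esub> x"
  shows "h y = h x"
proof -
  interpret h: LinearCombinations.mod_hom R M P h
    using P h by (simp add: LinearCombinations.mod_hom_def mod_hom_axioms_def module_axioms)
  have yM: "y \<in> carrier M" using x y N.a_elemrcos_carrier by blast
  have "y \<ominus>\<^bsub>M\<^esub> x \<in> N"
    using coset_mem_iff x y yM by auto
  then have "h y \<ominus>\<^bsub>P\<^esub> h x = \<zero>\<^bsub>P\<^esub>" using ker[of "y \<ominus>\<^bsub>M\<^esub> x"] x yM by simp
  then show ?thesis using x yM by simp
qed

end

end

section \<open>The tensor product\<close>

definition bilinear_map ::
  "('k, 'm) ring_scheme \<Rightarrow> ('k, 'a, 'n) module_scheme \<Rightarrow> ('k, 'b, 'l) module_scheme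
    \<Rightarrow> ('k, 'c, 'o) module_scheme \<Rightarrow> ('a \<Rightarrow> 'b \<Rightarrow> 'c) \<Rightarrow> bool"
  where "bilinear_map K V W M \<beta> \<longleftrightarrow>
    (\<forall>w\<in>carrier W. (\<lambda>v. \<beta> v w) \<in> LinearCombinations.module_hom K V M) \<and>
    (\<forall>v\<in>carrier V. \<beta> v \<in> LinearCombinations.module_hom K W M)"

lemma bilinear_mapI:
  assumes "\<And>v w. v \<in> carrier V \<Longrightarrow> w \<in> carrier W \<Longrightarrow> \<beta> v w \<in> carrier M"
    and "\<And>v v' w. v \<in> carrier V \<Longrightarrow> v' \<in> carrier V \<Longrightarrow> w \<in> carrier W \<Longrightarrow>
      \<beta> (v \<oplus>\<^bsub>V\<^esub> v') w = \<beta> v w \<oplus>\<^bsub>M\<^esub> \<beta> v' w"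
    and "\<And>v w w'. v \<in> carrier V \<Longrightarrow> w \<in> carrier W \<Longrightarrow> w' \<in> carrier W \<Longrightarrow>
      \<beta> v (w \<oplus>\<^bsub>W\<^esub> w') = \<beta> v w \<oplus>\<^bsub>M\<^esub> \<beta> v w'"
    and "\<And>c v w. c \<in> carrier K \<Longrightarrow> v \<in> carrier V \<Longrightarrow> w \<in> carrier W \<Longrightarrow>
      \<beta> (c \<odot>\<^bsub>V\<^esub> v) w = c \<odot>\<^bsub>M\<^esub> \<beta> v w"
    and "\<And>c v w. c \<in> carrier K \<Longrightarrow> v \<in> carrier V \<Longrightarrow> w \<in> carrier W \<Longrightarrow>
      \<beta> v (c \<odot>\<^bsub>W\<^esub> w) = c \<odot>\<^bsub>M\<^esub> \<beta> v w"
  shows "bilinear_map K V W M \<beta>"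
  using assms unfolding bilinear_map_def LinearCombinations.module_hom_def by auto

lemma bilinear_mapD:
  assumes "bilinear_map K V W M \<beta>"
  shows "\<lbrakk>v \<in> carrier V; w \<in> carrier W\<rbrakk> \<Longrightarrow> \<beta> v w \<in> carrier M"
    and "\<lbrakk>v \<in> carrier V; v' \<in> carrier V; w \<in> carrier W\<rbrakk> \<Longrightarrow>
      \<beta> (v \<oplus>\<^bsub>V\<^esub> v') w = \<beta> v w \<oplus>\<^bsub>M\<^esub> \<beta> v' w"
    and "\<lbrakk>v \<in> carrier V; w \<in> carrier W; w' \<in> carrier W\<rbrakk> \<Longrightarrow>
      \<beta> v (w \<oplus>\<^bsub>W\<^esub> w') = \<beta> v w \<oplus>\<^bsub>M\<^esub> \<beta> v w'"
    and "\<lbrakk>c \<in> carrier K; v \<in> carrier V; w \<in> carrier W\<rbrakk> \<Longrightarrow> \<beta> (c \<odot>\<^bsub>V\<^esub> v) w = c \<odot>\<^bsub>M\<^esub> \<beta> v w"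
    and "\<lbrakk>c \<in> carrier K; v \<in> carrier V; w \<in> carrier W\<rbrakk> \<Longrightarrow> \<beta> v (c \<odot>\<^bsub>W\<^esub> w) = c \<odot>\<^bsub>M\<^esub> \<beta> v w"
  using assms unfolding bilinear_map_def LinearCombinations.module_hom_def by auto

definition tensor ::
  "('k, 'm) ring_scheme \<Rightarrow> ('k, 'a, 'n) module_scheme \<Rightarrow> ('k, 'b, 'l) module_scheme
    \<Rightarrow> 'a \<Rightarrow> 'b \<Rightarrow> ('a \<times> 'b \<Rightarrow> 'k) set"
  where "tensor K V W v w =
    tensor_null K V W +>\<^bsub>free_module K (carrier V \<times> carrier W)\<^esub> free_gen K (v, w)"

text \<open>
  The linear map on the tensor product that a bilinear map \<open>\<beta>\<close> induces, evaluated at a chosen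
  representative of the coset.
\<close>

definition tensor_lift ::
  "('k, 'm) ring_scheme \<Rightarrow> ('k, 'c, 'o) module_scheme \<Rightarrow> ('a \<Rightarrow> 'b \<Rightarrow> 'c)
    \<Rightarrow> ('a \<times> 'b \<Rightarrow> 'k) set \<Rightarrow> 'c"
  where "tensor_lift K M \<beta> t = linear_extension K M (case_prod \<beta>) (SOME f. f \<in> t)"

locale module_pair = V: Module.module K V + W: Module.module K W
  for K :: "('k, 'm) ring_scheme" (structure)
    and V :: "('k, 'a, 'n) module_scheme" and W :: "('k, 'b, 'l) module_scheme"
begin

abbreviation "F \<equiv> free_module K (carrier V \<times> carrier W)"
abbreviation "N \<equiv> tensor_null K V W"
abbreviation "T \<equiv> tensor_product K V W"

sublocale F: Module.module K F by (rule V.R.module_free_module)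

lemma gen_closed: "v \<in> carrier V \<Longrightarrow> w \<in> carrier W \<Longrightarrow> free_gen K (v, w) \<in> carrier F"
  by (rule V.R.free_gen_closed) auto

lemma tensor_relations_closed: "tensor_relations K V W \<subseteq> carrier F"
  unfolding tensor_relations_def Let_def
  using gen_closed F.smult_closed F.M.add.m_closed F.M.minus_closed
  by (auto simp del: free_module_simps)

lemma null_submodule: "LinearCombinations.submodule K N F"
  unfolding tensor_null_def by (rule F.span_is_submodule[OF tensor_relations_closed])

sublocale T: Module.module K T
  unfolding tensor_product_def by (rule F.module_quotient_module[OF null_submodule])

lemmas T_carrier = F.quotient_carrier[OF null_submodule, folded tensor_product_def]
lemmas T_coset_hom = F.coset_hom[OF null_submodule, folded tensor_product_def]
lemmas T_add = F.quotient_add[OF null_submodule, folded tensor_product_def]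
lemmas T_smult = F.quotient_smult[OF null_submodule, folded tensor_product_def]
lemmas T_zero = F.quotient_zero[OF null_submodule, folded tensor_product_def]

lemma tensor_closed: "v \<in> carrier V \<Longrightarrow> w \<in> carrier W \<Longrightarrow> tensor K V W v w \<in> carrier T"
  unfolding tensor_def T_carrier using gen_closed by blast

lemma relation_null: "x \<in> tensor_relations K V W \<Longrightarrow> x \<in> N"
  unfolding tensor_null_def using F.in_own_span[OF tensor_relations_closed] by blast

lemma tensor_bilinear: "bilinear_map K V W T (tensor K V W)"
proof -
  have eq: "N +>\<^bsub>F\<^esub> f = N +>\<^bsub>F\<^esub> g"
    if "f \<in> carrier F" "g \<in> carrier F" "f \<ominus>\<^bsub>F\<^esub> g \<in> tensor_relations K V W" for f g
    using F.coset_eq_iff[OF null_submodule that(1,2)] relation_null[OF that(3)] by simp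
  note rel = tensor_relations_def Let_def
  have add_left: "tensor K V W (v \<oplus>\<^bsub>V\<^esub> v') w = tensor K V W v w \<oplus>\<^bsub>T\<^esub> tensor K V W v' w"
    if "v \<in> carrier V" "v' \<in> carrier V" "w \<in> carrier W" for v v' w
    unfolding tensor_def T_add[OF gen_closed gen_closed, OF that(1,3) that(2,3)]
    by (rule eq) (use that gen_closed F.M.add.m_closed in \<open>auto simp: rel simp del: free_module_simps\<close>)
  have add_right: "tensor K V W v (w \<oplus>\<^bsub>W\<^esub> w') = tensor K V W v w \<oplus>\<^bsub>T\<^esub> tensor K V W v w'"
    if "v \<in> carrier V" "w \<in> carrier W" "w' \<in> carrier W" for v w w'
    unfolding tensor_def T_add[OF gen_closed gen_closed, OF that(1,2) that(1,3)]
    by (rule eq) (use that gen_closed F.M.add.m_closed in \<open>auto simp: rel simp del: free_module_simps\<close>)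
  have smult_left: "tensor K V W (c \<odot>\<^bsub>V\<^esub> v) w = c \<odot>\<^bsub>T\<^esub> tensor K V W v w"
    if "c \<in> carrier K" "v \<in> carrier V" "w \<in> carrier W" for c v w
    unfolding tensor_def T_smult[OF that(1) gen_closed[OF that(2,3)]]
    by (rule eq) (use that gen_closed F.smult_closed in \<open>auto simp: rel simp del: free_module_simps\<close>)
  have smult_right: "tensor K V W v (c \<odot>\<^bsub>W\<^esub> w) = c \<odot>\<^bsub>T\<^esub> tensor K V W v w"
    if "c \<in> carrier K" "v \<in> carrier V" "w \<in> carrier W" for c v w
    unfolding tensor_def T_smult[OF that(1) gen_closed[OF that(2,3)]]
    by (rule eq) (use that gen_closed F.smult_closed in \<open>auto simp: rel simp del: free_module_simps\<close>)
  show ?thesis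
    by (rule bilinear_mapI) (fact tensor_closed add_left add_right smult_left smult_right)+
qed

text \<open>
  A scalar in front of a pure tensor can be moved into its first factor, so the pure tensors generate
  the tensor product already as an additive group. Every identity between additive maps on tensors is
  reduced to pure tensors by this rule.
\<close>

lemma tensor_induct:
  assumes t: "t \<in> carrier T"
    and gen: "\<And>v w. v \<in> carrier V \<Longrightarrow> w \<in> carrier W \<Longrightarrow> P (tensor K V W v w)"
    and add: "\<And>s t. s \<in> carrier T \<Longrightarrow> t \<in> carrier T \<Longrightarrow> P s \<Longrightarrow> P t \<Longrightarrow> P (s \<oplus>\<^bsub>T\<^esub> t)"
  shows "P t"
proof -
  have smult: "c \<odot>\<^bsub>T\<^esub> tensor K V W v w = tensor K V W (c \<odot>\<^bsub>V\<^esub> v) w"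
    if "c \<in> carrier K" "v \<in> carrier V" "w \<in> carrier W" for c v w
    using bilinear_mapD(4)[OF tensor_bilinear that] by simp
  obtain f where f: "f \<in> carrier F" "t = N +>\<^bsub>F\<^esub> f" using t unfolding T_carrier by auto
  have "P (N +>\<^bsub>F\<^esub> f)"
    using f(1)
  proof (rule V.R.free_module_induct)
    have "N +>\<^bsub>F\<^esub> \<zero>\<^bsub>F\<^esub> = \<zero> \<odot>\<^bsub>T\<^esub> tensor K V W \<zero>\<^bsub>V\<^esub> \<zero>\<^bsub>W\<^esub>"
      using tensor_closed T_zero by simp
    also have "\<dots> = tensor K V W (\<zero> \<odot>\<^bsub>V\<^esub> \<zero>\<^bsub>V\<^esub>) \<zero>\<^bsub>W\<^esub>" by (rule smult) auto
    finally show "P (N +>\<^bsub>F\<^esub> \<zero>\<^bsub>F\<^esub>)" using gen by simp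
  next
    fix c x assume c: "c \<in> carrier K" and x: "x \<in> carrier V \<times> carrier W"
    obtain v w where vw: "x = (v, w)" "v \<in> carrier V" "w \<in> carrier W" using x by auto
    have "N +>\<^bsub>F\<^esub> (c \<odot>\<^bsub>F\<^esub> free_gen K x) = tensor K V W (c \<odot>\<^bsub>V\<^esub> v) w"
      using T_smult[OF c gen_closed[OF vw(2,3)]] smult[OF c vw(2,3)] vw(1)
      unfolding tensor_def by simp
    then show "P (N +>\<^bsub>F\<^esub> (c \<odot>\<^bsub>F\<^esub> free_gen K x))" using gen c vw by simp
  next
    fix f g assume "f \<in> carrier F" "g \<in> carrier F" "P (N +>\<^bsub>F\<^esub> f)" "P (N +>\<^bsub>F\<^esub> g)"
    then show "P (N +>\<^bsub>F\<^esub> (f \<oplus>\<^bsub>F\<^esub> g))"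
      using add[of "N +>\<^bsub>F\<^esub> f" "N +>\<^bsub>F\<^esub> g"] T_add T_carrier by auto
  qed
  then show ?thesis using f by simp
qed

context
  fixes M :: "('k, 'c, 'o) module_scheme" and \<beta> :: "'a \<Rightarrow> 'b \<Rightarrow> 'c"
  assumes M: "Module.module K M" and \<beta>: "bilinear_map K V W M \<beta>"
begin

interpretation M: Module.module K M by (rule M)

lemma bilinear_closed: "v \<in> carrier V \<Longrightarrow> w \<in> carrier W \<Longrightarrow> \<beta> v w \<in> carrier M"
  by (rule bilinear_mapD(1)[OF \<beta>])

lemma bilinear_extension_hom:
  "linear_extension K M (case_prod \<beta>) \<in> LinearCombinations.module_hom K F M"
  using bilinear_closed by (intro M.linear_extension_hom) auto

lemma bilinear_extension_gen:
  "v \<in> carrier V \<Longrightarrow> w \<in> carrier W \<Longrightarrow> linear_extension K M (case_prod \<beta>) (free_gen K (v, w)) = \<beta> v w"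
  using M.linear_extension_gen[of "case_prod \<beta>" "carrier V \<times> carrier W" "(v, w)"] bilinear_closed
  by (auto simp: Pi_iff)

interpretation E: LinearCombinations.mod_hom K F M "linear_extension K M (case_prod \<beta>)"
  by (intro LinearCombinations.mod_hom.intro mod_hom_axioms.intro bilinear_extension_hom)
    (rule F.module_axioms M)+

text \<open>
  On the four kinds of generating relations the claim is the bilinearity of \<open>\<beta>\<close>; the kernel of the
  extension, being a submodule, then contains their span.
\<close>

lemma bilinear_extension_null:
  assumes "f \<in> N"
  shows "linear_extension K M (case_prod \<beta>) f = \<zero>\<^bsub>M\<^esub>"
proof -
  have "tensor_relations K V W \<subseteq> E.ker"
    unfolding E.ker_def
  proof (intro subsetI CollectI conjI)
    fix x assume x: "x \<in> tensor_relations K V W"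
    then show "x \<in> carrier F" using tensor_relations_closed by auto
    show "linear_extension K M (case_prod \<beta>) x = \<zero>\<^bsub>M\<^esub>"
      using x unfolding tensor_relations_def Let_def
      by (auto simp: gen_closed bilinear_extension_gen bilinear_closed bilinear_mapD[OF \<beta>]
          simp del: free_module_simps)
  qed
  then have "N \<subseteq> E.ker"
    unfolding tensor_null_def by (intro F.span_is_subset E.ker_is_submodule)
  then show ?thesis using assms E.f_ker by blast
qed

lemma tensor_lift_coset:
  assumes "f \<in> carrier F"
  shows "tensor_lift K M \<beta> (N +>\<^bsub>F\<^esub> f) = linear_extension K M (case_prod \<beta>) f"
proof -
  interpret N: abelian_subgroup N F by (rule F.submodule_abelian_subgroup[OF null_submodule])
  have "(SOME g. g \<in> N +>\<^bsub>F\<^esub> f) \<in> N +>\<^bsub>F\<^esub> f" using N.a_rcos_self[OF assms] by (subst some_in_eq) blast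
  then show ?thesis
    unfolding tensor_lift_def
    by (intro F.hom_const_on_coset[OF null_submodule M bilinear_extension_hom _ assms])
      (rule bilinear_extension_null)
qed

lemma tensor_lift_hom: "tensor_lift K M \<beta> \<in> LinearCombinations.module_hom K T M"
  unfolding LinearCombinations.module_hom_def T_carrier
  by (auto simp: T_add T_smult tensor_lift_coset simp del: free_module_simps)

lemma tensor_lift_tensor:
  "v \<in> carrier V \<Longrightarrow> w \<in> carrier W \<Longrightarrow> tensor_lift K M \<beta> (tensor K V W v w) = \<beta> v w"
  unfolding tensor_def by (simp add: gen_closed tensor_lift_coset bilinear_extension_gen)

end

end

context cring
begin

lemma free_module_finsum_apply:
  assumes "finite X" "\<And>x. x \<in> X \<Longrightarrow> \<phi> x \<in> carrier (free_module R S)"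
  shows "(\<Oplus>\<^bsub>free_module R S\<^esub>x\<in>X. \<phi> x) y = (\<Oplus>x\<in>X. \<phi> x y)"
  using assms
proof (induction X)
  case empty
  interpret F: Module.module R "free_module R S" by (rule module_free_module)
  show ?case by simp
next
  case (insert x X)
  interpret F: Module.module R "free_module R S" by (rule module_free_module)
  have "(\<Oplus>\<^bsub>free_module R S\<^esub>x\<in>insert x X. \<phi> x)
      = \<phi> x \<oplus>\<^bsub>free_module R S\<^esub> (\<Oplus>\<^bsub>free_module R S\<^esub>x\<in>X. \<phi> x)"
    using insert by (intro F.M.finsum_insert) auto
  then have "(\<Oplus>\<^bsub>free_module R S\<^esub>x\<in>insert x X. \<phi> x) y = \<phi> x y \<oplus> (\<Oplus>x\<in>X. \<phi> x y)"
    using insert by simp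
  also have "\<dots> = (\<Oplus>x\<in>insert x X. \<phi> x y)"
    using insert free_module_closed[of _ S] by (intro finsum_insert[symmetric]) auto
  finally show ?case .
qed

text \<open>
  At \<open>y\<close>, both sides add up the values of \<open>f\<close> over the points of its support that \<open>h\<close> maps to \<open>y\<close>.
\<close>

lemma free_map_eq_linear_extension:
  assumes f: "f \<in> carrier (free_module R S)" and h: "\<And>x. x \<in> S \<Longrightarrow> h x \<in> S'"
  shows "free_map R h f = linear_extension R (free_module R S') (\<lambda>x. free_gen R (h x)) f"
proof
  fix y
  interpret F: Module.module R "free_module R S'" by (rule module_free_module)
  let ?X = "{x. f x \<noteq> \<zero>}"
  have X: "finite ?X" "?X \<subseteq> S" using f by (auto simp: free_module_carrier)
  have fc: "f x \<in> carrier R" for x using free_module_closed[OF f] .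
  have "linear_extension R (free_module R S') (\<lambda>x. free_gen R (h x)) f y
      = (\<Oplus>x\<in>?X. (f x \<odot>\<^bsub>free_module R S'\<^esub> free_gen R (h x)) y)"
    unfolding linear_extension_def
  proof (rule free_module_finsum_apply[OF X(1)])
    fix x assume "x \<in> ?X"
    then have "h x \<in> S'" using X h by blast
    then show "f x \<odot>\<^bsub>free_module R S'\<^esub> free_gen R (h x) \<in> carrier (free_module R S')"
      by (intro F.smult_closed fc free_gen_closed)
  qed
  also have "\<dots> = (\<Oplus>x\<in>{x. f x \<noteq> \<zero> \<and> h x = y}. f x)"
    using X fc by (intro add.finprod_mono_neutral_cong_right) (auto simp: free_gen_def)
  finally show "free_map R h f y = linear_extension R (free_module R S') (\<lambda>x. free_gen R (h x)) f y"
    unfolding free_map_def by simp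
qed

end

section \<open>Contractions and nearly Frobenius coproducts\<close>

lemma (in LinearCombinations.mod_hom) hom_finsum:
  assumes "g \<in> X \<rightarrow> carrier M"
  shows "f (\<Oplus>\<^bsub>M\<^esub>x\<in>X. g x) = (\<Oplus>\<^bsub>N\<^esub>x\<in>X. f (g x))"
  using assms
proof (induction X rule: infinite_finite_induct)
  case (insert x X)
  then have g: "g x \<in> carrier M" "g \<in> X \<rightarrow> carrier M" by auto
  then have "f (g x \<oplus>\<^bsub>M\<^esub> (\<Oplus>\<^bsub>M\<^esub>y\<in>X. g y)) = f (g x) \<oplus>\<^bsub>N\<^esub> (\<Oplus>\<^bsub>N\<^esub>y\<in>X. f (g y))"
    using insert.IH by (simp add: M.M.finsum_closed)
  then show ?case using insert.hyps g by (simp add: Pi_iff M.M.finsum_insert N.M.finsum_insert)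
qed simp_all

sublocale assoc_algebra \<subseteq> AA: module_pair K A A ..

text \<open>
  The maps \<open>id \<otimes> \<phi>\<close> and \<open>\<phi> \<otimes> id\<close> from \<open>A \<otimes> A\<close> to \<open>A\<close>.
\<close>

definition contract ::
  "('k, 'm) ring_scheme \<Rightarrow> ('k, 'a, 'n) module_scheme \<Rightarrow> ('a \<Rightarrow> 'k) \<Rightarrow> ('a \<times> 'a \<Rightarrow> 'k) set \<Rightarrow> 'a"
  where "contract K A \<phi> = tensor_lift K A (\<lambda>v w. \<phi> w \<odot>\<^bsub>A\<^esub> v)"

definition contract_left ::
  "('k, 'm) ring_scheme \<Rightarrow> ('k, 'a, 'n) module_scheme \<Rightarrow> ('a \<Rightarrow> 'k) \<Rightarrow> ('a \<times> 'a \<Rightarrow> 'k) set \<Rightarrow> 'a"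
  where "contract_left K A \<phi> = tensor_lift K A (\<lambda>v w. \<phi> v \<odot>\<^bsub>A\<^esub> w)"

context assoc_algebra
begin

abbreviation "T \<equiv> tensor_product K A A"
abbreviation tns (infixl \<open>\<box>\<close> 75) where "v \<box> w \<equiv> tensor K A A v w"
abbreviation "act \<equiv> bimodule_act K A"
abbreviation "E \<equiv> frobenius_space K A"

lemma module_A: "Module.module K A" ..
lemma module_T: "Module.module K T" by (rule AA.T.module_axioms)

lemmas tns_closed [simp] = AA.tensor_closed
lemmas tns_simps = bilinear_mapD(2-5)[OF AA.tensor_bilinear]

subsection \<open>The bimodule action\<close>

lemma act_bilinear:
  assumes "a \<in> carrier A" "d \<in> carrier A"
  shows "bilinear_map K A A T (\<lambda>b c. (a \<otimes> b) \<box> (c \<otimes> d))"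
  using assms by (intro bilinear_mapI)
    (simp_all add: tns_simps r_distr l_distr smult_mult_left smult_mult_right)

text \<open>
  Composed with the projection onto cosets, the map of representatives that sends the generator
  \<open>(b, c)\<close> to \<open>(a b, c d)\<close> is the linear extension of a bilinear map. It is therefore constant on
  cosets, which evaluates the union over representatives in the definition of the action.
\<close>

lemma act_eq_lift:
  assumes "a \<in> carrier A" "d \<in> carrier A" "t \<in> carrier T"
  shows "act a t d = tensor_lift K T (\<lambda>b c. (a \<otimes> b) \<box> (c \<otimes> d)) t"
proof -
  let ?\<beta> = "\<lambda>b c. (a \<otimes> b) \<box> (c \<otimes> d)"
  let ?h = "\<lambda>(b, c). (a \<otimes> b, c \<otimes> d)"
  let ?AA = "carrier A \<times> carrier A"
  interpret N: abelian_subgroup AA.N AA.F by (rule AA.F.submodule_abelian_subgroup[OF AA.null_submodule])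
  interpret \<pi>: LinearCombinations.mod_hom K AA.F T "\<lambda>f. AA.N +>\<^bsub>AA.F\<^esub> f"
    by (intro LinearCombinations.mod_hom.intro mod_hom_axioms.intro AA.T_coset_hom
        AA.F.module_axioms module_T)
  note bil = act_bilinear[OF assms(1,2)]
  have free: "AA.N +>\<^bsub>AA.F\<^esub> free_map K ?h f = linear_extension K T (case_prod ?\<beta>) f"
    if f: "f \<in> carrier AA.F" for f
  proof -
    let ?X = "{x. f x \<noteq> \<zero>\<^bsub>K\<^esub>}"
    have X: "?X \<subseteq> ?AA" using f by (auto simp: free_module_carrier)
    have fc: "f x \<in> carrier K" for x using R.free_module_closed[OF f] .
    have g: "free_gen K (?h x) \<in> carrier AA.F" if "x \<in> ?AA" for x
      using that assms AA.gen_closed by auto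
    have map: "free_map K ?h f = linear_extension K AA.F (\<lambda>x. free_gen K (?h x)) f"
      by (rule R.free_map_eq_linear_extension[OF f]) (use assms in auto)
    have "AA.N +>\<^bsub>AA.F\<^esub> free_map K ?h f
        = AA.N +>\<^bsub>AA.F\<^esub> linear_extension K AA.F (\<lambda>x. free_gen K (?h x)) f"
      unfolding map ..
    also have "\<dots> = (\<Oplus>\<^bsub>T\<^esub>x\<in>?X. AA.N +>\<^bsub>AA.F\<^esub> (f x \<odot>\<^bsub>AA.F\<^esub> free_gen K (?h x)))"
      unfolding linear_extension_def using X fc g AA.F.smult_closed
      by (intro \<pi>.hom_finsum) (auto simp del: free_module_simps)
    also have "\<dots> = (\<Oplus>\<^bsub>T\<^esub>x\<in>?X. f x \<odot>\<^bsub>T\<^esub> case_prod ?\<beta> x)"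
    proof (rule AA.T.M.finsum_cong')
      fix x assume "x \<in> ?X"
      then have x: "x \<in> ?AA" using X by auto
      then show "AA.N +>\<^bsub>AA.F\<^esub> (f x \<odot>\<^bsub>AA.F\<^esub> free_gen K (?h x)) = f x \<odot>\<^bsub>T\<^esub> case_prod ?\<beta> x"
        using AA.T_smult[OF fc g[OF x]] by (auto simp: tensor_def)
    next
      show "(\<lambda>x. f x \<odot>\<^bsub>T\<^esub> case_prod ?\<beta> x) \<in> ?X \<rightarrow> carrier T"
        using X fc assms by auto
    qed simp
    finally show ?thesis unfolding linear_extension_def .
  qed
  obtain f where f: "f \<in> carrier AA.F" "t = AA.N +>\<^bsub>AA.F\<^esub> f"
    using assms(3) unfolding AA.T_carrier by auto
  have "act a t d = (\<Union>g\<in>AA.N +>\<^bsub>AA.F\<^esub> f. AA.N +>\<^bsub>AA.F\<^esub> free_map K ?h g)"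
    unfolding bimodule_act_def f(2) by simp
  also have "\<dots> = AA.N +>\<^bsub>AA.F\<^esub> free_map K ?h f"
  proof (rule AA.F.coset_union_const[OF AA.null_submodule f(1)])
    fix g assume g: "g \<in> AA.N +>\<^bsub>AA.F\<^esub> f"
    then have gF: "g \<in> carrier AA.F" using f N.a_elemrcos_carrier by blast
    have "linear_extension K T (case_prod ?\<beta>) g = linear_extension K T (case_prod ?\<beta>) f"
      by (rule AA.F.hom_const_on_coset[OF AA.null_submodule module_T
            AA.bilinear_extension_hom[OF module_T bil]
            AA.bilinear_extension_null[OF module_T bil] f(1) g])
    then show "AA.N +>\<^bsub>AA.F\<^esub> free_map K ?h g = AA.N +>\<^bsub>AA.F\<^esub> free_map K ?h f"
      using free f(1) gF by simp
  qed
  also have "\<dots> = tensor_lift K T ?\<beta> t"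
    unfolding free[OF f(1)] f(2) AA.tensor_lift_coset[OF module_T bil f(1)] ..
  finally show ?thesis .
qed

lemma act_tns [simp]:
  "\<lbrakk>a \<in> carrier A; d \<in> carrier A; v \<in> carrier A; w \<in> carrier A\<rbrakk> \<Longrightarrow>
    act a (v \<box> w) d = (a \<otimes> v) \<box> (w \<otimes> d)"
  by (simp add: act_eq_lift AA.tensor_lift_tensor[OF module_T act_bilinear])

lemma act_hom:
  assumes "a \<in> carrier A" "d \<in> carrier A"
  shows "(\<lambda>t. act a t d) \<in> LinearCombinations.module_hom K T T"
  using AA.tensor_lift_hom[OF module_T act_bilinear[OF assms]] assms
  unfolding LinearCombinations.module_hom_def by (auto simp: act_eq_lift)

lemma act_closed [simp]:
    "\<lbrakk>a \<in> carrier A; d \<in> carrier A; t \<in> carrier T\<rbrakk> \<Longrightarrow> act a t d \<in> carrier T"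
  and act_add: "\<lbrakk>a \<in> carrier A; d \<in> carrier A; s \<in> carrier T; t \<in> carrier T\<rbrakk> \<Longrightarrow>
    act a (s \<oplus>\<^bsub>T\<^esub> t) d = act a s d \<oplus>\<^bsub>T\<^esub> act a t d"
  and act_smult: "\<lbrakk>a \<in> carrier A; d \<in> carrier A; c \<in> carrier K; t \<in> carrier T\<rbrakk> \<Longrightarrow>
    act a (c \<odot>\<^bsub>T\<^esub> t) d = c \<odot>\<^bsub>T\<^esub> act a t d"
  using act_hom[of a d] unfolding LinearCombinations.module_hom_def by blast+

lemma act_zero [simp]:
  assumes "a \<in> carrier A" "d \<in> carrier A"
  shows "act a \<zero>\<^bsub>T\<^esub> d = \<zero>\<^bsub>T\<^esub>"
  using act_smult[OF assms, of "\<zero>\<^bsub>K\<^esub>" "\<zero>\<^bsub>T\<^esub>"] assms by simp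

lemma act_act:
  assumes "a \<in> carrier A" "b \<in> carrier A" "c \<in> carrier A" "d \<in> carrier A" "t \<in> carrier T"
  shows "act a (act b t c) d = act (a \<otimes> b) t (c \<otimes> d)"
  using assms(5) by (rule AA.tensor_induct)
    (use assms in \<open>simp_all add: act_add m_assoc\<close>)

lemma act_add_left:
  assumes "a \<in> carrier A" "b \<in> carrier A" "d \<in> carrier A" "t \<in> carrier T"
  shows "act (a \<oplus> b) t d = act a t d \<oplus>\<^bsub>T\<^esub> act b t d"
  using assms(4) by (rule AA.tensor_induct)
    (use assms in \<open>simp_all add: act_add l_distr tns_simps AA.T.M.a_ac\<close>)

lemma act_smult_left:
  assumes "a \<in> carrier A" "d \<in> carrier A" "t \<in> carrier T" "c \<in> carrier K"
  shows "act (c \<odot> a) t d = c \<odot>\<^bsub>T\<^esub> act a t d"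
  using assms(3) by (rule AA.tensor_induct)
    (use assms in \<open>simp_all add: act_add smult_mult_left tns_simps AA.T.smult_r_distr\<close>)

subsection \<open>Contractions\<close>

context
  fixes \<phi> assumes \<phi>: "\<phi> \<in> linear_forms K A"
begin

lemma contract_bilinear: "bilinear_map K A A A (\<lambda>v w. \<phi> w \<odot> v)"
  using linear_form_closed[OF \<phi>] linear_form_add[OF \<phi>] linear_form_smult[OF \<phi>]
  by (intro bilinear_mapI)
    (simp_all add: smult_l_distr smult_r_distr smult_assoc_simp R.m_comm)

lemma contract_left_bilinear: "bilinear_map K A A A (\<lambda>v w. \<phi> v \<odot> w)"
  using linear_form_closed[OF \<phi>] linear_form_add[OF \<phi>] linear_form_smult[OF \<phi>]
  by (intro bilinear_mapI)
    (simp_all add: smult_l_distr smult_r_distr smult_assoc_simp R.m_comm)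

lemma contract_tns [simp]:
  "\<lbrakk>v \<in> carrier A; w \<in> carrier A\<rbrakk> \<Longrightarrow> contract K A \<phi> (v \<box> w) = \<phi> w \<odot> v"
  unfolding contract_def by (rule AA.tensor_lift_tensor[OF module_A contract_bilinear])

lemma contract_left_tns [simp]:
  "\<lbrakk>v \<in> carrier A; w \<in> carrier A\<rbrakk> \<Longrightarrow> contract_left K A \<phi> (v \<box> w) = \<phi> v \<odot> w"
  unfolding contract_left_def by (rule AA.tensor_lift_tensor[OF module_A contract_left_bilinear])

lemma contract_closed [simp]: "t \<in> carrier T \<Longrightarrow> contract K A \<phi> t \<in> carrier A"
  and contract_add: "\<lbrakk>s \<in> carrier T; t \<in> carrier T\<rbrakk> \<Longrightarrow>
    contract K A \<phi> (s \<oplus>\<^bsub>T\<^esub> t) = contract K A \<phi> s \<oplus> contract K A \<phi> t"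
  and contract_smult: "\<lbrakk>c \<in> carrier K; t \<in> carrier T\<rbrakk> \<Longrightarrow>
    contract K A \<phi> (c \<odot>\<^bsub>T\<^esub> t) = c \<odot> contract K A \<phi> t"
  using AA.tensor_lift_hom[OF module_A contract_bilinear]
  unfolding LinearCombinations.module_hom_def contract_def by blast+

lemma contract_left_closed [simp]: "t \<in> carrier T \<Longrightarrow> contract_left K A \<phi> t \<in> carrier A"
  and contract_left_add: "\<lbrakk>s \<in> carrier T; t \<in> carrier T\<rbrakk> \<Longrightarrow>
    contract_left K A \<phi> (s \<oplus>\<^bsub>T\<^esub> t) = contract_left K A \<phi> s \<oplus> contract_left K A \<phi> t"
  using AA.tensor_lift_hom[OF module_A contract_left_bilinear]
  unfolding LinearCombinations.module_hom_def contract_left_def by blast+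

end

lemma linear_form_compose_right:
  assumes "\<phi> \<in> linear_forms K A" "d \<in> carrier A"
  shows "(\<lambda>x. \<phi> (x \<otimes> d)) \<in> linear_forms K A"
  using linear_form_closed[OF assms(1)] linear_form_add[OF assms(1)] linear_form_smult[OF assms(1)] assms(2)
  by (intro linear_formI) (simp_all add: l_distr smult_mult_left)

text \<open>
  Both sides are \<open>(\<zeta> \<otimes> \<phi>) t\<close>.
\<close>

lemma contract_swap:
  assumes "\<phi> \<in> linear_forms K A" "\<zeta> \<in> linear_forms K A" "t \<in> carrier T"
  shows "\<phi> (contract_left K A \<zeta> t) = \<zeta> (contract K A \<phi> t)"
  using assms(3)
  by (rule AA.tensor_induct)
    (use assms linear_form_closed[OF assms(1)] linear_form_closed[OF assms(2)] in
      \<open>simp_all add: linear_form_add[OF assms(1)] linear_form_add[OF assms(2)]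
      linear_form_smult[OF assms(1)] linear_form_smult[OF assms(2)]
      contract_add contract_left_add R.m_comm\<close>)

lemma contract_act:
  assumes "\<phi> \<in> linear_forms K A" "a \<in> carrier A" "d \<in> carrier A" "t \<in> carrier T"
  shows "contract K A \<phi> (act a t d) = a \<otimes> contract K A (\<lambda>x. \<phi> (x \<otimes> d)) t"
proof -
  note \<phi>d = linear_form_compose_right[OF assms(1,3)]
  show ?thesis
    using assms(4)
    by (rule AA.tensor_induct)
      (use assms \<phi>d linear_form_closed[OF assms(1)] in
        \<open>simp_all add: act_add contract_add r_distr smult_mult_right\<close>)
qed

lemma contract_cong:
  assumes "\<phi> \<in> linear_forms K A" "\<psi> \<in> linear_forms K A" "t \<in> carrier T"
    and "\<And>x. x \<in> carrier A \<Longrightarrow> \<phi> x = \<psi> x"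
  shows "contract K A \<phi> t = contract K A \<psi> t"
  using assms(3) by (rule AA.tensor_induct) (use assms in \<open>simp_all add: contract_add\<close>)

text \<open>
  If \<open>(id \<otimes> \<psi>) t\<close> were nonzero, some form \<open>\<zeta>\<close> would be nonzero there. Then \<open>w = (\<zeta> \<otimes> id) t\<close> satisfies
  \<open>\<phi> w = \<zeta> ((id \<otimes> \<phi>) t) = 0\<close> for all \<open>\<phi> \<in> \<Phi>\<close>, but \<open>\<psi> w \<noteq> 0\<close>.
\<close>

lemma contract_common_kernel:
  assumes fd: "fin_dim" and \<Phi>: "\<Phi> \<subseteq> linear_forms K A" and \<psi>: "\<psi> \<in> linear_forms K A"
    and t: "t \<in> carrier T"
    and ker: "\<And>x. x \<in> carrier A \<Longrightarrow> (\<And>\<phi>. \<phi> \<in> \<Phi> \<Longrightarrow> \<phi> x = \<zero>\<^bsub>K\<^esub>) \<Longrightarrow> \<psi> x = \<zero>\<^bsub>K\<^esub>"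
    and zero: "\<And>\<phi>. \<phi> \<in> \<Phi> \<Longrightarrow> contract K A \<phi> t = \<zero>"
  shows "contract K A \<psi> t = \<zero>"
proof (rule ccontr)
  assume nz: "contract K A \<psi> t \<noteq> \<zero>"
  have sub: "VectorSpace.subspace K {\<zero>} A" unfolding subspace_alt by auto
  obtain \<zeta> where \<zeta>: "\<zeta> \<in> linear_forms K A" "\<zeta> (contract K A \<psi> t) \<noteq> \<zero>\<^bsub>K\<^esub>"
    using linear_form_avoiding_subspace[OF fd sub contract_closed[OF \<psi> t]] nz by auto
  have w: "contract_left K A \<zeta> t \<in> carrier A" using \<zeta> t by simp
  have "\<phi> (contract_left K A \<zeta> t) = \<zero>\<^bsub>K\<^esub>" if "\<phi> \<in> \<Phi>" for \<phi>
    using contract_swap[of \<phi> \<zeta> t] that \<Phi> \<zeta>(1) t zero[OF that] linear_form_zero[OF \<zeta>(1)] by auto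
  with ker[OF w] have "\<psi> (contract_left K A \<zeta> t) = \<zero>\<^bsub>K\<^esub>" by blast
  then show False
    using contract_swap[OF \<psi> \<zeta>(1) t] \<zeta>(2) by simp
qed

text \<open>
  For a pure tensor this is the expansion of its second factor in the basis.
\<close>

lemma tensor_expansion:
  assumes B: "finite B" "B \<subseteq> carrier A" and \<kappa>: "\<And>b. b \<in> B \<Longrightarrow> \<kappa> b \<in> linear_forms K A"
    and exp: "\<And>x. x \<in> carrier A \<Longrightarrow> lincomb (\<lambda>b. \<kappa> b x) B = x"
    and t: "t \<in> carrier T"
  shows "t = (\<Oplus>\<^bsub>T\<^esub>b\<in>B. contract K A (\<kappa> b) t \<box> b)"
  using t
proof (rule AA.tensor_induct)
  fix v w assume vw: "v \<in> carrier A" "w \<in> carrier A"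
  have "v \<box> w = v \<box> (\<Oplus>b\<in>B. \<kappa> b w \<odot> b)"
    using exp[OF vw(2)] unfolding lincomb_def by simp
  also have "\<dots> = (\<Oplus>\<^bsub>T\<^esub>b\<in>B. v \<box> (\<kappa> b w \<odot> b))"
  proof -
    have "(\<lambda>w. v \<box> w) \<in> LinearCombinations.module_hom K A T"
      using AA.tensor_bilinear vw unfolding bilinear_map_def by blast
    then interpret h: LinearCombinations.mod_hom K A T "\<lambda>w. v \<box> w"
      by (intro LinearCombinations.mod_hom.intro mod_hom_axioms.intro module_A module_T)
    show ?thesis
      using B \<kappa> linear_form_closed[OF \<kappa> vw(2)] by (intro h.hom_finsum) auto
  qed
  also have "\<dots> = (\<Oplus>\<^bsub>T\<^esub>b\<in>B. contract K A (\<kappa> b) (v \<box> w) \<box> b)"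
    using B \<kappa> vw linear_form_closed[OF \<kappa> vw(2)]
    by (intro AA.T.M.finsum_cong') (auto simp: tns_simps)
  finally show "v \<box> w = (\<Oplus>\<^bsub>T\<^esub>b\<in>B. contract K A (\<kappa> b) (v \<box> w) \<box> b)" .
next
  fix s t assume st: "s \<in> carrier T" "t \<in> carrier T"
    "s = (\<Oplus>\<^bsub>T\<^esub>b\<in>B. contract K A (\<kappa> b) s \<box> b)" "t = (\<Oplus>\<^bsub>T\<^esub>b\<in>B. contract K A (\<kappa> b) t \<box> b)"
  have "s \<oplus>\<^bsub>T\<^esub> t
      = (\<Oplus>\<^bsub>T\<^esub>b\<in>B. contract K A (\<kappa> b) s \<box> b) \<oplus>\<^bsub>T\<^esub> (\<Oplus>\<^bsub>T\<^esub>b\<in>B. contract K A (\<kappa> b) t \<box> b)"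
    using st(3,4) by metis
  also have "\<dots> = (\<Oplus>\<^bsub>T\<^esub>b\<in>B. contract K A (\<kappa> b) s \<box> b \<oplus>\<^bsub>T\<^esub> contract K A (\<kappa> b) t \<box> b)"
    using B \<kappa> st(1,2) by (intro AA.T.M.finsum_addf[symmetric]) auto
  also have "\<dots> = (\<Oplus>\<^bsub>T\<^esub>b\<in>B. contract K A (\<kappa> b) (s \<oplus>\<^bsub>T\<^esub> t) \<box> b)"
    using B \<kappa> st(1,2) by (intro AA.T.M.finsum_cong') (auto simp: tns_simps contract_add)
  finally show "s \<oplus>\<^bsub>T\<^esub> t = (\<Oplus>\<^bsub>T\<^esub>b\<in>B. contract K A (\<kappa> b) (s \<oplus>\<^bsub>T\<^esub> t) \<box> b)" .
qed

lemma tns_zero_left [simp]: "w \<in> carrier A \<Longrightarrow> \<zero> \<box> w = \<zero>\<^bsub>T\<^esub>"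
  using tns_simps(3)[of "\<zero>\<^bsub>K\<^esub>" "\<zero>" w] by simp

lemma tensor_eq_zero_of_contract:
  assumes fd: "fin_dim" and t: "t \<in> carrier T"
    and zero: "\<And>\<phi>. \<phi> \<in> linear_forms K A \<Longrightarrow> contract K A \<phi> t = \<zero>"
  shows "t = \<zero>\<^bsub>T\<^esub>"
proof -
  obtain B where B: "finite B" "basis B" using finite_basis_exists[OF fd] by blast
  then have BA: "B \<subseteq> carrier A" unfolding basis_def by auto
  obtain \<kappa> where \<kappa>: "\<And>b. b \<in> B \<Longrightarrow> \<kappa> b \<in> linear_forms K A"
    "\<And>x. x \<in> carrier A \<Longrightarrow> lincomb (\<lambda>b. \<kappa> b x) B = x"
    using basis_coordinates[OF B] by metis
  have "t = (\<Oplus>\<^bsub>T\<^esub>b\<in>B. contract K A (\<kappa> b) t \<box> b)"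
    by (rule tensor_expansion[OF B(1) BA \<kappa> t])
  also have "\<dots> = \<zero>\<^bsub>T\<^esub>"
    using BA zero \<kappa>(1) by (intro AA.T.M.add.finprod_one_eqI) auto
  finally show ?thesis .
qed

end

subsection \<open>The Frobenius space as a vector space\<close>

context assoc_algebra
begin

lemma frobenius_space_simps:
  "carrier E = {\<Delta> \<in> extensional (carrier A). nearly_frobenius K A \<Delta>}"
  "\<zero>\<^bsub>E\<^esub> = (\<lambda>x\<in>carrier A. \<zero>\<^bsub>T\<^esub>)"
  "\<Delta> \<oplus>\<^bsub>E\<^esub> \<Gamma> = (\<lambda>x\<in>carrier A. \<Delta> x \<oplus>\<^bsub>T\<^esub> \<Gamma> x)"
  "c \<odot>\<^bsub>E\<^esub> \<Delta> = (\<lambda>x\<in>carrier A. c \<odot>\<^bsub>T\<^esub> \<Delta> x)"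
  by (simp_all add: frobenius_space_def Let_def)

lemma coproductD:
  assumes "\<Delta> \<in> carrier E"
  shows "x \<in> carrier A \<Longrightarrow> \<Delta> x \<in> carrier T"
    and "\<lbrakk>x \<in> carrier A; y \<in> carrier A\<rbrakk> \<Longrightarrow> \<Delta> (x \<oplus> y) = \<Delta> x \<oplus>\<^bsub>T\<^esub> \<Delta> y"
    and "\<lbrakk>c \<in> carrier K; x \<in> carrier A\<rbrakk> \<Longrightarrow> \<Delta> (c \<odot> x) = c \<odot>\<^bsub>T\<^esub> \<Delta> x"
    and "\<lbrakk>a \<in> carrier A; x \<in> carrier A; d \<in> carrier A\<rbrakk> \<Longrightarrow>
      \<Delta> (a \<otimes> x \<otimes> d) = act a (\<Delta> x) d"
    and "x \<notin> carrier A \<Longrightarrow> \<Delta> x = undefined"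
  using assms
  unfolding frobenius_space_simps nearly_frobenius_def LinearCombinations.module_hom_def
  by (auto simp: extensional_def)

lemma coproductI:
  assumes "\<And>x. x \<in> carrier A \<Longrightarrow> \<Delta> x \<in> carrier T"
    and "\<And>x y. \<lbrakk>x \<in> carrier A; y \<in> carrier A\<rbrakk> \<Longrightarrow> \<Delta> (x \<oplus> y) = \<Delta> x \<oplus>\<^bsub>T\<^esub> \<Delta> y"
    and "\<And>c x. \<lbrakk>c \<in> carrier K; x \<in> carrier A\<rbrakk> \<Longrightarrow> \<Delta> (c \<odot> x) = c \<odot>\<^bsub>T\<^esub> \<Delta> x"
    and "\<And>a x d. \<lbrakk>a \<in> carrier A; x \<in> carrier A; d \<in> carrier A\<rbrakk> \<Longrightarrow>
      \<Delta> (a \<otimes> x \<otimes> d) = act a (\<Delta> x) d"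
  shows "restrict \<Delta> (carrier A) \<in> carrier E"
  using assms
  unfolding frobenius_space_simps nearly_frobenius_def LinearCombinations.module_hom_def
  by auto

lemma coproduct_eqI:
  assumes "\<Delta> \<in> carrier E" "\<Gamma> \<in> carrier E" "\<And>x. x \<in> carrier A \<Longrightarrow> \<Delta> x = \<Gamma> x"
  shows "\<Delta> = \<Gamma>"
  using assms coproductD(5) by (metis ext)

lemma E_zero_closed: "\<zero>\<^bsub>E\<^esub> \<in> carrier E"
  unfolding frobenius_space_simps(2) by (rule coproductI) simp_all

lemma E_add_closed:
  assumes "\<Delta> \<in> carrier E" "\<Gamma> \<in> carrier E"
  shows "\<Delta> \<oplus>\<^bsub>E\<^esub> \<Gamma> \<in> carrier E"
  unfolding frobenius_space_simps(3)
  using coproductD[OF assms(1)] coproductD[OF assms(2)]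
  by (intro coproductI) (simp_all add: AA.T.M.a_ac AA.T.smult_r_distr act_add)

lemma E_smult_closed:
  assumes "c \<in> carrier K" "\<Delta> \<in> carrier E"
  shows "c \<odot>\<^bsub>E\<^esub> \<Delta> \<in> carrier E"
  unfolding frobenius_space_simps(4)
  using coproductD[OF assms(2)] assms(1)
  by (intro coproductI)
    (simp_all add: AA.T.smult_r_distr AA.T.smult_assoc_simp R.m_comm act_smult)

lemma E_apply [simp]:
  assumes "x \<in> carrier A"
  shows "\<zero>\<^bsub>E\<^esub> x = \<zero>\<^bsub>T\<^esub>" "(\<Delta> \<oplus>\<^bsub>E\<^esub> \<Gamma>) x = \<Delta> x \<oplus>\<^bsub>T\<^esub> \<Gamma> x" "(c \<odot>\<^bsub>E\<^esub> \<Delta>) x = c \<odot>\<^bsub>T\<^esub> \<Delta> x"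
  using assms by (simp_all add: frobenius_space_simps)

lemma vectorspace_E: "vectorspace K E"
proof (rule vs_criteria)
  show "field K" by (rule field_axioms)
  note closed = E_zero_closed E_add_closed E_smult_closed
  note eq = coproduct_eqI
  show "\<zero>\<^bsub>E\<^esub> \<in> carrier E" by (rule E_zero_closed)
  show "\<forall>v w. v \<in> carrier E \<and> w \<in> carrier E \<longrightarrow> v \<oplus>\<^bsub>E\<^esub> w \<in> carrier E"
    using E_add_closed by blast
  show "\<forall>c v. c \<in> carrier K \<and> v \<in> carrier E \<longrightarrow> c \<odot>\<^bsub>E\<^esub> v \<in> carrier E"
    using E_smult_closed by blast
  show "\<forall>v\<in>carrier E. \<exists>w\<in>carrier E. v \<oplus>\<^bsub>E\<^esub> w = \<zero>\<^bsub>E\<^esub>"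
  proof
    fix \<Delta> assume \<Delta>: "\<Delta> \<in> carrier E"
    have m: "(\<ominus>\<^bsub>K\<^esub> \<one>\<^bsub>K\<^esub>) \<odot>\<^bsub>E\<^esub> \<Delta> \<in> carrier E" by (rule E_smult_closed[OF _ \<Delta>]) simp
    have "\<Delta> \<oplus>\<^bsub>E\<^esub> (\<ominus>\<^bsub>K\<^esub> \<one>\<^bsub>K\<^esub>) \<odot>\<^bsub>E\<^esub> \<Delta> = \<zero>\<^bsub>E\<^esub>"
      by (rule eq[OF E_add_closed[OF \<Delta> m] E_zero_closed])
        (use coproductD(1)[OF \<Delta>] in \<open>simp add: AA.T.smult_minus_1 AA.T.M.r_neg\<close>)
    with m show "\<exists>w\<in>carrier E. \<Delta> \<oplus>\<^bsub>E\<^esub> w = \<zero>\<^bsub>E\<^esub>" by blast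
  qed
  show "\<forall>v w. v \<in> carrier E \<and> w \<in> carrier E \<longrightarrow> v \<oplus>\<^bsub>E\<^esub> w = w \<oplus>\<^bsub>E\<^esub> v"
    by (intro allI impI eq) (auto intro: closed simp: coproductD AA.T.M.a_comm)
  show "\<forall>v w x. v \<in> carrier E \<and> w \<in> carrier E \<and> x \<in> carrier E \<longrightarrow>
      v \<oplus>\<^bsub>E\<^esub> w \<oplus>\<^bsub>E\<^esub> x = v \<oplus>\<^bsub>E\<^esub> (w \<oplus>\<^bsub>E\<^esub> x)"
    by (intro allI impI eq) (auto intro: closed simp: coproductD AA.T.M.a_assoc)
  show "\<forall>v\<in>carrier E. v \<oplus>\<^bsub>E\<^esub> \<zero>\<^bsub>E\<^esub> = v"
    by (intro ballI eq) (auto intro: closed simp: coproductD)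
  show "\<forall>a b v. a \<in> carrier K \<and> b \<in> carrier K \<and> v \<in> carrier E \<longrightarrow>
      (a \<otimes>\<^bsub>K\<^esub> b) \<odot>\<^bsub>E\<^esub> v = a \<odot>\<^bsub>E\<^esub> (b \<odot>\<^bsub>E\<^esub> v)"
    by (intro allI impI eq) (auto intro: closed simp: coproductD AA.T.smult_assoc1)
  show "\<forall>v\<in>carrier E. \<one>\<^bsub>K\<^esub> \<odot>\<^bsub>E\<^esub> v = v"
    by (intro ballI eq) (auto intro: closed simp: coproductD)
  show "\<forall>a b v. a \<in> carrier K \<and> b \<in> carrier K \<and> v \<in> carrier E \<longrightarrow>
      (a \<oplus>\<^bsub>K\<^esub> b) \<odot>\<^bsub>E\<^esub> v = a \<odot>\<^bsub>E\<^esub> v \<oplus>\<^bsub>E\<^esub> b \<odot>\<^bsub>E\<^esub> v"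
    by (intro allI impI eq) (auto intro: closed simp: coproductD AA.T.smult_l_distr)
  show "\<forall>a v w. a \<in> carrier K \<and> v \<in> carrier E \<and> w \<in> carrier E \<longrightarrow>
      a \<odot>\<^bsub>E\<^esub> (v \<oplus>\<^bsub>E\<^esub> w) = a \<odot>\<^bsub>E\<^esub> v \<oplus>\<^bsub>E\<^esub> a \<odot>\<^bsub>E\<^esub> w"
    by (intro allI impI eq) (auto intro: closed simp: coproductD AA.T.smult_r_distr)
qed

subsection \<open>Coproducts and central tensors\<close>

lemma coproduct_act_left:
  assumes "\<Delta> \<in> carrier E" "a \<in> carrier A"
  shows "\<Delta> a = act a (\<Delta> \<one>) \<one>"
  using coproductD(4)[OF assms(1), of a "\<one>" "\<one>"] assms(2) by simp

lemma coproduct_act_right: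
  assumes "\<Delta> \<in> carrier E" "a \<in> carrier A"
  shows "\<Delta> a = act \<one> (\<Delta> \<one>) a"
  using coproductD(4)[OF assms(1), of "\<one>" "\<one>" a] assms(2) by simp

text \<open>
  Coproducts correspond to the tensors \<open>t\<close> with \<open>a \<cdot> t = t \<cdot> a\<close> for all \<open>a\<close>, by way of \<open>t = \<Delta> 1\<close>. This
  direction is the source of examples of coproducts.
\<close>

lemma coproduct_of_central:
  assumes t: "t \<in> carrier T"
    and central: "\<And>a. a \<in> carrier A \<Longrightarrow> act a t \<one> = act \<one> t a"
  shows "(\<lambda>x\<in>carrier A. act x t \<one>) \<in> carrier E"
proof (rule coproductI)
  fix a x d assume "a \<in> carrier A" "x \<in> carrier A" "d \<in> carrier A"
  note axd = this
  have "act (a \<otimes> x \<otimes> d) t \<one> = act (a \<otimes> x) (act d t \<one>) \<one>"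
    using axd t by (simp add: act_act)
  also have "\<dots> = act (a \<otimes> x) (act \<one> t d) \<one>" using central axd by simp
  also have "\<dots> = act a (act x t \<one>) d" using axd t by (simp add: act_act)
  finally show "act (a \<otimes> x \<otimes> d) t \<one> = act a (act x t \<one>) d" .
qed (use t in \<open>simp_all add: act_add_left act_smult_left\<close>)

text \<open>
  The contraction \<open>(id \<otimes> \<phi>) (\<Delta> 1)\<close>, the value at \<open>\<Delta> 1\<close> of a slice map of the tensor square.
\<close>

definition slice :: "('c \<Rightarrow> 'a) \<Rightarrow> ('c \<Rightarrow> ('c \<times> 'c \<Rightarrow> 'a) set) \<Rightarrow> 'c"
  where "slice \<phi> \<Delta> = contract K A \<phi> (\<Delta> \<one>)"

lemma slice_closed [simp]: "\<phi> \<in> linear_forms K A \<Longrightarrow> \<Delta> \<in> carrier E \<Longrightarrow> slice \<phi> \<Delta> \<in> carrier A"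
  unfolding slice_def by (simp add: coproductD(1))

lemma slice_linear_form:
  assumes "\<phi> \<in> linear_forms K A" "\<zeta> \<in> linear_forms K A"
  shows "(\<lambda>\<Delta>. \<zeta> (slice \<phi> \<Delta>)) \<in> linear_forms K E"
  using assms
  by (intro linear_formI)
    (simp_all add: linear_form_closed[OF assms(2)] slice_def coproductD(1) contract_add contract_smult
      linear_form_add[OF assms(2)] linear_form_smult[OF assms(2)])

text \<open>
  Both sides are the contraction of \<open>\<Delta> a\<close>, computed from \<open>\<Delta> a = a \<cdot> \<Delta> 1\<close> and from \<open>\<Delta> a = \<Delta> 1 \<cdot> a\<close>.
\<close>

lemma mult_slice:
  assumes \<phi>: "\<phi> \<in> linear_forms K A" and \<Delta>: "\<Delta> \<in> carrier E" and a: "a \<in> carrier A"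
  shows "a \<otimes> slice \<phi> \<Delta> = slice (\<lambda>x. \<phi> (x \<otimes> a)) \<Delta>"
proof -
  have t: "\<Delta> \<one> \<in> carrier T" using \<Delta> by (simp add: coproductD(1))
  have one: "contract K A (\<lambda>x. \<phi> (x \<otimes> \<one>)) (\<Delta> \<one>) = contract K A \<phi> (\<Delta> \<one>)"
    by (rule contract_cong[OF linear_form_compose_right[OF \<phi>] \<phi> t]) simp_all
  have "a \<otimes> slice \<phi> \<Delta> = contract K A \<phi> (act a (\<Delta> \<one>) \<one>)"
    unfolding slice_def using contract_act[OF \<phi> a _ t, of "\<one>"] one by simp
  also have "\<dots> = contract K A \<phi> (act \<one> (\<Delta> \<one>) a)"
    using coproduct_act_left[OF \<Delta> a] coproduct_act_right[OF \<Delta> a] by simp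
  also have "\<dots> = slice (\<lambda>x. \<phi> (x \<otimes> a)) \<Delta>"
    unfolding slice_def
    using contract_act[OF \<phi> _ a t, of "\<one>"] linear_form_compose_right[OF \<phi> a] t by simp
  finally show ?thesis .
qed

lemma slice_common_kernel:
  assumes "fin_dim" "\<Phi> \<subseteq> linear_forms K A" "\<psi> \<in> linear_forms K A" "\<Delta> \<in> carrier E"
    and "\<And>x. x \<in> carrier A \<Longrightarrow> (\<And>\<phi>. \<phi> \<in> \<Phi> \<Longrightarrow> \<phi> x = \<zero>\<^bsub>K\<^esub>) \<Longrightarrow> \<psi> x = \<zero>\<^bsub>K\<^esub>"
    and "\<And>\<phi>. \<phi> \<in> \<Phi> \<Longrightarrow> slice \<phi> \<Delta> = \<zero>"
  shows "slice \<psi> \<Delta> = \<zero>"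
  unfolding slice_def
proof (rule contract_common_kernel[OF assms(1-3)])
  show "\<Delta> \<one> \<in> carrier T" by (rule coproductD(1)[OF assms(4)]) simp
  show "contract K A \<phi> (\<Delta> \<one>) = \<zero>" if "\<phi> \<in> \<Phi>" for \<phi>
    using assms(6)[OF that] unfolding slice_def .
qed (rule assms(5))

text \<open>
  A form vanishes on the common kernel \<open>0\<close> of \<open>\<Phi>\<close>, so all contractions of \<open>\<Delta> 1\<close> vanish, and \<open>\<Delta> 1\<close>
  determines \<open>\<Delta>\<close>.
\<close>

lemma coproduct_eq_zero_of_slice:
  assumes fd: "fin_dim" and \<Delta>: "\<Delta> \<in> carrier E"
    and \<Phi>: "\<Phi> \<subseteq> linear_forms K A"
    and sep: "\<And>x. x \<in> carrier A \<Longrightarrow> (\<And>\<phi>. \<phi> \<in> \<Phi> \<Longrightarrow> \<phi> x = \<zero>\<^bsub>K\<^esub>) \<Longrightarrow> x = \<zero>"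
    and zero: "\<And>\<phi>. \<phi> \<in> \<Phi> \<Longrightarrow> slice \<phi> \<Delta> = \<zero>"
  shows "\<Delta> = \<zero>\<^bsub>E\<^esub>"
proof -
  have "slice \<psi> \<Delta> = \<zero>" if "\<psi> \<in> linear_forms K A" for \<psi>
    by (rule slice_common_kernel[OF fd \<Phi> that \<Delta>]) (use sep zero linear_form_zero[OF that] in blast)+
  then have "\<Delta> \<one> = \<zero>\<^bsub>T\<^esub>"
    using tensor_eq_zero_of_contract[OF fd, of "\<Delta> \<one>"] coproductD(1)[OF \<Delta>]
    unfolding slice_def by auto
  then have "\<Delta> x = \<zero>\<^bsub>E\<^esub> x" if "x \<in> carrier A" for x
    using coproduct_act_left[OF \<Delta> that] that by simp
  then show ?thesis by (rule coproduct_eqI[OF \<Delta> E_zero_closed])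
qed

end

section \<open>The extremal value of the dimension\<close>

context assoc_algebra
begin

text \<open>
  The largest right ideal of \<open>A\<close> contained in the kernel of \<open>\<phi>\<close>.
\<close>

definition right_kernel :: "('c \<Rightarrow> 'a) \<Rightarrow> 'c set"
  where "right_kernel \<phi> = {x \<in> carrier A. \<forall>a\<in>carrier A. \<phi> (x \<otimes> a) = \<zero>\<^bsub>K\<^esub>}"

lemma right_kernel_subspace:
  assumes "\<phi> \<in> linear_forms K A"
  shows "VectorSpace.subspace K (right_kernel \<phi>) A"
  unfolding subspace_alt right_kernel_def
  using linear_form_zero[OF assms] linear_form_add[OF assms] linear_form_smult[OF assms]
  by (auto simp: l_distr smult_mult_left)

lemma right_kernel_ideal:
  assumes "x \<in> right_kernel \<phi>" "a \<in> carrier A"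
  shows "x \<otimes> a \<in> right_kernel \<phi>"
  using assms unfolding right_kernel_def by (auto simp: m_assoc)

lemma right_kernel_ker: "x \<in> right_kernel \<phi> \<Longrightarrow> \<phi> x = \<zero>\<^bsub>K\<^esub>"
  using r_one[of x] one_closed unfolding right_kernel_def by fastforce

text \<open>
  If the contractions of \<open>\<Delta> 1\<close> against the forms in \<open>\<Phi>\<close> vanish, then so do those against their
  translates \<open>\<phi>(\<cdot> a)\<close>, whose common kernel lies in \<open>W\<close>. Together with \<open>dim W\<close> forms that separate the
  points of \<open>W\<close> the translates separate the points of \<open>A\<close>. Hence \<open>\<Delta>\<close> is determined by
  \<open>card \<Phi> + dim W\<close> contractions, each of which has \<open>dim A\<close> coordinates.
\<close>

lemma frobdim_bound:
  assumes fd: "fin_dim" and \<Phi>: "finite \<Phi>" "\<Phi> \<subseteq> linear_forms K A"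
    and W: "VectorSpace.subspace K W A"
    and sub: "\<And>x. x \<in> carrier A \<Longrightarrow> (\<And>\<phi>. \<phi> \<in> \<Phi> \<Longrightarrow> x \<in> right_kernel \<phi>) \<Longrightarrow> x \<in> W"
  shows "Frobdim K A \<le> (card \<Phi> + vectorspace.dim K (vs W)) * dim"
proof -
  interpret E: vectorspace K E by (rule vectorspace_E)
  obtain S :: "'c set" and \<sigma> where S: "finite S" "card S = vectorspace.dim K (vs W)"
    "\<And>s. s \<in> S \<Longrightarrow> \<sigma> s \<in> linear_forms K A"
    "\<And>x. x \<in> W \<Longrightarrow> (\<And>s. s \<in> S \<Longrightarrow> \<sigma> s x = \<zero>\<^bsub>K\<^esub>) \<Longrightarrow> x = \<zero>"
    using subspace_separating_forms[OF fd W] by blast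
  have "VectorSpace.subspace K (carrier A) A" unfolding subspace_alt by auto
  from subspace_separating_forms[OF fd this]
  obtain R :: "'c set" and \<rho> where R: "finite R" "card R = dim"
    "\<And>s. s \<in> R \<Longrightarrow> \<rho> s \<in> linear_forms K A"
    "\<And>x. x \<in> carrier A \<Longrightarrow> (\<And>s. s \<in> R \<Longrightarrow> \<rho> s x = \<zero>\<^bsub>K\<^esub>) \<Longrightarrow> x = \<zero>"
    by simp blast
  define \<Psi> where "\<Psi> = \<Phi> \<union> \<sigma> ` S"
  have \<Psi>: "finite \<Psi>" "\<Psi> \<subseteq> linear_forms K A" using \<Phi> S unfolding \<Psi>_def by auto
  have card\<Psi>: "card \<Psi> \<le> card \<Phi> + vectorspace.dim K (vs W)"
    unfolding \<Psi>_def using card_Un_le[of \<Phi> "\<sigma> ` S"] card_image_le[OF S(1), of \<sigma>] S(2) by linarith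
  have "E.dim \<le> card (\<Psi> \<times> R)"
  proof (rule E.dim_le_card_separating(2)[where \<phi> = "\<lambda>(\<psi>, s) \<Delta>. \<rho> s (slice \<psi> \<Delta>)"])
    show "finite (\<Psi> \<times> R)" using \<Psi> R by auto
    show "(\<lambda>(\<psi>, s) \<Delta>. \<rho> s (slice \<psi> \<Delta>)) p \<in> linear_forms K E" if "p \<in> \<Psi> \<times> R" for p
      using that slice_linear_form R(3) \<Psi>(2) by auto
    fix \<Delta> assume \<Delta>: "\<Delta> \<in> carrier E"
      and z: "\<And>p. p \<in> \<Psi> \<times> R \<Longrightarrow> (\<lambda>(\<psi>, s) \<Delta>. \<rho> s (slice \<psi> \<Delta>)) p \<Delta> = \<zero>\<^bsub>K\<^esub>"
    have zero: "slice \<psi> \<Delta> = \<zero>" if "\<psi> \<in> \<Psi>" for \<psi>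
      using z that \<Psi>(2) by (intro R(4) slice_closed \<Delta>) auto
    let ?\<Phi>' = "{\<lambda>x. \<phi> (x \<otimes> a) | \<phi> a. \<phi> \<in> \<Phi> \<and> a \<in> carrier A} \<union> \<sigma> ` S"
    show "\<Delta> = \<zero>\<^bsub>E\<^esub>"
    proof (rule coproduct_eq_zero_of_slice[OF fd \<Delta>, of ?\<Phi>'])
      show "?\<Phi>' \<subseteq> linear_forms K A" using S(3) \<Phi>(2) linear_form_compose_right by blast
    next
      fix \<psi> assume "\<psi> \<in> ?\<Phi>'"
      then consider \<phi> a where "\<psi> = (\<lambda>x. \<phi> (x \<otimes> a))" "\<phi> \<in> \<Phi>" "a \<in> carrier A" | "\<psi> \<in> \<Psi>"
        unfolding \<Psi>_def by auto
      then show "slice \<psi> \<Delta> = \<zero>"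
      proof cases
        case 1
        then have \<phi>: "\<phi> \<in> linear_forms K A" "\<phi> \<in> \<Psi>" using \<Phi>(2) \<Psi>_def by auto
        show ?thesis using mult_slice[OF \<phi>(1) \<Delta> 1(3)] zero[OF \<phi>(2)] 1 by simp
      next
        case 2 then show ?thesis by (rule zero)
      qed
    next
      fix x assume x: "x \<in> carrier A" and vanish: "\<And>\<psi>. \<psi> \<in> ?\<Phi>' \<Longrightarrow> \<psi> x = \<zero>\<^bsub>K\<^esub>"
      have "x \<in> right_kernel \<phi>" if "\<phi> \<in> \<Phi>" for \<phi>
      proof -
        have "\<phi> (x \<otimes> a) = \<zero>\<^bsub>K\<^esub>" if "a \<in> carrier A" for a
          using vanish[of "\<lambda>x. \<phi> (x \<otimes> a)"] \<open>\<phi> \<in> \<Phi>\<close> that by blast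
        then show ?thesis using x unfolding right_kernel_def by auto
      qed
      from sub[OF x this] have "x \<in> W" .
      then show "x = \<zero>" using vanish by (intro S(4)) auto
    qed
  qed
  also have "\<dots> = card \<Psi> * dim" using R(2) by (simp add: card_cartesian_product)
  also have "\<dots> \<le> (card \<Phi> + vectorspace.dim K (vs W)) * dim" using card\<Psi> by simp
  finally show ?thesis unfolding Frobdim_def .
qed

text \<open>
  A line is an intersection of kernels of linear forms, so by assumption \<open>hyper\<close> every vector of \<open>W\<close> is
  an eigenvector of the right multiplication by \<open>a\<close>. The eigenvalues agree because the combination of
  two vectors of \<open>W\<close> that lies in the kernel of \<open>\<psi>\<close> is also mapped into that kernel.
\<close>

lemma right_mult_scalar_on_subspace:
  assumes fd: "fin_dim" and W: "VectorSpace.subspace K W A"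
    and hyper: "\<And>\<psi> x a. \<lbrakk>\<psi> \<in> linear_forms K A; x \<in> W; a \<in> carrier A; \<psi> x = \<zero>\<^bsub>K\<^esub>\<rbrakk>
      \<Longrightarrow> \<psi> (x \<otimes> a) = \<zero>\<^bsub>K\<^esub>"
    and w: "w \<in> W" "w \<noteq> \<zero>" and a: "a \<in> carrier A"
  shows "\<exists>c\<in>carrier K. \<forall>x\<in>W. x \<otimes> a = c \<odot> x"
proof -
  have WA: "x \<in> carrier A" if "x \<in> W" for x using that W unfolding subspace_alt by auto
  have scal: "\<exists>c\<in>carrier K. x \<otimes> a = c \<odot> x" if x: "x \<in> W" for x
  proof (rule ccontr)
    assume "\<not> ?thesis"
    then have nin: "x \<otimes> a \<notin> span {x}" using WA[OF x] by (auto simp: span_singleton)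
    have sp: "VectorSpace.subspace K (span {x}) A" using WA[OF x] by (intro span_is_subspace) auto
    obtain \<psi> where \<psi>: "\<psi> \<in> linear_forms K A" "\<And>y. y \<in> span {x} \<Longrightarrow> \<psi> y = \<zero>\<^bsub>K\<^esub>"
      "\<psi> (x \<otimes> a) \<noteq> \<zero>\<^bsub>K\<^esub>"
      using linear_form_avoiding_subspace[OF fd sp _ nin] WA[OF x] a by auto
    then show False using hyper[OF \<psi>(1) x a] span_self[OF WA[OF x]] by auto
  qed
  obtain \<psi> where \<psi>: "\<psi> \<in> linear_forms K A" "\<psi> w \<noteq> \<zero>\<^bsub>K\<^esub>"
    using linear_forms_separate_points[OF fd WA[OF w(1)], of "\<zero>"] w(2) linear_form_zero
    by (metis zero_closed)
  note cl = linear_form_closed[OF \<psi>(1)]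
  obtain c where c: "c \<in> carrier K" "w \<otimes> a = c \<odot> w" using scal[OF w(1)] by auto
  have generic: "x \<otimes> a = c \<odot> x" if x: "x \<in> W" "\<psi> x \<noteq> \<zero>\<^bsub>K\<^esub>" for x
  proof -
    obtain e where e: "e \<in> carrier K" "x \<otimes> a = e \<odot> x" using scal[OF x(1)] by auto
    let ?z = "\<psi> w \<odot> x \<ominus> \<psi> x \<odot> w"
    have car: "x \<in> carrier A" "w \<in> carrier A" "\<psi> x \<in> carrier K" "\<psi> w \<in> carrier K"
      using WA x w cl by auto
    have "?z \<in> W" using W x w car by (intro subspace_diff) (auto simp: subspace_alt)
    moreover have "\<psi> ?z = \<zero>\<^bsub>K\<^esub>"
      using car by (simp add: linear_form_diff[OF \<psi>(1)] linear_form_smult[OF \<psi>(1)] R.m_comm)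
    ultimately have "\<psi> (?z \<otimes> a) = \<zero>\<^bsub>K\<^esub>" using hyper[OF \<psi>(1) _ a] by simp
    moreover have "?z \<otimes> a = \<psi> w \<odot> (e \<odot> x) \<ominus> \<psi> x \<odot> (c \<odot> w)"
      using car a e(2) c(2) by (simp add: a_minus_def l_distr l_minus smult_mult_left)
    ultimately have "\<psi> w \<otimes>\<^bsub>K\<^esub> (e \<otimes>\<^bsub>K\<^esub> \<psi> x) \<ominus>\<^bsub>K\<^esub> \<psi> x \<otimes>\<^bsub>K\<^esub> (c \<otimes>\<^bsub>K\<^esub> \<psi> w) = \<zero>\<^bsub>K\<^esub>"
      using car e c by (simp add: linear_form_diff[OF \<psi>(1)] linear_form_smult[OF \<psi>(1)])
    then have "(\<psi> w \<otimes>\<^bsub>K\<^esub> \<psi> x) \<otimes>\<^bsub>K\<^esub> e = (\<psi> w \<otimes>\<^bsub>K\<^esub> \<psi> x) \<otimes>\<^bsub>K\<^esub> c"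
      using car e c by (simp add: R.m_ac)
    moreover have "\<psi> w \<otimes>\<^bsub>K\<^esub> \<psi> x \<noteq> \<zero>\<^bsub>K\<^esub>" using car x \<psi>(2) by (simp add: integral_iff)
    ultimately have "e = c" using m_lcancel car e c by auto
    then show ?thesis using e by simp
  qed
  have "x \<otimes> a = c \<odot> x" if x: "x \<in> W" for x
  proof (cases "\<psi> x = \<zero>\<^bsub>K\<^esub>")
    case True
    have car: "x \<in> carrier A" "w \<in> carrier A" using WA x w by auto
    have "x \<oplus> w \<in> W" using x w W unfolding subspace_alt by auto
    moreover have "\<psi> (x \<oplus> w) \<noteq> \<zero>\<^bsub>K\<^esub>"
      using True car \<psi>(2) cl by (simp add: linear_form_add[OF \<psi>(1)])
    ultimately have "(x \<oplus> w) \<otimes> a = c \<odot> (x \<oplus> w)" by (rule generic)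
    then have "x \<otimes> a \<oplus> c \<odot> w = c \<odot> x \<oplus> c \<odot> w"
      using car a c by (simp add: l_distr smult_r_distr)
    then show ?thesis using car a c by simp
  qed (use generic x in auto)
  then show ?thesis using c(1) by blast
qed

end

context assoc_algebra
begin

abbreviation "sdim W \<equiv> vectorspace.dim K (vs W)"

lemma subspace_carrier: "VectorSpace.subspace K (carrier A) A"
  unfolding subspace_alt by auto

lemma left_eigenspace_subspace:
  assumes "\<And>a. a \<in> carrier A \<Longrightarrow> \<chi> a \<in> carrier K"
  shows "VectorSpace.subspace K {z \<in> carrier A. \<forall>a\<in>carrier A. a \<otimes> z = \<chi> a \<odot> z} A"
  unfolding subspace_alt using assms
  by (auto simp: r_distr smult_r_distr smult_mult_right smult_assoc_simp R.m_comm)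

text \<open>
  The pairing \<open>(x, a) \<mapsto> \<phi> (x a)\<close> is degenerate in \<open>x\<close> by assumption. Hence it vanishes for all \<open>x\<close> once
  it vanishes for fewer than \<open>dim A\<close> of them, and fewer than \<open>dim A\<close> linear conditions on \<open>a\<close> have a
  nonzero solution.
\<close>

lemma left_annihilating_element:
  assumes fd: "fin_dim" and \<phi>: "\<phi> \<in> linear_forms K A"
    and nz: "0 < sdim (right_kernel \<phi>)"
  obtains a where "a \<in> carrier A" "a \<noteq> \<zero>" "\<And>x. x \<in> carrier A \<Longrightarrow> \<phi> (x \<otimes> a) = \<zero>\<^bsub>K\<^esub>"
proof (rule adapted_coordinates[OF fd right_kernel_subspace[OF \<phi>]])
  fix B C :: "'c set"
  assume C: "finite C" "basis C" "B \<subseteq> C" "span B = right_kernel \<phi>" "card B = sdim (right_kernel \<phi>)"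
  have CA: "C \<subseteq> carrier A" using C(2) unfolding basis_def by auto
  have card: "card (C - B) < dim"
    using C dim_basis[OF C(1,2)] nz card_Diff_subset[of B C] finite_subset[OF C(3,1)]
      card_mono[OF C(1,3)] by auto
  have form: "(\<lambda>a. \<phi> (c \<otimes> a)) \<in> linear_forms K A" if "c \<in> carrier A" for c
    using that linear_form_closed[OF \<phi>] linear_form_add[OF \<phi>] linear_form_smult[OF \<phi>]
    by (intro linear_formI) (simp_all add: r_distr smult_mult_right)
  have "\<exists>a\<in>carrier A. a \<noteq> \<zero> \<and> (\<forall>c\<in>C - B. \<phi> (c \<otimes> a) = \<zero>\<^bsub>K\<^esub>)"
  proof (rule ccontr)
    assume "\<not> ?thesis"
    then have "dim \<le> card (C - B)"
      using C(1) CA form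
      by (intro dim_le_card_separating(2)[where \<phi> = "\<lambda>c a. \<phi> (c \<otimes> a)"]) auto
    then show False using card by simp
  qed
  then obtain a where a: "a \<in> carrier A" "a \<noteq> \<zero>" "\<And>c. c \<in> C - B \<Longrightarrow> \<phi> (c \<otimes> a) = \<zero>\<^bsub>K\<^esub>"
    by blast
  note ker = linear_form_ker_subspace[OF linear_form_compose_right[OF \<phi> a(1)]]
  have "B \<subseteq> right_kernel \<phi>" using C(3,4) CA span_mem[of B] by blast
  then have "C \<subseteq> {x \<in> carrier A. \<phi> (x \<otimes> a) = \<zero>\<^bsub>K\<^esub>}"
    using CA a unfolding right_kernel_def by blast
  from span_subset_subspace[OF ker this] C(2)
  have "carrier A \<subseteq> {x \<in> carrier A. \<phi> (x \<otimes> a) = \<zero>\<^bsub>K\<^esub>}" unfolding basis_def by auto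
  then show thesis using that[OF a(1,2)] by blast
qed

text \<open>
  Let \<open>W\<close> be the right kernel of \<open>\<phi>\<close> and \<open>Z\<close> the left eigenspace of \<open>\<chi>\<close>. An element \<open>a\<^sub>0 \<noteq> 0\<close> with
  \<open>\<phi> (x a\<^sub>0) = 0\<close> for all \<open>x\<close> annihilates all contractions against \<open>\<phi>\<close>, while \<open>a\<^sub>0 1 \<noteq> 0\<close>; so these
  contractions lie in a proper subspace \<open>U\<close>, and \<open>dim A - 1\<close> coordinates are enough for them. If the
  contraction against \<open>\<phi>\<close> vanishes, then \<open>(\<xi> \<otimes> id) (\<Delta> 1)\<close> lies in \<open>W\<close> for every form \<open>\<xi>\<close>, and the
  right eigenvalue equation on \<open>W\<close> turns into the left one for every contraction. The remaining
  contractions, against \<open>dim W\<close> forms that separate the points of \<open>W\<close>, thus lie in \<open>Z\<close>.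
\<close>

lemma frobdim_bound_eigenspace:
  assumes fd: "fin_dim" and \<phi>: "\<phi> \<in> linear_forms K A"
    and nz: "0 < sdim (right_kernel \<phi>)"
    and \<chi>: "\<And>a. a \<in> carrier A \<Longrightarrow> \<chi> a \<in> carrier K"
    and eig: "\<And>x a. x \<in> right_kernel \<phi> \<Longrightarrow> a \<in> carrier A \<Longrightarrow> x \<otimes> a = \<chi> a \<odot> x"
  shows "Frobdim K A \<le> (dim - 1) + sdim (right_kernel \<phi>)
    * sdim {z \<in> carrier A. \<forall>a\<in>carrier A. a \<otimes> z = \<chi> a \<odot> z}"
    (is "_ \<le> _ + _ * sdim ?Z")
proof -
  interpret E: vectorspace K E by (rule vectorspace_E)
  let ?W = "right_kernel \<phi>"
  define Z where "Z = ?Z"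
  note subW = right_kernel_subspace[OF \<phi>]
  have subZ: "VectorSpace.subspace K Z A"
    unfolding Z_def by (rule left_eigenspace_subspace[OF \<chi>])
  obtain a0 where a0: "a0 \<in> carrier A" "a0 \<noteq> \<zero>"
    "\<And>x. x \<in> carrier A \<Longrightarrow> \<phi> (x \<otimes> a0) = \<zero>\<^bsub>K\<^esub>"
    using left_annihilating_element[OF fd \<phi> nz] by metis
  let ?U = "{y \<in> carrier A. a0 \<otimes> y = \<zero>}"
  have subU: "VectorSpace.subspace K ?U A"
    unfolding subspace_alt using a0(1) by (auto simp: r_distr smult_mult_right)
  have "\<one> \<notin> ?U" using a0 by simp
  then have "?U \<subset> carrier A" using one_closed by blast
  then have "sdim ?U < sdim (carrier A)" by (rule subspace_dim_less[OF fd subU subspace_carrier])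
  then have dimU: "sdim ?U \<le> dim - 1" by simp
  obtain S1 :: "'c set" and u where S1: "finite S1" "card S1 = sdim ?U"
    "\<And>s. s \<in> S1 \<Longrightarrow> u s \<in> linear_forms K A"
    "\<And>x. x \<in> ?U \<Longrightarrow> (\<And>s. s \<in> S1 \<Longrightarrow> u s x = \<zero>\<^bsub>K\<^esub>) \<Longrightarrow> x = \<zero>"
    by (rule subspace_separating_forms[OF fd subU]) blast
  obtain S2 :: "'c set" and \<sigma> where S2: "finite S2" "card S2 = sdim ?W"
    "\<And>s. s \<in> S2 \<Longrightarrow> \<sigma> s \<in> linear_forms K A"
    "\<And>x. x \<in> ?W \<Longrightarrow> (\<And>s. s \<in> S2 \<Longrightarrow> \<sigma> s x = \<zero>\<^bsub>K\<^esub>) \<Longrightarrow> x = \<zero>"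
    by (rule subspace_separating_forms[OF fd subW]) blast
  obtain S3 :: "'c set" and \<zeta> where S3: "finite S3" "card S3 = sdim Z"
    "\<And>s. s \<in> S3 \<Longrightarrow> \<zeta> s \<in> linear_forms K A"
    "\<And>x. x \<in> Z \<Longrightarrow> (\<And>s. s \<in> S3 \<Longrightarrow> \<zeta> s x = \<zero>\<^bsub>K\<^esub>) \<Longrightarrow> x = \<zero>"
    by (rule subspace_separating_forms[OF fd subZ]) blast
  define form where "form = case_sum (\<lambda>s \<Delta>. u s (slice \<phi> \<Delta>)) (\<lambda>(i, j) \<Delta>. \<zeta> j (slice (\<sigma> i) \<Delta>))"
  let ?S = "Sum_Type.Plus S1 (S2 \<times> S3)"
  have "E.dim \<le> card ?S"
  proof (rule E.dim_le_card_separating(2)[where \<phi> = form])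
    show "finite ?S" using S1(1) S2(1) S3(1) by simp
    show "form s \<in> linear_forms K E" if s: "s \<in> ?S" for s
    proof (cases s)
      case (Inl i)
      then have "i \<in> S1" using s by auto
      then show ?thesis using slice_linear_form[OF \<phi> S1(3)] Inl unfolding form_def by simp
    next
      case (Inr ij)
      then obtain i j where "ij = (i, j)" "i \<in> S2" "j \<in> S3" using s by auto
      then show ?thesis using slice_linear_form[OF S2(3) S3(3)] Inr unfolding form_def by simp
    qed
    fix \<Delta> assume \<Delta>: "\<Delta> \<in> carrier E" and zero: "\<And>s. s \<in> ?S \<Longrightarrow> form s \<Delta> = \<zero>\<^bsub>K\<^esub>"
    have t: "\<Delta> \<one> \<in> carrier T" by (rule coproductD(1)[OF \<Delta>]) simp
    have \<phi>0: "slice \<phi> \<Delta> = \<zero>"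
    proof (rule S1(4))
      have "a0 \<otimes> slice \<phi> \<Delta> = slice (\<lambda>x. \<phi> (x \<otimes> a0)) \<Delta>" by (rule mult_slice[OF \<phi> \<Delta> a0(1)])
      also have "\<dots> = \<zero>"
        by (rule slice_common_kernel[OF fd, of "{}"])
          (use linear_form_compose_right[OF \<phi> a0(1)] \<Delta> a0(3) in auto)
      finally show "slice \<phi> \<Delta> \<in> ?U" using \<phi> \<Delta> by simp
      show "u s (slice \<phi> \<Delta>) = \<zero>\<^bsub>K\<^esub>" if "s \<in> S1" for s
        using zero[of "Inl s"] that unfolding form_def by auto
    qed
    have in_W: "contract_left K A \<xi> (\<Delta> \<one>) \<in> ?W" if \<xi>: "\<xi> \<in> linear_forms K A" for \<xi>
    proof -
      have "\<phi> (contract_left K A \<xi> (\<Delta> \<one>) \<otimes> a) = \<zero>\<^bsub>K\<^esub>" if a: "a \<in> carrier A" for a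
      proof -
        have "\<phi> (contract_left K A \<xi> (\<Delta> \<one>) \<otimes> a) = \<xi> (slice (\<lambda>x. \<phi> (x \<otimes> a)) \<Delta>)"
          unfolding slice_def by (rule contract_swap[OF linear_form_compose_right[OF \<phi> a] \<xi> t])
        also have "\<dots> = \<xi> (a \<otimes> slice \<phi> \<Delta>)" using mult_slice[OF \<phi> \<Delta> a] by simp
        also have "\<dots> = \<zero>\<^bsub>K\<^esub>" using \<phi>0 a linear_form_zero[OF \<xi>] by simp
        finally show ?thesis .
      qed
      then show ?thesis using contract_left_closed[OF \<xi> t] unfolding right_kernel_def by simp
    qed
    have \<sigma>0: "slice (\<sigma> i) \<Delta> = \<zero>" if i: "i \<in> S2" for i
    proof (rule S3(4))
      note \<sigma> = S2(3)[OF i]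
      have y: "slice (\<sigma> i) \<Delta> \<in> carrier A" using \<sigma> \<Delta> by simp
      have "a \<otimes> slice (\<sigma> i) \<Delta> = \<chi> a \<odot> slice (\<sigma> i) \<Delta>" if a: "a \<in> carrier A" for a
      proof (rule linear_forms_separate_points[OF fd])
        fix \<xi> assume \<xi>: "\<xi> \<in> linear_forms K A"
        let ?w = "contract_left K A \<xi> (\<Delta> \<one>)"
        have w: "?w \<in> carrier A" by (rule contract_left_closed[OF \<xi> t])
        have "\<xi> (a \<otimes> slice (\<sigma> i) \<Delta>) = \<xi> (slice (\<lambda>x. \<sigma> i (x \<otimes> a)) \<Delta>)"
          using mult_slice[OF \<sigma> \<Delta> a] by simp
        also have "\<dots> = \<sigma> i (?w \<otimes> a)"
          unfolding slice_def by (rule contract_swap[OF linear_form_compose_right[OF \<sigma> a] \<xi> t, symmetric])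
        also have "\<dots> = \<chi> a \<otimes>\<^bsub>K\<^esub> \<sigma> i ?w"
          using eig[OF in_W[OF \<xi>] a] linear_form_smult[OF \<sigma> \<chi>[OF a] w] by simp
        also have "\<sigma> i ?w = \<xi> (slice (\<sigma> i) \<Delta>)"
          unfolding slice_def by (rule contract_swap[OF \<sigma> \<xi> t])
        also have "\<chi> a \<otimes>\<^bsub>K\<^esub> \<xi> (slice (\<sigma> i) \<Delta>) = \<xi> (\<chi> a \<odot> slice (\<sigma> i) \<Delta>)"
          using linear_form_smult[OF \<xi> \<chi>[OF a] y] by simp
        finally show "\<xi> (a \<otimes> slice (\<sigma> i) \<Delta>) = \<xi> (\<chi> a \<odot> slice (\<sigma> i) \<Delta>)" .
      qed (use a y \<chi> in auto)
      then show "slice (\<sigma> i) \<Delta> \<in> Z" using y unfolding Z_def by simp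
      show "\<zeta> j (slice (\<sigma> i) \<Delta>) = \<zero>\<^bsub>K\<^esub>" if "j \<in> S3" for j
        using zero[of "Inr (i, j)"] that i unfolding form_def by auto
    qed
    let ?\<Phi> = "{\<lambda>x. \<phi> (x \<otimes> a) | a. a \<in> carrier A} \<union> \<sigma> ` S2"
    show "\<Delta> = \<zero>\<^bsub>E\<^esub>"
    proof (rule coproduct_eq_zero_of_slice[OF fd \<Delta>, of ?\<Phi>])
      show "?\<Phi> \<subseteq> linear_forms K A" using S2(3) linear_form_compose_right[OF \<phi>] by blast
    next
      fix \<psi> assume "\<psi> \<in> ?\<Phi>"
      then consider a where "\<psi> = (\<lambda>x. \<phi> (x \<otimes> a))" "a \<in> carrier A" | i where "\<psi> = \<sigma> i" "i \<in> S2"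
        by blast
      then show "slice \<psi> \<Delta> = \<zero>"
      proof cases
        case 1 then show ?thesis using mult_slice[OF \<phi> \<Delta>] \<phi>0 by (metis r_null)
      next
        case 2 then show ?thesis using \<sigma>0 by simp
      qed
    next
      fix x assume x: "x \<in> carrier A" and vanish: "\<And>\<psi>. \<psi> \<in> ?\<Phi> \<Longrightarrow> \<psi> x = \<zero>\<^bsub>K\<^esub>"
      have "\<phi> (x \<otimes> a) = \<zero>\<^bsub>K\<^esub>" if "a \<in> carrier A" for a
        using vanish[of "\<lambda>x. \<phi> (x \<otimes> a)"] that by blast
      then have "x \<in> ?W" using x unfolding right_kernel_def by auto
      then show "x = \<zero>" using vanish by (intro S2(4)) auto
    qed
  qed
  also have "card ?S = sdim ?U + sdim ?W * sdim Z"
    using S1(1,2) S2(1,2) S3(1,2) by (simp add: card_Plus card_cartesian_product)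
  finally show ?thesis using dimU unfolding Frobdim_def Z_def by linarith
qed

text \<open>
  For \<open>z\<close> in \<open>Z\<close>, the product \<open>w z\<close> equals \<open>\<chi> z w\<close> as well as \<open>\<chi> w z\<close>. If \<open>\<chi> z \<noteq> 0\<close> for some \<open>z\<close>, then
  \<open>\<chi> w \<noteq> 0\<close> and all of \<open>Z\<close> lies on the line through \<open>w\<close>, against its dimension.
\<close>

lemma eigenspace_square_zero:
  assumes fd: "fin_dim" and \<chi>: "\<And>a. a \<in> carrier A \<Longrightarrow> \<chi> a \<in> carrier K"
    and w: "w \<in> carrier A" "w \<noteq> \<zero>" "\<And>a. a \<in> carrier A \<Longrightarrow> w \<otimes> a = \<chi> a \<odot> w"
    and Z: "Z = {z \<in> carrier A. \<forall>a\<in>carrier A. a \<otimes> z = \<chi> a \<odot> z}" and dimZ: "2 \<le> sdim Z"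
    and z: "z \<in> Z" and z': "z' \<in> Z"
  shows "z \<otimes> z' = \<zero>"
proof -
  have ZA: "x \<in> carrier A" if "x \<in> Z" for x using that Z by auto
  have subZ: "VectorSpace.subspace K Z A" unfolding Z by (rule left_eigenspace_subspace[OF \<chi>])
  interpret Z: vectorspace K "vs Z" by (rule subspace_is_vs[OF subZ])
  have swap: "\<chi> x \<odot> w = \<chi> w \<odot> x" if x: "x \<in> Z" for x
  proof -
    have "w \<otimes> x = \<chi> w \<odot> x" using x w(1) Z by auto
    then show ?thesis using w(3)[OF ZA[OF x]] by simp
  qed
  have "\<chi> z = \<zero>\<^bsub>K\<^esub>"
  proof (rule ccontr)
    assume nz: "\<chi> z \<noteq> \<zero>\<^bsub>K\<^esub>"
    have cz: "\<chi> z \<in> carrier K" "\<chi> w \<in> carrier K" using \<chi> ZA[OF z] w(1) by auto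
    have "\<chi> w \<noteq> \<zero>\<^bsub>K\<^esub>"
      using swap[OF z] smult_eq_zeroD[OF cz(1) w(1)] nz w(2) ZA[OF z] by auto
    obtain \<psi> where \<psi>: "\<psi> \<in> linear_forms K A" "\<psi> w \<noteq> \<zero>\<^bsub>K\<^esub>"
      using linear_forms_separate_points[OF fd w(1), of "\<zero>"] w(2) linear_form_zero
      by (metis zero_closed)
    have "Z.dim \<le> card {()}"
    proof (rule Z.dim_le_card_separating(2)[where \<phi> = "\<lambda>_. \<psi>"])
      show "\<psi> \<in> linear_forms K (vs Z)" by (rule linear_forms_subspace[OF subZ \<psi>(1)])
      fix x assume x: "x \<in> carrier (vs Z)" and "\<And>s. s \<in> {()} \<Longrightarrow> \<psi> x = \<zero>\<^bsub>K\<^esub>"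
      then have xZ: "x \<in> Z" and 0: "\<psi> x = \<zero>\<^bsub>K\<^esub>" by auto
      have "\<chi> x \<otimes>\<^bsub>K\<^esub> \<psi> w = \<chi> w \<otimes>\<^bsub>K\<^esub> \<psi> x"
        using swap[OF xZ] linear_form_smult[OF \<psi>(1)] \<chi> ZA[OF xZ] w(1) by metis
      then have "\<chi> x = \<zero>\<^bsub>K\<^esub>"
        using 0 \<psi>(2) \<chi>[OF ZA[OF xZ]] cz linear_form_closed[OF \<psi>(1) w(1)] by (simp add: integral_iff)
      then have "\<chi> w \<odot> x = \<zero>" using swap[OF xZ] w(1) by simp
      then have "x = \<zero>"
        using smult_eq_zeroD[OF cz(2) ZA[OF xZ]] \<open>\<chi> w \<noteq> \<zero>\<^bsub>K\<^esub>\<close> by blast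
      then show "x = \<zero>\<^bsub>vs Z\<^esub>" by simp
    qed auto
    then show False using dimZ by simp
  qed
  moreover have "z \<otimes> z' = \<chi> z \<odot> z'" using z' ZA[OF z] Z by auto
  ultimately show ?thesis using ZA[OF z'] by simp
qed

definition square_zero_basis :: "nat \<Rightarrow> (nat \<Rightarrow> 'c) \<Rightarrow> bool"
  where "square_zero_basis n v \<longleftrightarrow> basis (insert \<one> (v ` {2..n})) \<and>
    (\<forall>i\<in>{2..n}. \<forall>j\<in>{2..n}. v i \<otimes> v j = \<zero>)"

lemma square_zero_basis_of_subspace:
  assumes fd: "fin_dim" and n: "dim = n" "n \<ge> 1"
    and Z: "VectorSpace.subspace K Z A" "sdim Z = n - 1" "\<one> \<notin> Z"
    and sq: "\<And>z z'. z \<in> Z \<Longrightarrow> z' \<in> Z \<Longrightarrow> z \<otimes> z' = \<zero>"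
  shows "\<exists>v. square_zero_basis n v"
proof -
  have ZA: "Z \<subseteq> carrier A" using Z(1) unfolding subspace_alt by auto
  obtain B where B: "finite B" "B \<subseteq> Z" "lin_indpt B" "span B = Z" "sdim Z = card B"
    using subspace_basis[OF fd Z(1)] by metis
  have nin: "\<one> \<notin> B" using B(2) Z(3) by blast
  have "\<not> lin_dep (B \<union> {\<one>})"
    using lin_dep_iff_in_span[of B "\<one>"] B ZA nin Z(3) one_closed by blast
  moreover have "card (B \<union> {\<one>}) = n" using B(1,5) Z(2) nin n(2) by simp
  ultimately have basis: "basis (insert \<one> B)"
    using B ZA n one_closed by (intro dim_li_is_basis[OF fd]) auto
  have "card {2..n} = card B" using B(5) Z(2) by simp
  then obtain v where v: "bij_betw v {2..n} B"
    using B(1) finite_same_card_bij[of "{2..n}" B] by auto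
  then have "v ` {2..n} = B" unfolding bij_betw_def by simp
  then have "square_zero_basis n v"
    unfolding square_zero_basis_def using basis sq B(2) by blast
  then show ?thesis by blast
qed

theorem square_zero_of_Frobdim:
  assumes fd: "fin_dim" and n: "dim = n" "n \<ge> 3" and F: "Frobdim K A = (n - 1)\<^sup>2"
  shows "\<exists>v. square_zero_basis n v"
proof -
  \<comment> \<open>since \<open>(n - 2) n = (n - 1)\<^sup>2 - 1\<close>\<close>
  have small: False if "Frobdim K A \<le> (n - 2) * n"
  proof -
    obtain m where m: "n = 2 + m" using le_Suc_ex[of 2 n] n(2) by auto
    show False using that F unfolding m by (simp add: power2_eq_square)
  qed
  note dim_less = subspace_dim_less[OF fd]
  have one_span: "\<not> carrier A \<subseteq> span {\<one>}"
  proof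
    assume "carrier A \<subseteq> span {\<one>}"
    then have "span {\<one>} = carrier A" using span_closed[of "{\<one>}"] one_closed by blast
    then have "dim \<le> card {\<one>}" by (intro gen_ge_dim) auto
    then show False using n by simp
  qed
  then obtain y where y: "y \<in> carrier A" "y \<notin> span {\<one>}" by blast
  have "VectorSpace.subspace K (span {\<one>}) A" by (rule span_is_subspace) auto
  then obtain \<phi> where \<phi>: "\<phi> \<in> linear_forms K A" "\<phi> \<one> = \<zero>\<^bsub>K\<^esub>" "\<phi> y \<noteq> \<zero>\<^bsub>K\<^esub>"
    using linear_form_avoiding_subspace[OF fd _ y] span_self[OF one_closed] by metis
  define W where "W = right_kernel \<phi>"
  have subW: "VectorSpace.subspace K W A" unfolding W_def by (rule right_kernel_subspace[OF \<phi>(1)])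
  have WA: "x \<in> carrier A" if "x \<in> W" for x using that unfolding W_def right_kernel_def by auto
  let ?ker = "\<lambda>\<psi>. {x \<in> carrier A. \<psi> x = \<zero>\<^bsub>K\<^esub>}"
  have "?ker \<phi> \<subset> carrier A" using y(1) \<phi>(3) by blast
  then have l1: "sdim (?ker \<phi>) < sdim (carrier A)"
    by (rule dim_less[OF linear_form_ker_subspace[OF \<phi>(1)] subspace_carrier])
  have "\<one> \<notin> W" using y(1) \<phi>(3) unfolding W_def right_kernel_def by auto
  then have "W \<subset> ?ker \<phi>" using WA right_kernel_ker[of _ \<phi>] \<phi>(2) one_closed unfolding W_def by blast
  then have l2: "sdim W < sdim (?ker \<phi>)"
    by (rule dim_less[OF subW linear_form_ker_subspace[OF \<phi>(1)]])
  have W_le: "sdim W \<le> n - 2" using l1 l2 n(1) by simp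
  \<comment> \<open>the bound by one form\<close>
  have W_ge: "n - 2 \<le> sdim W"
  proof (rule ccontr)
    assume c: "\<not> n - 2 \<le> sdim W"
    have "Frobdim K A \<le> (card {\<phi>} + sdim W) * dim"
      by (rule frobdim_bound[OF fd _ _ subW]) (use \<phi> in \<open>auto simp: W_def\<close>)
    also have "\<dots> \<le> (n - 2) * n" unfolding n(1) by (rule mult_right_mono) (use c in auto)
    finally show False by (rule small)
  qed
  have W_eq: "sdim W = n - 2" using W_le W_ge by simp
  have ideal: "x \<otimes> a \<in> W" if "x \<in> W" "a \<in> carrier A" for x a
    using right_kernel_ideal that unfolding W_def by blast
  \<comment> \<open>otherwise the bound by the two forms \<open>\<phi>\<close> and \<open>\<psi>\<close> is too small\<close>
  have hyper: "\<psi> (x \<otimes> a) = \<zero>\<^bsub>K\<^esub>"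
    if \<psi>: "\<psi> \<in> linear_forms K A" and x: "x \<in> W" and a: "a \<in> carrier A" and 0: "\<psi> x = \<zero>\<^bsub>K\<^esub>" for \<psi> x a
  proof (rule ccontr)
    assume nz: "\<psi> (x \<otimes> a) \<noteq> \<zero>\<^bsub>K\<^esub>"
    let ?U = "W \<inter> ?ker \<psi>" and ?V = "W \<inter> right_kernel \<psi>"
    have subU: "VectorSpace.subspace K ?U A"
      by (rule subspace_inter[OF subW linear_form_ker_subspace[OF \<psi>]])
    have subV: "VectorSpace.subspace K ?V A"
      by (rule subspace_inter[OF subW right_kernel_subspace[OF \<psi>]])
    have "?U \<subset> W" using ideal[OF x a] nz by blast
    then have 1: "sdim ?U < sdim W" by (rule dim_less[OF subU subW])
    have "x \<in> ?U" "x \<notin> ?V" using x 0 WA a nz unfolding right_kernel_def by auto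
    moreover have "?V \<subseteq> ?U" using WA right_kernel_ker[of _ \<psi>] by blast
    ultimately have "?V \<subset> ?U" by blast
    then have 2: "sdim ?V < sdim ?U" by (rule dim_less[OF subV subU])
    have "card {\<phi>, \<psi>} \<le> 2" by (simp add: card_insert_if)
    have "Frobdim K A \<le> (card {\<phi>, \<psi>} + sdim ?V) * dim"
      by (rule frobdim_bound[OF fd _ _ subV]) (use \<phi> \<psi> in \<open>auto simp: W_def\<close>)
    also have "\<dots> \<le> (n - 2) * n"
      unfolding n(1) by (rule mult_right_mono) (use 1 2 W_eq \<open>card {\<phi>, \<psi>} \<le> 2\<close> in auto)
    finally show False by (rule small)
  qed
  obtain w where w: "w \<in> W" "w \<noteq> \<zero>"
  proof -
    obtain B where B: "finite B" "B \<subseteq> W" "lin_indpt B" "sdim W = card B"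
      using subspace_basis[OF fd subW] by metis
    then have "B \<noteq> {}" using W_eq n by auto
    then obtain b where "b \<in> B" by blast
    moreover have "\<zero> \<notin> B" using vs_zero_lin_dep[OF _ B(3)] B(2) WA by blast
    ultimately show ?thesis using that B(2) by blast
  qed
  have "\<exists>c\<in>carrier K. \<forall>x\<in>W. x \<otimes> a = c \<odot> x" if "a \<in> carrier A" for a
    by (rule right_mult_scalar_on_subspace[OF fd subW _ w that]) (rule hyper)
  then obtain \<chi> where \<chi>: "\<And>a. a \<in> carrier A \<Longrightarrow> \<chi> a \<in> carrier K"
    "\<And>x a. x \<in> W \<Longrightarrow> a \<in> carrier A \<Longrightarrow> x \<otimes> a = \<chi> a \<odot> x"
    by (metis (no_types, lifting))
  define Z where "Z = {z \<in> carrier A. \<forall>a\<in>carrier A. a \<otimes> z = \<chi> a \<odot> z}"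
  have subZ: "VectorSpace.subspace K Z A" unfolding Z_def by (rule left_eigenspace_subspace[OF \<chi>(1)])
  have oneZ: "\<one> \<notin> Z"
  proof
    assume "\<one> \<in> Z"
    then have "a = \<chi> a \<odot> \<one>" if "a \<in> carrier A" for a using that unfolding Z_def by force
    then have "carrier A \<subseteq> span {\<one>}" using \<chi>(1) by (auto simp: span_singleton)
    with one_span show False by blast
  qed
  have "Z \<subset> carrier A" using oneZ one_closed unfolding Z_def by blast
  then have Z_lt: "sdim Z < sdim (carrier A)" by (rule dim_less[OF subZ subspace_carrier])
  have "sdim Z \<ge> n - 1"
  proof (rule ccontr)
    assume c: "\<not> sdim Z \<ge> n - 1"
    have "Frobdim K A \<le> (dim - 1) + sdim W * sdim Z"
      unfolding W_def Z_def
      by (rule frobdim_bound_eigenspace[OF fd \<phi>(1) _ \<chi>(1)])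
        (use W_eq n \<chi>(2) in \<open>auto simp: W_def\<close>)
    also have "\<dots> \<le> (n - 1) + (n - 2) * (n - 2)"
      unfolding n(1) W_eq using c by (intro add_left_mono mult_left_mono) auto
    finally have le: "(n - 1)\<^sup>2 \<le> (n - 1) + (n - 2) * (n - 2)" unfolding F .
    obtain m where m: "n = m + 3" using n(2) by (metis add.commute le_Suc_ex)
    show False using le unfolding m by (simp add: power2_eq_square algebra_simps)
  qed
  then have Z_eq: "sdim Z = n - 1" using Z_lt n by simp
  show ?thesis
  proof (rule square_zero_basis_of_subspace[OF fd n(1) _ subZ Z_eq oneZ])
    show "z \<otimes> z' = \<zero>" if "z \<in> Z" "z' \<in> Z" for z z'
      by (rule eigenspace_square_zero[OF fd \<chi>(1) WA[OF w(1)] w(2) \<chi>(2)[OF w(1)] Z_def _ that])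
        (use Z_eq n in auto)
  qed (use n in simp)
qed

end

section \<open>Algebras with a square zero basis\<close>

text \<open>
  An algebra with basis \<open>1, v\<^sub>2, \<dots>, v\<^sub>n\<close> and all products \<open>v\<^sub>i v\<^sub>j\<close> zero, together with the dual basis
  \<open>\<epsilon>, \<kappa>\<^sub>2, \<dots>, \<kappa>\<^sub>n\<close>.
\<close>

locale square_zero_coordinates = assoc_algebra K A
  for K :: "('k, 'm) ring_scheme" and A :: "('k, 'a, 'l) module_scheme" (structure) +
  fixes n :: nat and v :: "nat \<Rightarrow> 'a" and \<epsilon> :: "'a \<Rightarrow> 'k" and \<kappa> :: "nat \<Rightarrow> 'a \<Rightarrow> 'k"
  assumes v_closed [simp]: "i \<in> {2..n} \<Longrightarrow> v i \<in> carrier A"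
    and v_mult: "\<lbrakk>i \<in> {2..n}; j \<in> {2..n}\<rbrakk> \<Longrightarrow> v i \<otimes>\<^bsub>A\<^esub> v j = \<zero>\<^bsub>A\<^esub>"
    and \<epsilon>_form: "\<epsilon> \<in> linear_forms K A"
    and \<kappa>_form: "i \<in> {2..n} \<Longrightarrow> \<kappa> i \<in> linear_forms K A"
    and \<epsilon>_one: "\<epsilon> \<one>\<^bsub>A\<^esub> = \<one>\<^bsub>K\<^esub>" and \<epsilon>_v: "i \<in> {2..n} \<Longrightarrow> \<epsilon> (v i) = \<zero>\<^bsub>K\<^esub>"
    and \<kappa>_one: "i \<in> {2..n} \<Longrightarrow> \<kappa> i \<one>\<^bsub>A\<^esub> = \<zero>\<^bsub>K\<^esub>"
    and \<kappa>_v: "\<lbrakk>i \<in> {2..n}; j \<in> {2..n}\<rbrakk> \<Longrightarrow> \<kappa> i (v j) = (if i = j then \<one>\<^bsub>K\<^esub> else \<zero>\<^bsub>K\<^esub>)"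
    and spanning: "\<lbrakk>VectorSpace.subspace K U A; \<one>\<^bsub>A\<^esub> \<in> U; v ` {2..n} \<subseteq> U\<rbrakk> \<Longrightarrow> carrier A \<subseteq> U"
    and separating: "\<lbrakk>x \<in> carrier A; \<epsilon> x = \<zero>\<^bsub>K\<^esub>; \<And>i. i \<in> {2..n} \<Longrightarrow> \<kappa> i x = \<zero>\<^bsub>K\<^esub>\<rbrakk> \<Longrightarrow> x = \<zero>\<^bsub>A\<^esub>"

text \<open>
  A basis is given as a set; as it has \<open>n\<close> elements, the vectors \<open>1, v\<^sub>2, \<dots>, v\<^sub>n\<close> listed in it are
  distinct.
\<close>

lemma (in assoc_algebra) square_zero_basis_coordinates:
  assumes dim: "dim = n" and n: "n \<ge> 1" and v: "square_zero_basis n v"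
  obtains \<epsilon> \<kappa> where "square_zero_coordinates K A n v \<epsilon> \<kappa>"
proof -
  let ?I = "{2..n}" let ?C = "insert \<one>\<^bsub>A\<^esub> (v ` ?I)"
  have C: "finite ?C" "basis ?C" using v unfolding square_zero_basis_def by auto
  then have CA: "?C \<subseteq> carrier A" and span: "span ?C = carrier A" unfolding basis_def by auto
  have card: "card ?C = n" using dim_basis[OF C] dim by simp
  have le: "card (v ` ?I) \<le> n - 1" using card_image_le[of ?I v] by simp
  have one: "\<one>\<^bsub>A\<^esub> \<notin> v ` ?I"
  proof
    assume "\<one>\<^bsub>A\<^esub> \<in> v ` ?I"
    then have "card ?C = card (v ` ?I)" by (simp add: insert_absorb)
    then show False using card le n by simp
  qed
  then have "card (v ` ?I) = card ?I" using card by simp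
  then have inj: "inj_on v ?I" by (intro eq_card_imp_inj_on) auto
  have v_one: "v i \<noteq> \<one>\<^bsub>A\<^esub>" if "i \<in> ?I" for i using one imageI[OF that, of v] by metis
  obtain \<kappa> where \<kappa>: "\<And>b. b \<in> ?C \<Longrightarrow> \<kappa> b \<in> linear_forms K A"
    "\<And>b b'. b \<in> ?C \<Longrightarrow> b' \<in> ?C \<Longrightarrow> \<kappa> b b' = (if b = b' then \<one>\<^bsub>K\<^esub> else \<zero>\<^bsub>K\<^esub>)"
    "\<And>x. x \<in> carrier A \<Longrightarrow> lincomb (\<lambda>b. \<kappa> b x) ?C = x"
    using basis_coordinates[OF C] by blast
  show ?thesis
  proof (rule that[of "\<kappa> \<one>\<^bsub>A\<^esub>" "\<lambda>i. \<kappa> (v i)"], unfold_locales)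
    show "v i \<in> carrier A" if "i \<in> ?I" for i using CA that by auto
    show "v i \<otimes>\<^bsub>A\<^esub> v j = \<zero>\<^bsub>A\<^esub>" if "i \<in> ?I" "j \<in> ?I" for i j
      using v that unfolding square_zero_basis_def by blast
    show "\<kappa> \<one>\<^bsub>A\<^esub> \<in> linear_forms K A" by (rule \<kappa>(1)) simp
    show "\<kappa> (v i) \<in> linear_forms K A" if "i \<in> ?I" for i by (rule \<kappa>(1)) (use that in simp)
    show "\<kappa> \<one>\<^bsub>A\<^esub> \<one>\<^bsub>A\<^esub> = \<one>\<^bsub>K\<^esub>" by (subst \<kappa>(2)) simp_all
    show "\<kappa> \<one>\<^bsub>A\<^esub> (v i) = \<zero>\<^bsub>K\<^esub>" if "i \<in> ?I" for i using that v_one[OF that] by (subst \<kappa>(2)) auto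
    show "\<kappa> (v i) \<one>\<^bsub>A\<^esub> = \<zero>\<^bsub>K\<^esub>" if "i \<in> ?I" for i using that v_one[OF that] by (subst \<kappa>(2)) auto
    show "\<kappa> (v i) (v j) = (if i = j then \<one>\<^bsub>K\<^esub> else \<zero>\<^bsub>K\<^esub>)" if "i \<in> ?I" "j \<in> ?I" for i j
      using that inj by (subst \<kappa>(2)) (auto dest: inj_onD)
    show "carrier A \<subseteq> U" if "VectorSpace.subspace K U A" "\<one>\<^bsub>A\<^esub> \<in> U" "v ` ?I \<subseteq> U" for U
      using span_subset_subspace[OF that(1), of ?C] that(2,3) span by auto
    show "x = \<zero>\<^bsub>A\<^esub>" if x: "x \<in> carrier A" "\<kappa> \<one>\<^bsub>A\<^esub> x = \<zero>\<^bsub>K\<^esub>"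
      "\<And>i. i \<in> ?I \<Longrightarrow> \<kappa> (v i) x = \<zero>\<^bsub>K\<^esub>" for x
    proof -
      have "lincomb (\<lambda>b. \<kappa> b x) ?C = \<zero>\<^bsub>A\<^esub>" using CA x by (intro lincomb_zero) auto
      then show ?thesis using \<kappa>(3)[OF x(1)] by simp
    qed
  qed
qed

context square_zero_coordinates
begin

lemmas form_closed [simp] = linear_form_closed[OF \<epsilon>_form] linear_form_closed[OF \<kappa>_form]
lemmas form_add [simp] = linear_form_add[OF \<epsilon>_form] linear_form_add[OF \<kappa>_form]
lemmas form_smult [simp] = linear_form_smult[OF \<epsilon>_form] linear_form_smult[OF \<kappa>_form]
lemmas form_zero [simp] = linear_form_zero[OF \<epsilon>_form] linear_form_zero[OF \<kappa>_form]
lemmas coordinates_simps [simp] = \<epsilon>_one \<epsilon>_v \<kappa>_one \<kappa>_v v_mult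

text \<open>
  So \<open>\<epsilon>\<close> is the character by which \<open>A\<close> acts on the span of the \<open>v\<^sub>i\<close> from either side.
\<close>

lemma mult_v: 
  assumes x: "x \<in> carrier A" and i: "i \<in> {2..n}"
  shows "x \<otimes> v i = \<epsilon> x \<odot> v i" "v i \<otimes> x = \<epsilon> x \<odot> v i"
proof -
  let ?U = "{x \<in> carrier A. x \<otimes> v i = \<epsilon> x \<odot> v i \<and> v i \<otimes> x = \<epsilon> x \<odot> v i}"
  have "VectorSpace.subspace K ?U A"
    unfolding subspace_alt using i
    by (auto simp: l_distr r_distr smult_l_distr smult_mult_left smult_mult_right smult_assoc_simp)
  then have "carrier A \<subseteq> ?U" using i by (intro spanning) auto
  then show "x \<otimes> v i = \<epsilon> x \<odot> v i" "v i \<otimes> x = \<epsilon> x \<odot> v i" using x by auto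
qed

lemma coordinates_mult:
  assumes x: "x \<in> carrier A" and y: "y \<in> carrier A"
  shows "\<epsilon> (x \<otimes> y) = \<epsilon> x \<otimes>\<^bsub>K\<^esub> \<epsilon> y"
    and "i \<in> {2..n} \<Longrightarrow> \<kappa> i (x \<otimes> y) = \<epsilon> x \<otimes>\<^bsub>K\<^esub> \<kappa> i y \<oplus>\<^bsub>K\<^esub> \<kappa> i x \<otimes>\<^bsub>K\<^esub> \<epsilon> y"
proof -
  let ?U = "{y \<in> carrier A. \<epsilon> (x \<otimes> y) = \<epsilon> x \<otimes>\<^bsub>K\<^esub> \<epsilon> y \<and>
    (\<forall>i\<in>{2..n}. \<kappa> i (x \<otimes> y) = \<epsilon> x \<otimes>\<^bsub>K\<^esub> \<kappa> i y \<oplus>\<^bsub>K\<^esub> \<kappa> i x \<otimes>\<^bsub>K\<^esub> \<epsilon> y)}"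
  have "VectorSpace.subspace K ?U A"
    unfolding subspace_alt using x
    by (auto simp: r_distr R.r_distr smult_mult_right R.a_ac R.m_ac)
  then have "carrier A \<subseteq> ?U" using x by (intro spanning) (auto simp: mult_v)
  then show "\<epsilon> (x \<otimes> y) = \<epsilon> x \<otimes>\<^bsub>K\<^esub> \<epsilon> y"
    "i \<in> {2..n} \<Longrightarrow> \<kappa> i (x \<otimes> y) = \<epsilon> x \<otimes>\<^bsub>K\<^esub> \<kappa> i y \<oplus>\<^bsub>K\<^esub> \<kappa> i x \<otimes>\<^bsub>K\<^esub> \<epsilon> y" using y by auto
qed

lemma coordinates_surj:
  assumes "c \<in> carrier K" "\<And>i. i \<in> {2..n} \<Longrightarrow> b i \<in> carrier K"
  shows "\<exists>x\<in>carrier A. \<epsilon> x = c \<and> (\<forall>i\<in>{2..n}. \<kappa> i x = b i)"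
proof -
  have "\<exists>x\<in>carrier A. \<epsilon> x = c \<and> (\<forall>i\<in>{2..n}. \<kappa> i x = (if i \<in> J then b i else \<zero>\<^bsub>K\<^esub>))"
    if "finite J" "J \<subseteq> {2..n}" for J
    using that
  proof (induction J)
    case empty
    show ?case using assms by (intro bexI[of _ "c \<odot> \<one>"]) auto
  next
    case (insert j J)
    then obtain x where x: "x \<in> carrier A" "\<epsilon> x = c"
      "\<And>i. i \<in> {2..n} \<Longrightarrow> \<kappa> i x = (if i \<in> J then b i else \<zero>\<^bsub>K\<^esub>)" by auto
    have j: "j \<in> {2..n}" "j \<notin> J" using insert by auto
    show ?case
      by (rule bexI[of _ "x \<oplus> b j \<odot> v j"]) (use x j assms in auto)
  qed
  from this[of "{2..n}"] show ?thesis by auto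
qed

text \<open>
  Let \<open>y\<^sub>j\<close> be the contraction of \<open>\<Delta> 1\<close> against \<open>\<kappa>\<^sub>j\<close>. The form \<open>\<kappa>\<^sub>j(\<cdot> v\<^sub>i)\<close> is \<open>\<epsilon>\<close> for \<open>i = j\<close> and \<open>0\<close>
  otherwise, so \<open>v\<^sub>i y\<^sub>j = 0\<close> for \<open>i \<noteq> j\<close>, and \<open>v\<^sub>j y\<^sub>j\<close> is the contraction against \<open>\<epsilon>\<close>. As \<open>n \<ge> 3\<close>, every
  \<open>j\<close> has an \<open>i \<noteq> j\<close>, and \<open>\<epsilon> y\<^sub>j = 0\<close> follows. Thus the \<open>(n - 1)\<^sup>2\<close> numbers \<open>\<kappa>\<^sub>i y\<^sub>j\<close> determine \<open>\<Delta>\<close>. They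
  are independent because each \<open>v\<^sub>i \<otimes> v\<^sub>j\<close> is a central tensor.
\<close>

lemma Frobdim_square_zero:
  assumes fd: "fin_dim" and n: "n \<ge> 3"
  shows "Frobdim K A = (n - 1)\<^sup>2"
proof -
  interpret E: vectorspace K E by (rule vectorspace_E)
  let ?I = "{2..n}"
  let ?f = "\<lambda>(i, j) \<Delta>. \<kappa> i (slice (\<kappa> j) \<Delta>)"
  have form: "?f p \<in> linear_forms K E" if "p \<in> ?I \<times> ?I" for p
    using that slice_linear_form \<kappa>_form by auto
  have v_nz: "v i \<noteq> \<zero>" if "i \<in> ?I" for i
    using \<kappa>_v[OF that that] form_zero(2)[OF that] by auto
  have sep: "\<Delta> = \<zero>\<^bsub>E\<^esub>"
    if \<Delta>: "\<Delta> \<in> carrier E" and zero: "\<And>i j. i \<in> ?I \<Longrightarrow> j \<in> ?I \<Longrightarrow> \<kappa> i (slice (\<kappa> j) \<Delta>) = \<zero>\<^bsub>K\<^esub>" for \<Delta>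
  proof -
    have y: "slice (\<kappa> j) \<Delta> \<in> carrier A" if "j \<in> ?I" for j using \<kappa>_form[OF that] \<Delta> by simp
    have \<kappa>0: "slice (\<kappa> j) \<Delta> = \<zero>" if j: "j \<in> ?I" for j
    proof (rule separating[OF y[OF j]])
      show "\<kappa> i (slice (\<kappa> j) \<Delta>) = \<zero>\<^bsub>K\<^esub>" if "i \<in> ?I" for i by (rule zero[OF that j])
      define i :: nat where "i = (if j = 2 then 3 else 2)"
      have i: "i \<in> ?I" "i \<noteq> j" using n j unfolding i_def by auto
      have "v i \<otimes> slice (\<kappa> j) \<Delta> = slice (\<lambda>x. \<kappa> j (x \<otimes> v i)) \<Delta>"
        using mult_slice[OF \<kappa>_form[OF j] \<Delta>] i by simp
      also have "\<dots> = \<zero>"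
        by (rule slice_common_kernel[OF fd, of "{}"])
          (use linear_form_compose_right[OF \<kappa>_form[OF j]] i j \<Delta> in \<open>auto simp: mult_v\<close>)
      finally have "\<epsilon> (slice (\<kappa> j) \<Delta>) \<odot> v i = \<zero>" using mult_v(2)[OF y[OF j] i(1)] by simp
      then show "\<epsilon> (slice (\<kappa> j) \<Delta>) = \<zero>\<^bsub>K\<^esub>"
        using smult_eq_zeroD[OF _ _ _ v_nz[OF i(1)]] y[OF j] i(1) by simp
    qed
    have two: "2 \<in> ?I" using n by simp
    have "v 2 \<otimes> slice (\<kappa> 2) \<Delta> = slice (\<lambda>x. \<kappa> 2 (x \<otimes> v 2)) \<Delta>"
      using mult_slice[OF \<kappa>_form[OF two] \<Delta>] two by simp
    then have "slice (\<lambda>x. \<kappa> 2 (x \<otimes> v 2)) \<Delta> = \<zero>" using \<kappa>0[OF two] two by simp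
    then have \<epsilon>0: "slice \<epsilon> \<Delta> = \<zero>"
      by (intro slice_common_kernel[OF fd _ \<epsilon>_form \<Delta>, of "{\<lambda>x. \<kappa> 2 (x \<otimes> v 2)}"])
        (use linear_form_compose_right[OF \<kappa>_form[OF two]] two in \<open>auto simp: mult_v\<close>)
    show ?thesis
      by (rule coproduct_eq_zero_of_slice[OF fd \<Delta>, of "insert \<epsilon> (\<kappa> ` ?I)"])
        (use \<epsilon>_form \<kappa>_form \<epsilon>0 \<kappa>0 in \<open>auto intro: separating\<close>)
  qed
  have ub: "E.fin_dim" "E.dim \<le> card (?I \<times> ?I)"
    using E.dim_le_card_separating[of "?I \<times> ?I" ?f] form sep by auto
  define \<Delta> where "\<Delta> = (\<lambda>(i, j). \<lambda>x\<in>carrier A. act x (v i \<box> v j) \<one>)"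
  have \<Delta>_closed: "\<Delta> p \<in> carrier E" if "p \<in> ?I \<times> ?I" for p
  proof -
    obtain i j where p: "p = (i, j)" "i \<in> ?I" "j \<in> ?I" using \<open>p \<in> ?I \<times> ?I\<close> by auto
    have "act a (v i \<box> v j) \<one> = act \<one> (v i \<box> v j) a" if "a \<in> carrier A" for a
      using that p by (simp add: mult_v tns_simps)
    then show ?thesis unfolding \<Delta>_def p(1) using p by (simp add: coproduct_of_central)
  qed
  have "slice (\<kappa> l) (\<Delta> (i, j)) = \<kappa> l (v j) \<odot> v i" if "i \<in> ?I" "j \<in> ?I" "l \<in> ?I" for i j l
    unfolding slice_def \<Delta>_def using that \<kappa>_form by simp
  then have dual: "?f p (\<Delta> q) = (if p = q then \<one>\<^bsub>K\<^esub> else \<zero>\<^bsub>K\<^esub>)" if "p \<in> ?I \<times> ?I" "q \<in> ?I \<times> ?I" for p q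
    using that by (auto split: if_splits)
  have "card (?I \<times> ?I) \<le> E.dim"
    by (rule E.card_dual_family_le_dim[OF ub(1) _ form \<Delta>_closed dual]) auto
  with ub(2) show ?thesis
    unfolding Frobdim_def by (simp add: card_cartesian_product power2_eq_square)
qed

end

section \<open>The path algebra of a quiver with one vertex\<close>

text \<open>
  The product of the path algebra when there is only one vertex: the coefficient at \<open>r\<close> is the sum of
  \<open>f p g q\<close> over all ways to split the word \<open>r\<close> as \<open>p @ q\<close>. The recursion peels off the split with
  empty \<open>p\<close> and reads the others as splits of the tail; it turns the ring laws into inductions on \<open>r\<close>.
\<close>

fun conv :: "('k, 'm) ring_scheme \<Rightarrow> ('e list \<Rightarrow> 'k) \<Rightarrow> ('e list \<Rightarrow> 'k) \<Rightarrow> 'e list \<Rightarrow> 'k" where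
  "conv K f g [] = f [] \<otimes>\<^bsub>K\<^esub> g []"
| "conv K f g (x # r) = f [] \<otimes>\<^bsub>K\<^esub> g (x # r) \<oplus>\<^bsub>K\<^esub> conv K (\<lambda>p. f (x # p)) g r"

context cring
begin

lemma conv_closed:
  assumes "\<And>p. f p \<in> carrier R" "\<And>p. g p \<in> carrier R"
  shows "conv R f g r \<in> carrier R"
  using assms by (induction r arbitrary: f) auto

lemma conv_add_left:
  assumes "\<And>p. f p \<in> carrier R" "\<And>p. f' p \<in> carrier R" "\<And>p. g p \<in> carrier R"
  shows "conv R (\<lambda>p. f p \<oplus> f' p) g r = conv R f g r \<oplus> conv R f' g r"
  using assms by (induction r arbitrary: f f') (auto simp: l_distr a_ac conv_closed)

lemma conv_add_right:
  assumes "\<And>p. f p \<in> carrier R" "\<And>p. g p \<in> carrier R" "\<And>p. g' p \<in> carrier R"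
  shows "conv R f (\<lambda>p. g p \<oplus> g' p) r = conv R f g r \<oplus> conv R f g' r"
  using assms by (induction r arbitrary: f) (auto simp: r_distr a_ac conv_closed)

lemma conv_smult_left:
  assumes "c \<in> carrier R" "\<And>p. f p \<in> carrier R" "\<And>p. g p \<in> carrier R"
  shows "conv R (\<lambda>p. c \<otimes> f p) g r = c \<otimes> conv R f g r"
  using assms by (induction r arbitrary: f) (auto simp: r_distr m_assoc conv_closed)

lemma conv_assoc:
  assumes "\<And>p. f p \<in> carrier R" "\<And>p. g p \<in> carrier R" "\<And>p. h p \<in> carrier R"
  shows "conv R (conv R f g) h r = conv R f (conv R g h) r"
  using assms
proof (induction r arbitrary: f g)
  case (Cons x r)
  let ?fx = "\<lambda>p. f (x # p)" and ?gx = "\<lambda>p. g (x # p)"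
  have "conv R (\<lambda>p. conv R f g (x # p)) h r
      = conv R (\<lambda>p. f [] \<otimes> g (x # p) \<oplus> conv R ?fx g p) h r" by simp
  also have "\<dots> = conv R (\<lambda>p. f [] \<otimes> g (x # p)) h r \<oplus> conv R (conv R ?fx g) h r"
    using Cons.prems by (intro conv_add_left) (auto simp: conv_closed)
  also have "conv R (\<lambda>p. f [] \<otimes> g (x # p)) h r = f [] \<otimes> conv R ?gx h r"
    using Cons.prems by (intro conv_smult_left) auto
  also have "conv R (conv R ?fx g) h r = conv R ?fx (conv R g h) r"
    using Cons.prems by (intro Cons.IH) auto
  finally have "conv R (conv R f g) h (x # r)
      = (f [] \<otimes> g []) \<otimes> h (x # r) \<oplus> (f [] \<otimes> conv R ?gx h r \<oplus> conv R ?fx (conv R g h) r)"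
    by simp
  then show ?case
    using Cons.prems by (simp add: conv_closed r_distr m_assoc a_assoc)
qed (simp add: m_assoc)

definition word_gen :: "'e list \<Rightarrow> 'e list \<Rightarrow> 'a"
  where "word_gen p = (\<lambda>r. if r = p then \<one> else \<zero>)"

lemma conv_zero_left:
  assumes "\<And>p. g p \<in> carrier R"
  shows "conv R (\<lambda>p. \<zero>) g r = \<zero>"
  using assms by (induction r) auto

lemma conv_word_gen_left:
  assumes "\<And>p. g p \<in> carrier R"
  shows "conv R (word_gen p) g r = (if \<exists>q. r = p @ q then g (drop (length p) r) else \<zero>)"
proof (induction p arbitrary: r)
  case Nil
  have "(\<lambda>q. word_gen [] (x # q)) = (\<lambda>q. \<zero>)" for x :: 'b by (auto simp: word_gen_def)
  then show ?case
    using assms by (cases r) (auto simp: conv_zero_left word_gen_def)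
next
  case (Cons y p)
  show ?case
  proof (cases r)
    case Nil then show ?thesis using assms by (simp add: word_gen_def)
  next
    case r: (Cons x r')
    have "(\<lambda>q. word_gen (y # p) (x # q)) = (if x = y then word_gen p else (\<lambda>q. \<zero>))"
      by (auto simp: word_gen_def)
    then show ?thesis
      using assms r Cons.IH[of r'] by (auto simp: conv_zero_left conv_closed word_gen_def)
  qed
qed

lemma conv_one_right:
  assumes "\<And>p. f p \<in> carrier R"
  shows "conv R f (word_gen []) r = f r"
  using assms by (induction r arbitrary: f) (auto simp: word_gen_def)

lemma conv_word_gen:
  "conv R (word_gen p) (word_gen q) = word_gen (p @ q)"
proof
  fix r
  have "conv R (word_gen p) (word_gen q) r
      = (if \<exists>s. r = p @ s then word_gen q (drop (length p) r) else \<zero>)"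
    by (rule conv_word_gen_left) (simp add: word_gen_def)
  then show "conv R (word_gen p) (word_gen q) r = word_gen (p @ q) r"
    by (auto simp: word_gen_def)
qed

lemma conv_nonzero:
  assumes "\<And>p. f p \<in> carrier R" "\<And>p. g p \<in> carrier R" "conv R f g r \<noteq> \<zero>"
  shows "\<exists>p q. r = p @ q \<and> f p \<noteq> \<zero> \<and> g q \<noteq> \<zero>"
  using assms
proof (induction r arbitrary: f)
  case Nil
  then have "f [] \<noteq> \<zero>" "g [] \<noteq> \<zero>" by auto
  then show ?case by auto
next
  case (Cons x r)
  show ?case
  proof (cases "f [] \<otimes> g (x # r) = \<zero>")
    case True
    then have "conv R (\<lambda>p. f (x # p)) g r \<noteq> \<zero>" using Cons.prems by auto
    from Cons.IH[OF _ _ this] Cons.prems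
    obtain p q where "r = p @ q" "f (x # p) \<noteq> \<zero>" "g q \<noteq> \<zero>" by auto
    then show ?thesis by (intro exI[of _ "x # p"] exI[of _ q]) auto
  next
    case False
    then have "f [] \<noteq> \<zero>" "g (x # r) \<noteq> \<zero>" using Cons.prems by auto
    then show ?thesis by auto
  qed
qed

lemma finite_splits: "finite {(p, q). p @ q = r}"
proof (rule finite_subset)
  show "{(p, q). p @ q = r} \<subseteq> (\<lambda>k. (take k r, drop k r)) ` {..length r}"
  proof
    fix z assume "z \<in> {(p, q). p @ q = r}"
    then obtain p q where "z = (p, q)" "p @ q = r" by auto
    then have "z = (take (length p) r, drop (length p) r)" "length p \<le> length r" by auto
    then show "z \<in> (\<lambda>k. (take k r, drop k r)) ` {..length r}" by blast
  qed
qed simp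

lemma finsum_splits_conv:
  assumes "\<And>p. f p \<in> carrier R" "\<And>p. g p \<in> carrier R"
  shows "finsum R (\<lambda>(p, q). f p \<otimes> g q) {(p, q). p @ q = r} = conv R f g r"
  using assms
proof (induction r arbitrary: f)
  case Nil
  have "{(p, q). p @ q = ([] :: 'b list)} = {([], [])}" by auto
  then show ?case using Nil by simp
next
  case (Cons x r)
  let ?S = "{(p, q). p @ q = r}" and ?h = "\<lambda>(p, q). (x # p, q)"
  have fin: "finite ?S"
    by (rule finite_splits)
  have eq: "{(p, q). p @ q = x # r} = insert ([], x # r) (?h ` ?S)"
    by (auto simp: Cons_eq_append_conv append_eq_Cons_conv)
  have inj: "inj_on ?h ?S" by (auto simp: inj_on_def)
  have nin: "([], x # r) \<notin> ?h ` ?S" by auto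
  have "finsum R (\<lambda>(p, q). f p \<otimes> g q) {(p, q). p @ q = x # r}
      = f [] \<otimes> g (x # r) \<oplus> (finsum R (\<lambda>(p, q). f p \<otimes> g q) (?h ` ?S))"
    unfolding eq using fin nin Cons.prems by (subst finsum_insert) auto
  also have "(finsum R (\<lambda>(p, q). f p \<otimes> g q) (?h ` ?S)) = (\<Oplus>y\<in>?S. (\<lambda>(p, q). f p \<otimes> g q) (?h y))"
    using inj Cons.prems by (intro finsum_reindex) auto
  also have "\<dots> = finsum R (\<lambda>(p, q). f (x # p) \<otimes> g q) ?S"
    using Cons.prems by (intro finsum_cong') auto
  also have "\<dots> = conv R (\<lambda>p. f (x # p)) g r" using Cons.prems by (intro Cons.IH) auto
  finally show ?case by simp
qed

end

lemma quiver_paths_loop_quiver: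
  "(u, p, w) \<in> quiver_paths (loop_quiver n) \<longleftrightarrow> set p \<subseteq> {2..n}"
proof -
  have "pre_digraph.cas (loop_quiver n) u p w"
    by (induction p arbitrary: u) (simp_all add: pre_digraph.cas.simps)
  then show ?thesis
    unfolding quiver_paths_def by (simp add: pre_digraph.awalk_def) (simp add: loop_quiver_def)
qed

locale loop_path_algebra = cring K for K :: "('k, 'm) ring_scheme" (structure) +
  fixes n :: nat
begin

abbreviation "P \<equiv> path_algebra K (loop_quiver n)"
abbreviation "F \<equiv> free_module K (quiver_paths (loop_quiver n))"

definition coeff :: "(unit \<times> nat list \<times> unit \<Rightarrow> 'k) \<Rightarrow> nat list \<Rightarrow> 'k"
  where "coeff f p = f ((), p, ())"

lemma coeff_eqI: "(\<And>p. coeff f p = coeff g p) \<Longrightarrow> f = g"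
  unfolding coeff_def by (auto simp: fun_eq_iff)

lemma path_algebra_simps:
  "carrier P = carrier F" "\<zero>\<^bsub>P\<^esub> = \<zero>\<^bsub>F\<^esub>" "f \<oplus>\<^bsub>P\<^esub> g = f \<oplus>\<^bsub>F\<^esub> g" "c \<odot>\<^bsub>P\<^esub> f = c \<odot>\<^bsub>F\<^esub> f"
  by (simp_all add: path_algebra_def)

lemma P_carrier:
  "f \<in> carrier P \<longleftrightarrow> (\<forall>p. coeff f p \<in> carrier K) \<and> (\<forall>p. \<not> set p \<subseteq> {2..n} \<longrightarrow> coeff f p = \<zero>)
    \<and> finite {p. coeff f p \<noteq> \<zero>}"
proof -
  have "{p. coeff f p \<noteq> \<zero>} = (\<lambda>(u, p, w). p) ` {x. f x \<noteq> \<zero>}"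
    by (force simp: coeff_def)
  moreover have "{x. f x \<noteq> \<zero>} = (\<lambda>p. ((), p, ())) ` {p. coeff f p \<noteq> \<zero>}"
    by (auto simp: coeff_def)
  ultimately have fin: "finite {x. f x \<noteq> \<zero>} \<longleftrightarrow> finite {p. coeff f p \<noteq> \<zero>}"
    by (metis finite_imageI)
  show ?thesis
    unfolding path_algebra_simps free_module_carrier mem_Collect_eq fin
    by (auto simp: quiver_paths_loop_quiver coeff_def)
qed

lemma coeff_closed [simp]: "f \<in> carrier P \<Longrightarrow> coeff f p \<in> carrier K"
  by (simp add: P_carrier)

lemma coeff_add [simp]: "coeff (f \<oplus>\<^bsub>P\<^esub> g) p = coeff f p \<oplus> coeff g p"
  and coeff_zero [simp]: "coeff \<zero>\<^bsub>P\<^esub> p = \<zero>"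
  and coeff_smult [simp]: "coeff (c \<odot>\<^bsub>P\<^esub> f) p = c \<otimes> coeff f p"
  by (simp_all add: path_algebra_simps coeff_def)

lemma coeff_one: "coeff \<one>\<^bsub>P\<^esub> = word_gen []"
  by (auto simp: path_algebra_def coeff_def word_gen_def loop_quiver_def)

lemma coeff_free_gen: "coeff (free_gen K ((), p, ())) = word_gen p"
  by (auto simp: coeff_def free_gen_def word_gen_def)

lemma coeff_mult:
  assumes f: "f \<in> carrier P" and g: "g \<in> carrier P"
  shows "coeff (f \<otimes>\<^bsub>P\<^esub> g) = conv K (coeff f) (coeff g)"
proof
  fix r
  let ?S = "{(p, v, q). p @ q = r \<and> ((), p, v) \<in> quiver_paths (loop_quiver n)
      \<and> (v, q, ()) \<in> quiver_paths (loop_quiver n)}"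
  let ?S' = "{(p, q). p @ q = r}" and ?h = "\<lambda>(p, q). (p, (), q)"
  have "coeff (f \<otimes>\<^bsub>P\<^esub> g) r = finsum K (\<lambda>(p, v, q). f ((), p, v) \<otimes> g (v, q, ())) ?S"
    by (simp add: coeff_def path_algebra_def)
  also have "\<dots> = finsum K (\<lambda>(p, v, q). f ((), p, v) \<otimes> g (v, q, ())) (?h ` ?S')"
  proof (rule add.finprod_mono_neutral_cong_left)
    show "finite (?h ` ?S')" using finite_splits by (rule finite_imageI)
    show "?S \<subseteq> ?h ` ?S'" by force
    show "\<And>i. i \<in> ?h ` ?S' - ?S \<Longrightarrow> (case i of (p, v, q) \<Rightarrow> f ((), p, v) \<otimes> g (v, q, ())) = \<zero>"
    proof -
      fix i assume "i \<in> ?h ` ?S' - ?S"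
      then obtain p q where i: "i = (p, (), q)" "\<not> (set p \<subseteq> {2..n} \<and> set q \<subseteq> {2..n})"
        by (auto simp: quiver_paths_loop_quiver)
      then have "coeff f p = \<zero> \<or> coeff g q = \<zero>" using f g unfolding P_carrier by blast
      then show "(case i of (p, v, q) \<Rightarrow> f ((), p, v) \<otimes> g (v, q, ())) = \<zero>"
        using i coeff_closed[OF f, of p] coeff_closed[OF g, of q] by (auto simp: coeff_def)
    qed
  qed (use coeff_closed[OF f] coeff_closed[OF g] in \<open>auto simp: coeff_def\<close>)
  also have "\<dots> = (\<Oplus>y\<in>?S'. (\<lambda>(p, v, q). f ((), p, v) \<otimes> g (v, q, ())) (?h y))"
    using coeff_closed[OF f] coeff_closed[OF g]
    by (intro finsum_reindex) (auto simp: inj_on_def coeff_def)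
  also have "\<dots> = finsum K (\<lambda>(p, q). coeff f p \<otimes> coeff g q) ?S'"
    using coeff_closed[OF f] coeff_closed[OF g] by (intro finsum_cong') (auto simp: coeff_def)
  also have "\<dots> = conv K (coeff f) (coeff g) r"
    using f g by (intro finsum_splits_conv) auto
  finally show "coeff (f \<otimes>\<^bsub>P\<^esub> g) r = conv K (coeff f) (coeff g) r" .
qed

lemma module_P: "Module.module K P"
proof -
  interpret F: Module.module K F by (rule module_free_module)
  show ?thesis
  proof (rule module_criteria)
    show "\<forall>v\<in>carrier P. \<exists>w\<in>carrier P. v \<oplus>\<^bsub>P\<^esub> w = \<zero>\<^bsub>P\<^esub>"
      unfolding path_algebra_simps using F.M.r_neg F.M.a_inv_closed by blast
  qed (auto simp: path_algebra_simps F.M.a_ac F.smult_l_distr F.smult_r_distr F.smult_assoc1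
      cring_axioms simp del: free_module_simps)
qed

sublocale PM: Module.module K P by (rule module_P)

lemma P_mult_closed:
  assumes f: "f \<in> carrier P" and g: "g \<in> carrier P"
  shows "f \<otimes>\<^bsub>P\<^esub> g \<in> carrier P"
  unfolding P_carrier coeff_mult[OF f g]
proof (intro conjI allI impI)
  note ff = f[unfolded P_carrier] and gg = g[unfolded P_carrier]
  have nz: "\<exists>p q. r = p @ q \<and> coeff f p \<noteq> \<zero> \<and> coeff g q \<noteq> \<zero>"
    if "conv K (coeff f) (coeff g) r \<noteq> \<zero>" for r
    using conv_nonzero[OF _ _ that] f g by auto
  show "conv K (coeff f) (coeff g) p \<in> carrier K" for p using f g by (intro conv_closed) auto
  show "conv K (coeff f) (coeff g) r = \<zero>" if "\<not> set r \<subseteq> {2..n}" for r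
  proof (rule ccontr)
    assume "conv K (coeff f) (coeff g) r \<noteq> \<zero>"
    then obtain p q where r: "r = p @ q" and "coeff f p \<noteq> \<zero>" "coeff g q \<noteq> \<zero>" using nz by blast
    then have "set p \<subseteq> {2..n}" "set q \<subseteq> {2..n}" using ff gg by blast+
    then show False using that r by auto
  qed
  have "{r. conv K (coeff f) (coeff g) r \<noteq> \<zero>}
      \<subseteq> (\<lambda>(p, q). p @ q) ` ({p. coeff f p \<noteq> \<zero>} \<times> {q. coeff g q \<noteq> \<zero>})"
    using nz by force
  then show "finite {r. conv K (coeff f) (coeff g) r \<noteq> \<zero>}"
    using ff gg by (meson finite_SigmaI finite_imageI finite_subset)
qed

lemma gen_closed: "set p \<subseteq> {2..n} \<Longrightarrow> free_gen K ((), p, ()) \<in> carrier P"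
  unfolding path_algebra_simps by (rule free_gen_closed) (simp add: quiver_paths_loop_quiver)

lemma one_closed_P: "\<one>\<^bsub>P\<^esub> \<in> carrier P"
  unfolding P_carrier coeff_one by (auto simp: word_gen_def)

lemma ring_P: "ring P"
proof (rule ringI)
  show "abelian_group P" ..
  have one_left: "\<one>\<^bsub>P\<^esub> \<otimes>\<^bsub>P\<^esub> f = f" if "f \<in> carrier P" for f
    by (rule coeff_eqI) (simp add: that coeff_mult one_closed_P coeff_one conv_word_gen_left)
  have one_right: "f \<otimes>\<^bsub>P\<^esub> \<one>\<^bsub>P\<^esub> = f" if "f \<in> carrier P" for f
    by (rule coeff_eqI) (simp add: that coeff_mult one_closed_P coeff_one conv_one_right)
  have assoc: "f \<otimes>\<^bsub>P\<^esub> g \<otimes>\<^bsub>P\<^esub> h = f \<otimes>\<^bsub>P\<^esub> (g \<otimes>\<^bsub>P\<^esub> h)"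
    if "f \<in> carrier P" "g \<in> carrier P" "h \<in> carrier P" for f g h
    by (rule coeff_eqI) (simp add: that coeff_mult P_mult_closed conv_assoc)
  show "Group.monoid P"
    by (rule monoidI) (simp_all add: P_mult_closed one_closed_P one_left one_right assoc)
  fix f g h assume fgh: "f \<in> carrier P" "g \<in> carrier P" "h \<in> carrier P"
  have fun_add: "coeff (f \<oplus>\<^bsub>P\<^esub> g) = (\<lambda>p. coeff f p \<oplus> coeff g p)" for f g by auto
  show "(f \<oplus>\<^bsub>P\<^esub> g) \<otimes>\<^bsub>P\<^esub> h = f \<otimes>\<^bsub>P\<^esub> h \<oplus>\<^bsub>P\<^esub> g \<otimes>\<^bsub>P\<^esub> h"
    by (rule coeff_eqI) (simp add: fgh coeff_mult fun_add[of f g] conv_add_left)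
  show "h \<otimes>\<^bsub>P\<^esub> (f \<oplus>\<^bsub>P\<^esub> g) = h \<otimes>\<^bsub>P\<^esub> f \<oplus>\<^bsub>P\<^esub> h \<otimes>\<^bsub>P\<^esub> g"
    by (rule coeff_eqI) (simp add: fgh coeff_mult fun_add[of f g] conv_add_right)
qed

definition "J = Idl\<^bsub>P\<^esub> {free_gen K (u, p, w) | u p w.
    (u, p, w) \<in> quiver_paths (loop_quiver n) \<and> length p = 2}"

lemma J_gens: "{free_gen K (u, p, w) | u p w.
    (u, p, w) \<in> quiver_paths (loop_quiver n) \<and> length p = 2} \<subseteq> carrier P"
  using gen_closed by (auto simp: quiver_paths_loop_quiver)

lemma ideal_J: "ideal J P"
  unfolding J_def by (rule ring.genideal_ideal[OF ring_P J_gens])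

text \<open>
  Such a path is a path of length two followed by another path.
\<close>

lemma gen_in_J:
  assumes c: "c \<in> carrier K" and p: "set p \<subseteq> {2..n}" "length p \<ge> 2"
  shows "c \<odot>\<^bsub>P\<^esub> free_gen K ((), p, ()) \<in> J"
proof -
  interpret J: ideal J P by (rule ideal_J)
  let ?a = "take 2 p" and ?b = "drop 2 p"
  have ab: "set ?a \<subseteq> {2..n}" "set ?b \<subseteq> {2..n}" "length ?a = 2"
    using p set_take_subset[of 2 p] set_drop_subset[of 2 p] by auto
  have "free_gen K ((), ?a, ()) \<in> J"
    unfolding J_def by (rule subsetD[OF ring.genideal_self[OF ring_P J_gens]])
      (use ab in \<open>auto simp: quiver_paths_loop_quiver\<close>)
  then have "free_gen K ((), ?a, ()) \<otimes>\<^bsub>P\<^esub> free_gen K ((), ?b, ()) \<in> J"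
    using ab gen_closed by (intro J.I_r_closed) auto
  also have "free_gen K ((), ?a, ()) \<otimes>\<^bsub>P\<^esub> free_gen K ((), ?b, ()) = free_gen K ((), p, ())"
    by (rule coeff_eqI) (use ab in \<open>simp add: coeff_mult gen_closed coeff_free_gen conv_word_gen\<close>)
  finally have "(c \<odot>\<^bsub>P\<^esub> \<one>\<^bsub>P\<^esub>) \<otimes>\<^bsub>P\<^esub> free_gen K ((), p, ()) \<in> J"
    using c one_closed_P by (intro J.I_l_closed) auto
  also have "(c \<odot>\<^bsub>P\<^esub> \<one>\<^bsub>P\<^esub>) \<otimes>\<^bsub>P\<^esub> free_gen K ((), p, ()) = c \<odot>\<^bsub>P\<^esub> free_gen K ((), p, ())"
  proof (rule coeff_eqI)
    fix r
    have sm: "coeff (c \<odot>\<^bsub>P\<^esub> \<one>\<^bsub>P\<^esub>) = (\<lambda>q. c \<otimes> word_gen [] q)" by (auto simp: coeff_one)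
    have "conv K (\<lambda>q. c \<otimes> word_gen [] q) (word_gen p) r = c \<otimes> conv K (word_gen []) (word_gen p) r"
      using c by (intro conv_smult_left) (auto simp: word_gen_def)
    then show "coeff ((c \<odot>\<^bsub>P\<^esub> \<one>\<^bsub>P\<^esub>) \<otimes>\<^bsub>P\<^esub> free_gen K ((), p, ())) r
        = coeff (c \<odot>\<^bsub>P\<^esub> free_gen K ((), p, ())) r"
      using c p one_closed_P by (simp add: coeff_mult gen_closed coeff_free_gen sm conv_word_gen)
  qed
  finally show ?thesis .
qed

text \<open>
  A coefficient of a product at a word of length at most one is a sum of products of a coefficient of
  the left and one of the right factor at such words.
\<close>

lemma low_coeff_ideal:
  "ideal {f \<in> carrier P. \<forall>p. length p < 2 \<longrightarrow> coeff f p = \<zero>} P" (is "ideal ?I P")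
proof (rule idealI)
  show "ring P" by (rule ring_P)
  have short: "length p < 2 \<Longrightarrow> p = [] \<or> (\<exists>i. p = [i])" for p :: "nat list"
    by (cases p; cases "tl p") auto
  have inv: "\<ominus>\<^bsub>P\<^esub> f \<in> ?I" if "f \<in> ?I" for f
  proof -
    have "\<ominus>\<^bsub>P\<^esub> f = (\<ominus> \<one>) \<odot>\<^bsub>P\<^esub> f" using that PM.smult_minus_1[of f] by simp
    then show ?thesis using that by (simp del: coeff_smult add: coeff_smult[of "\<ominus> \<one>" f])
  qed
  show "subgroup ?I (add_monoid P)"
    by (rule PM.M.add.subgroupI) (use inv in \<open>auto simp flip: a_inv_def\<close>)
  fix f g assume f: "f \<in> ?I" and g: "g \<in> carrier P"
  show "g \<otimes>\<^bsub>P\<^esub> f \<in> ?I"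
    using f g short by (fastforce simp: P_mult_closed coeff_mult)
  show "f \<otimes>\<^bsub>P\<^esub> g \<in> ?I"
    using f g short by (fastforce simp: P_mult_closed coeff_mult)
qed

text \<open>
  Truncating away the words of length at most one sends every element into \<open>J\<close>, since it is a sum
  of multiples of paths, and it fixes the elements without coefficients at these words.
\<close>

lemma J_eq: "J = {f \<in> carrier P. \<forall>p. length p < 2 \<longrightarrow> coeff f p = \<zero>}"
proof
  show "J \<subseteq> {f \<in> carrier P. \<forall>p. length p < 2 \<longrightarrow> coeff f p = \<zero>}"
    unfolding J_def by (rule ring.genideal_minimal[OF ring_P low_coeff_ideal])
      (use J_gens in \<open>auto simp: coeff_free_gen word_gen_def\<close>)
  interpret J: ideal J P by (rule ideal_J)
  define trunc :: "(unit \<times> nat list \<times> unit \<Rightarrow> 'k) \<Rightarrow> unit \<times> nat list \<times> unit \<Rightarrow> 'k"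
    where "trunc f = (\<lambda>(u, p, w). if length p < 2 then \<zero> else f (u, p, w))" for f
  have coeff_trunc: "coeff (trunc f) p = (if length p < 2 then \<zero> else coeff f p)" for f p
    by (simp add: trunc_def coeff_def)
  have "trunc f \<in> J" if "f \<in> carrier F" for f
    using that
  proof (rule free_module_induct)
    have "trunc \<zero>\<^bsub>F\<^esub> = \<zero>\<^bsub>P\<^esub>"
      by (rule coeff_eqI) (simp add: coeff_trunc, simp add: coeff_def)
    then show "trunc \<zero>\<^bsub>F\<^esub> \<in> J" by (simp only: J.zero_closed)
  next
    fix c x assume c: "c \<in> carrier K" and x: "x \<in> quiver_paths (loop_quiver n)"
    obtain p where p: "x = ((), p, ())" by (metis old.unit.exhaust prod.collapse)
    then have pn: "set p \<subseteq> {2..n}" using x by (simp add: quiver_paths_loop_quiver)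
    show "trunc (c \<odot>\<^bsub>F\<^esub> free_gen K x) \<in> J"
    proof (cases "length p < 2")
      case True
      have "trunc (c \<odot>\<^bsub>P\<^esub> free_gen K x) = \<zero>\<^bsub>P\<^esub>"
        by (rule coeff_eqI) (use True c p in \<open>auto simp: coeff_trunc coeff_free_gen word_gen_def\<close>)
      then show ?thesis by (simp only: path_algebra_simps(4)[symmetric] J.zero_closed)
    next
      case False
      have "trunc (c \<odot>\<^bsub>P\<^esub> free_gen K x) = c \<odot>\<^bsub>P\<^esub> free_gen K x"
        by (rule coeff_eqI) (use False c p in \<open>auto simp: coeff_trunc coeff_free_gen word_gen_def\<close>)
      moreover have "c \<odot>\<^bsub>P\<^esub> free_gen K x \<in> J"
        unfolding p by (rule gen_in_J[OF c pn]) (use False in simp)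
      ultimately show ?thesis by (simp only: path_algebra_simps(4)[symmetric])
    qed
  next
    fix f g assume "trunc f \<in> J" "trunc g \<in> J"
    then have "trunc f \<oplus>\<^bsub>P\<^esub> trunc g \<in> J" by (rule J.a_closed)
    moreover have "trunc (f \<oplus>\<^bsub>P\<^esub> g) = trunc f \<oplus>\<^bsub>P\<^esub> trunc g"
      by (rule coeff_eqI) (simp add: coeff_trunc)
    ultimately show "trunc (f \<oplus>\<^bsub>F\<^esub> g) \<in> J" by (simp only: path_algebra_simps(3)[symmetric])
  qed
  moreover have "trunc f = f" if "\<forall>p. length p < 2 \<longrightarrow> coeff f p = \<zero>" for f
    by (rule coeff_eqI) (use that in \<open>simp add: coeff_trunc\<close>)
  ultimately show "{f \<in> carrier P. \<forall>p. length p < 2 \<longrightarrow> coeff f p = \<zero>} \<subseteq> J"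
    unfolding path_algebra_simps by fastforce
qed

lemma J_submodule: "LinearCombinations.submodule K J P"
  unfolding PM.submodule_alt J_eq by auto

end

subsection \<open>Comparison with the path algebra\<close>

context loop_path_algebra
begin

lemma J_coset_eq:
  assumes "f \<in> carrier P" "g \<in> carrier P"
  shows "J +>\<^bsub>P\<^esub> f = J +>\<^bsub>P\<^esub> g \<longleftrightarrow> (\<forall>p. length p < 2 \<longrightarrow> coeff f p = coeff g p)"
proof -
  have "coeff (f \<ominus>\<^bsub>P\<^esub> g) p = coeff f p \<ominus> coeff g p" for p
  proof -
    have "f \<ominus>\<^bsub>P\<^esub> g = f \<oplus>\<^bsub>P\<^esub> (\<ominus> \<one>) \<odot>\<^bsub>P\<^esub> g"
      using PM.smult_minus_1[OF assms(2)] by (simp add: a_minus_def)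
    then show ?thesis using assms by (simp add: a_minus_def l_minus)
  qed
  then show ?thesis
    using PM.coset_eq_iff[OF J_submodule assms] assms PM.M.minus_closed[OF assms]
    unfolding J_eq by auto
qed

abbreviation "B \<equiv> radical_square_zero_algebra K (loop_quiver n)"

lemma B_simps:
  "carrier B = (\<lambda>f. J +>\<^bsub>P\<^esub> f) ` carrier P"
  "\<lbrakk>f \<in> carrier P; g \<in> carrier P\<rbrakk> \<Longrightarrow> (J +>\<^bsub>P\<^esub> f) \<oplus>\<^bsub>B\<^esub> (J +>\<^bsub>P\<^esub> g) = J +>\<^bsub>P\<^esub> (f \<oplus>\<^bsub>P\<^esub> g)"
  "\<lbrakk>f \<in> carrier P; g \<in> carrier P\<rbrakk> \<Longrightarrow> (J +>\<^bsub>P\<^esub> f) \<otimes>\<^bsub>B\<^esub> (J +>\<^bsub>P\<^esub> g) = J +>\<^bsub>P\<^esub> (f \<otimes>\<^bsub>P\<^esub> g)"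
  "\<lbrakk>c \<in> carrier K; f \<in> carrier P\<rbrakk> \<Longrightarrow> c \<odot>\<^bsub>B\<^esub> (J +>\<^bsub>P\<^esub> f) = J +>\<^bsub>P\<^esub> (c \<odot>\<^bsub>P\<^esub> f)"
  "\<one>\<^bsub>B\<^esub> = J +>\<^bsub>P\<^esub> \<one>\<^bsub>P\<^esub>"
  unfolding radical_square_zero_algebra_def J_def[symmetric]
  by (simp_all only: PM.quotient_carrier[OF J_submodule] PM.quotient_add[OF J_submodule]
      PM.quotient_smult[OF J_submodule] quotient_module_simps(3,5) ideal.rcoset_mult_add[OF ideal_J])

text \<open>
  Send \<open>x\<close> to the class of \<open>\<epsilon> x + \<Sum>\<^sub>i \<kappa>\<^sub>i x \<alpha>\<^sub>i\<close>. Classes modulo \<open>J\<close> are determined by their coefficients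
  at words of length at most one, and on these both products are given by the same formulas.
\<close>

lemma iso_of_square_zero_coordinates:
  fixes A :: "('k, 'a, 'l) module_scheme"
  assumes "square_zero_coordinates K A n v \<epsilon> \<kappa>"
  shows "algebra_isomorphic K A B"
proof -
  interpret A: square_zero_coordinates K A n v \<epsilon> \<kappa> by fact
  let ?I = "{2..n}"
  define s :: "'a \<Rightarrow> unit \<times> nat list \<times> unit \<Rightarrow> 'k"
    where "s x = (\<lambda>(u, p, w). if p = [] then \<epsilon> x
      else if length p = 1 \<and> hd p \<in> ?I then \<kappa> (hd p) x else \<zero>)" for x
  have coeff_s: "coeff (s x) p = (if p = [] then \<epsilon> x
      else if length p = 1 \<and> hd p \<in> ?I then \<kappa> (hd p) x else \<zero>)" for x p
    by (simp add: coeff_def s_def)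
  have short: "length p < 2 \<longleftrightarrow> p = [] \<or> (\<exists>i. p = [i])" for p :: "nat list"
    by (cases p; cases "tl p") auto
  have s_closed: "s x \<in> carrier P" if x: "x \<in> carrier A" for x
    unfolding P_carrier
  proof (intro conjI allI impI)
    show "coeff (s x) p \<in> carrier K" for p using x by (simp add: coeff_s)
    show "coeff (s x) p = \<zero>" if "\<not> set p \<subseteq> ?I" for p
      using that by (cases p) (auto simp: coeff_s)
    have "{p. coeff (s x) p \<noteq> \<zero>} \<subseteq> insert [] ((\<lambda>i. [i]) ` ?I)"
      by (auto simp: coeff_s length_Suc_conv split: if_splits)
    then show "finite {p. coeff (s x) p \<noteq> \<zero>}" by (rule finite_subset) simp
  qed
  have coset_eq: "J +>\<^bsub>P\<^esub> f = J +>\<^bsub>P\<^esub> g"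
    if "f \<in> carrier P" "g \<in> carrier P" "coeff f [] = coeff g []" "\<And>i. coeff f [i] = coeff g [i]" for f g
    using that J_coset_eq short by auto
  define h where "h x = J +>\<^bsub>P\<^esub> s x" for x
  have h_closed: "h x \<in> carrier B" if "x \<in> carrier A" for x
    using s_closed[OF that] unfolding h_def B_simps(1) by blast
  have h_add: "h (x \<oplus>\<^bsub>A\<^esub> y) = h x \<oplus>\<^bsub>B\<^esub> h y" if "x \<in> carrier A" "y \<in> carrier A" for x y
  proof -
    have "h (x \<oplus>\<^bsub>A\<^esub> y) = J +>\<^bsub>P\<^esub> (s x \<oplus>\<^bsub>P\<^esub> s y)"
      unfolding h_def by (rule coset_eq) (use that s_closed in \<open>auto simp: coeff_s\<close>)
    then show ?thesis unfolding h_def using that s_closed by (simp add: B_simps(2))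
  qed
  have h_smult: "h (c \<odot>\<^bsub>A\<^esub> x) = c \<odot>\<^bsub>B\<^esub> h x" if "c \<in> carrier K" "x \<in> carrier A" for c x
  proof -
    have "h (c \<odot>\<^bsub>A\<^esub> x) = J +>\<^bsub>P\<^esub> (c \<odot>\<^bsub>P\<^esub> s x)"
      unfolding h_def by (rule coset_eq) (use that s_closed in \<open>auto simp: coeff_s\<close>)
    then show ?thesis unfolding h_def using that s_closed by (simp add: B_simps(4))
  qed
  have h_mult: "h (x \<otimes>\<^bsub>A\<^esub> y) = h x \<otimes>\<^bsub>B\<^esub> h y" if "x \<in> carrier A" "y \<in> carrier A" for x y
  proof -
    have "h (x \<otimes>\<^bsub>A\<^esub> y) = J +>\<^bsub>P\<^esub> (s x \<otimes>\<^bsub>P\<^esub> s y)"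
      unfolding h_def
      by (rule coset_eq)
        (use that s_closed in \<open>auto simp: P_mult_closed coeff_s coeff_mult A.coordinates_mult\<close>)
    then show ?thesis unfolding h_def using that s_closed by (simp add: B_simps(3))
  qed
  have h_one: "h \<one>\<^bsub>A\<^esub> = \<one>\<^bsub>B\<^esub>"
    unfolding h_def B_simps(5)
    by (intro coset_eq s_closed one_closed_P) (auto simp: coeff_s coeff_one word_gen_def)
  have inj: "inj_on h (carrier A)"
  proof (rule inj_onI)
    fix x y assume xy: "x \<in> carrier A" "y \<in> carrier A" "h x = h y"
    then have low: "coeff (s x) p = coeff (s y) p" if "length p < 2" for p
      using J_coset_eq[OF s_closed[OF xy(1)] s_closed[OF xy(2)]] that unfolding h_def by blast
    have 1: "\<epsilon> x = \<epsilon> y" using low[of "[]"] by (simp add: coeff_s)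
    have 2: "\<kappa> i x = \<kappa> i y" if "i \<in> ?I" for i using low[of "[i]"] that by (simp add: coeff_s)
    have "x \<ominus>\<^bsub>A\<^esub> y = \<zero>\<^bsub>A\<^esub>"
      by (rule A.separating)
        (use xy 1 2 in \<open>simp_all add: A.linear_form_diff[OF A.\<epsilon>_form] A.linear_form_diff[OF A.\<kappa>_form]\<close>)
    then show "x = y" using xy by simp
  qed
  have surj: "h ` carrier A = carrier B"
  proof
    show "h ` carrier A \<subseteq> carrier B" using h_closed by blast
    show "carrier B \<subseteq> h ` carrier A"
    proof
      fix X assume "X \<in> carrier B"
      then obtain f where f: "f \<in> carrier P" "X = J +>\<^bsub>P\<^esub> f" unfolding B_simps(1) by blast
      then obtain x where x: "x \<in> carrier A" "\<epsilon> x = coeff f []" "\<forall>i\<in>?I. \<kappa> i x = coeff f [i]"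
        using A.coordinates_surj[of "coeff f []" "\<lambda>i. coeff f [i]"] by auto
      have "coeff f [i] = \<zero>" if "i \<notin> ?I" for i
        using f(1) that unfolding P_carrier by simp
      then have "h x = X"
        unfolding h_def f(2) using x f(1) s_closed by (intro coset_eq) (auto simp: coeff_s)
      then show "X \<in> h ` carrier A" using x by blast
    qed
  qed
  have "h \<in> ring_hom A B"
    by (rule ring_hom_memI) (use h_closed h_add h_mult h_one in auto)
  moreover have "bij_betw h (carrier A) (carrier B)" using inj surj by (rule bij_betw_imageI)
  moreover have "h \<in> LinearCombinations.module_hom K A B"
    unfolding LinearCombinations.module_hom_def using h_closed h_add h_smult by auto
  ultimately show ?thesis unfolding algebra_isomorphic_def ring_iso_def by blast
qed

text \<open>
  Transport the classes of the trivial path and of the arrows along the isomorphism. The coefficients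
  at words of length at most one are well defined modulo \<open>J\<close> and are dual to these \<open>n\<close> elements, which
  are therefore independent and form a basis.
\<close>

lemma square_zero_basis_of_iso:
  assumes A: "assoc_algebra K A" and fd: "vectorspace.fin_dim K A"
    and dim: "vectorspace.dim K A = n" and n: "n \<ge> 1" and iso: "algebra_isomorphic K A B"
  shows "\<exists>v. assoc_algebra.square_zero_basis K A n v"
proof -
  interpret A: assoc_algebra K A by (rule A)
  let ?I = "{2..n}"
  obtain h where iso: "h \<in> ring_iso A B" and hom: "h \<in> LinearCombinations.module_hom K A B"
    using iso unfolding algebra_isomorphic_def by blast
  have bij: "bij_betw h (carrier A) (carrier B)" using ring_iso_memE(5)[OF iso] .
  have inj: "inj_on h (carrier A)" using bij unfolding bij_betw_def by blast
  define rep where "rep x = (SOME f. f \<in> carrier P \<and> h x = J +>\<^bsub>P\<^esub> f)" for x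
  have rep: "rep x \<in> carrier P" "h x = J +>\<^bsub>P\<^esub> rep x" if "x \<in> carrier A" for x
  proof -
    have "h x \<in> carrier B" using bij that unfolding bij_betw_def by blast
    then have "\<exists>f. f \<in> carrier P \<and> h x = J +>\<^bsub>P\<^esub> f" unfolding B_simps(1) by blast
    from someI_ex[OF this] show "rep x \<in> carrier P" "h x = J +>\<^bsub>P\<^esub> rep x" unfolding rep_def by auto
  qed
  have rep_coeff: "coeff (rep x) p = coeff f p"
    if "x \<in> carrier A" "f \<in> carrier P" "h x = J +>\<^bsub>P\<^esub> f" "length p < 2" for x f p
    using J_coset_eq[OF rep(1)[OF that(1)] that(2)] rep(2)[OF that(1)] that(3,4) by simp
  let ?S = "insert [] ((\<lambda>i. [i]) ` ?I)"
  have short: "length p < 2" "set p \<subseteq> ?I" if "p \<in> ?S" for p using that by auto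
  have form: "(\<lambda>x. coeff (rep x) p) \<in> linear_forms K A" if p: "length p < 2" for p
  proof (rule linear_formI)
    show "coeff (rep x) p \<in> carrier K" if "x \<in> carrier A" for x using rep(1)[OF that] by simp
    show "coeff (rep (x \<oplus>\<^bsub>A\<^esub> y)) p = coeff (rep x) p \<oplus> coeff (rep y) p"
      if "x \<in> carrier A" "y \<in> carrier A" for x y
    proof -
      have "h (x \<oplus>\<^bsub>A\<^esub> y) = J +>\<^bsub>P\<^esub> (rep x \<oplus>\<^bsub>P\<^esub> rep y)"
        using LinearCombinations.module_hom_add[OF hom that] rep that by (simp add: B_simps)
      then show ?thesis using rep_coeff[of "x \<oplus>\<^bsub>A\<^esub> y" "rep x \<oplus>\<^bsub>P\<^esub> rep y" p] rep(1) that p by simp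
    qed
    show "coeff (rep (c \<odot>\<^bsub>A\<^esub> x)) p = c \<otimes> coeff (rep x) p" if "c \<in> carrier K" "x \<in> carrier A" for c x
    proof -
      have "h (c \<odot>\<^bsub>A\<^esub> x) = J +>\<^bsub>P\<^esub> (c \<odot>\<^bsub>P\<^esub> rep x)"
        using LinearCombinations.module_hom_smult[OF hom that] rep that by (simp add: B_simps)
      then show ?thesis using rep_coeff[of "c \<odot>\<^bsub>A\<^esub> x" "c \<odot>\<^bsub>P\<^esub> rep x" p] rep(1) that p by simp
    qed
  qed
  define e where "e p = inv_into (carrier A) h (J +>\<^bsub>P\<^esub> free_gen K ((), p, ()))" for p
  have e: "e p \<in> carrier A" "h (e p) = J +>\<^bsub>P\<^esub> free_gen K ((), p, ())" if "set p \<subseteq> ?I" for p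
  proof -
    have "J +>\<^bsub>P\<^esub> free_gen K ((), p, ()) \<in> h ` carrier A"
      using bij gen_closed[OF that] unfolding bij_betw_def B_simps(1) by blast
    then show "e p \<in> carrier A" "h (e p) = J +>\<^bsub>P\<^esub> free_gen K ((), p, ())"
      unfolding e_def by (rule inv_into_into, rule f_inv_into_f)
  qed
  have dual: "coeff (rep (e q)) p = (if p = q then \<one> else \<zero>)" if "p \<in> ?S" "q \<in> ?S" for p q
    using rep_coeff[OF e(1) gen_closed e(2), of q p] short that
    by (simp add: coeff_free_gen word_gen_def)
  note li = A.dual_family_lin_indpt[of ?S "\<lambda>p x. coeff (rep x) p" e,
      OF _ form[OF short(1)] e(1)[OF short(2)] dual]
  have eS: "e ` ?S \<subseteq> carrier A" using e(1)[OF short(2)] by blast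
  have "card (e ` ?S) = card ?S" using li(1) by (intro card_image) auto
  also have "\<dots> = n"
    using n by (subst card_insert_disjoint) (auto simp: card_image inj_on_def)
  finally have basis: "A.basis (e ` ?S)"
    using li(2) eS dim by (intro A.dim_li_is_basis[OF fd]) auto
  have "free_gen K ((), [], ()) = \<one>\<^bsub>P\<^esub>" by (rule coeff_eqI) (simp add: coeff_free_gen coeff_one)
  then have "h (e []) = h \<one>\<^bsub>A\<^esub>" using e(2)[of "[]"] ring_iso_memE(4)[OF iso] B_simps(5) by simp
  then have e_one: "e [] = \<one>\<^bsub>A\<^esub>" using inj e(1)[of "[]"] by (auto dest: inj_onD)
  have "e [i] \<otimes>\<^bsub>A\<^esub> e [j] = \<zero>\<^bsub>A\<^esub>" if ij: "i \<in> ?I" "j \<in> ?I" for i j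
  proof -
    have c: "e [i] \<in> carrier A" "e [j] \<in> carrier A" using e(1) ij by auto
    have z: "h \<zero>\<^bsub>A\<^esub> = J +>\<^bsub>P\<^esub> (\<zero> \<odot>\<^bsub>P\<^esub> rep \<zero>\<^bsub>A\<^esub>)"
      using LinearCombinations.module_hom_smult[OF hom, of \<zero> "\<zero>\<^bsub>A\<^esub>"] rep[of "\<zero>\<^bsub>A\<^esub>"] by (simp add: B_simps)
    have "h (e [i] \<otimes>\<^bsub>A\<^esub> e [j]) = (J +>\<^bsub>P\<^esub> free_gen K ((), [i], ())) \<otimes>\<^bsub>B\<^esub> (J +>\<^bsub>P\<^esub> free_gen K ((), [j], ()))"
      using ring_iso_memE(2)[OF iso c] e(2)[of "[i]"] e(2)[of "[j]"] ij by simp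
    also have "\<dots> = J +>\<^bsub>P\<^esub> (free_gen K ((), [i], ()) \<otimes>\<^bsub>P\<^esub> free_gen K ((), [j], ()))"
      using gen_closed ij by (intro B_simps(3)) auto
    also have "\<dots> = h \<zero>\<^bsub>A\<^esub>"
      unfolding z using gen_closed ij rep(1)[of "\<zero>\<^bsub>A\<^esub>"]
      by (subst J_coset_eq)
        (auto simp: P_mult_closed coeff_mult coeff_free_gen conv_word_gen, auto simp: word_gen_def)
    finally show ?thesis using inj c by (auto dest: inj_onD)
  qed
  moreover have "e ` ?S = insert \<one>\<^bsub>A\<^esub> ((\<lambda>i. e [i]) ` ?I)" using e_one by (auto simp: image_image)
  ultimately have "A.square_zero_basis n (\<lambda>i. e [i])"
    using basis unfolding A.square_zero_basis_def by simp
  then show ?thesis by blast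
qed

end

section \<open>The characterization\<close>

theorem theorem2:
  fixes K :: "('k, 'm) ring_scheme"
    and A :: "('k, 'a, 'l) module_scheme"
    and n :: nat
  assumes "assoc_algebra K A"
    and "vectorspace.fin_dim K A"
    and "vectorspace.dim K A = n"
    and "n \<ge> 3"
  shows "(Frobdim K A = (n - 1)\<^sup>2
           \<longleftrightarrow> (\<exists>v :: nat \<Rightarrow> 'a.
                  vectorspace.basis K A (insert \<one>\<^bsub>A\<^esub> (v ` {2..n})) \<and>
                  (\<forall>i\<in>{2..n}. \<forall>j\<in>{2..n}. v i \<otimes>\<^bsub>A\<^esub> v j = \<zero>\<^bsub>A\<^esub>)))
       \<and> ((\<exists>v :: nat \<Rightarrow> 'a.
                  vectorspace.basis K A (insert \<one>\<^bsub>A\<^esub> (v ` {2..n})) \<and>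
                  (\<forall>i\<in>{2..n}. \<forall>j\<in>{2..n}. v i \<otimes>\<^bsub>A\<^esub> v j = \<zero>\<^bsub>A\<^esub>))
           \<longleftrightarrow> algebra_isomorphic K A (radical_square_zero_algebra K (loop_quiver n)))"
proof -
  interpret A: assoc_algebra K A by (rule assms(1))
  interpret Q: loop_path_algebra K n by (rule loop_path_algebra.intro) (rule A.R.cring_axioms)
  note n = \<open>n \<ge> 3\<close>
  have n1: "n \<ge> 1" using n by simp
  have "A.square_zero_basis n v \<Longrightarrow> Frobdim K A = (n - 1)\<^sup>2" for v
    using A.square_zero_basis_coordinates[OF assms(3) n1]
      square_zero_coordinates.Frobdim_square_zero[OF _ assms(2) n] by metis
  moreover have "A.square_zero_basis n v \<Longrightarrow> algebra_isomorphic K A Q.B" for v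
    using A.square_zero_basis_coordinates[OF assms(3) n1] Q.iso_of_square_zero_coordinates by metis
  ultimately show ?thesis
    using A.square_zero_of_Frobdim[OF assms(2,3) n]
      Q.square_zero_basis_of_iso[OF assms(1-3) n1]
    unfolding A.square_zero_basis_def by blast
qed

end
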